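(* Let $X$ be an $8$-dimensional Riemannian spin manifold. Then $$\left\{\widehat{A}(TX)\,\mathrm{ch}(\triangle(X))\,\mathrm{ch}(2\widetilde{T_{\mathbb C}X})+32\,\widehat{A}(TX)\,\mathrm{ch}(\widetilde{T_{\mathbb C}X}+\wedge^2\widetilde{T_{\mathbb C}X})\right\}^{(8)}=240\left\{\widehat{A}(TX)\,\mathrm{ch}(\triangle(X))+32\,\widehat{A}(TX)\right\}^{(8)}$$ and $$\Big\{\widehat{A}(TX)\,\mathrm{ch}(\triangle(X))\,\mathrm{ch}\big(2\widetilde{T_{\mathbb C}X}+\wedge^2\widetilde{T_{\mathbb C}X}+\widetilde{T_{\mathbb C}X}\otimes\widetilde{T_{\mathbb C}X}+S^2\widetilde{T_{\mathbb C}X}\big)$$ $$+32\,\widehat{A}(TX)\,\mathrm{ch}\big(\wedge^4\widetilde{T_{\mathbb C}X}+\wedge^2\widetilde{T_{\mathbb C}X}\otimes\widetilde{T_{\mathbb C}X}+\widetilde{T_{\mathbb C}X}\otimes\widetilde{T_{\mathbb C}X}+S^2\widetilde{T_{\mathbb C}X}+\widetilde{T_{\mathbb C}X}\big)\Big\}^{(8)}$$ $$=2160\left\{\widehat{A}(TX)\,\mathrm{ch}(\triangle(X))+32\,\widehat{A}(TX)\right\}^{(8)}.$$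
   Context: $\nabla^{TX}$ is the Levi-Civita connection of $X$, $R^{TX}=(\nabla^{TX})^2$ its curvature, and $\widehat{A}(TX)=\widehat{A}(TX,\nabla^{TX})=\det^{1/2}\left(\frac{\frac{\sqrt{-1}}{4\pi}R^{TX}}{\sinh(\frac{\sqrt{-1}}{4\pi}R^{TX})}\right)$. $\triangle(X)$ is the (full, ungraded) complex spinor bundle of $X$. $T_{\mathbb C}X=TX\otimes\mathbb C$ and $\widetilde{T_{\mathbb C}X}=T_{\mathbb C}X-\dim X$ (virtual bundle of rank $0$, subtracting the trivial bundle of rank $\dim X$). $\mathrm{ch}(E)=\mathrm{tr}\exp(\frac{\sqrt{-1}}{2\pi}R^E)$ is the Chern character form for the connections induced by $\nabla^{TX}$, extended additively to virtual bundles. For a virtual bundle $W=E-F$, $\wedge^iW$ and $S^iW$ are the coefficients of $t^i$ in $\wedge_t(W)=\wedge_t(E)/\wedge_t(F)$ and $S_t(W)=S_t(E)/S_t(F)$, where $\wedge_t(E)=\sum_i t^i\wedge^iE$ and $S_t(E)=\sum_i t^iS^iE$. $\{\cdot\}^{(p)}$ denotes the degree-$p$ component of a differential form. *)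

theory Defs
  imports
    "HOL-Analysis.Analysis"
    "HOL-Computational_Algebra.Formal_Power_Series"
    "Jordan_Normal_Form.Determinant"
begin

text \<open>
  Matrices with the notation \<open>$$\<close> are those of \<open>Jordan_Normal_Form\<close>; the types
  \<open>real ^ 'n\<close> and \<open>real ^ 'n ^ 'n\<close> are those of \<open>HOL-Analysis\<close>.
\<close>


section \<open>Complex exterior forms of even degree\<close>

text \<open>
  All characteristic forms have even degree, and even forms commute.  A form at a point of a chart
  with coordinates \<open>x\<^sub>k\<close>, \<open>k :: 'n\<close>, is given by its coefficients: \<open>coeff_form \<alpha> K\<close> is the
  coefficient of \<open>dx\<^sub>k\<^sub>1 \<and> \<dots> \<and> dx\<^sub>k\<^sub>p\<close> where \<open>K = {k\<^sub>1 < \<dots> < k\<^sub>p}\<close>.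
\<close>

typedef (overloaded) 'n evform = "{\<alpha> :: 'n set \<Rightarrow> complex. \<forall>K. odd (card K) \<longrightarrow> \<alpha> K = 0}"
  morphisms coeff_form Abs_evform
  by (rule exI[of _ "\<lambda>_. 0"]) simp

setup_lifting type_definition_evform

lemma coeff_form_odd [simp]: "odd (card K) \<Longrightarrow> coeff_form \<alpha> K = 0"
  by transfer blast

lemma evform_eqI: "(\<And>K. coeff_form \<alpha> K = coeff_form \<beta> K) \<Longrightarrow> \<alpha> = \<beta>"
  by transfer blast

text \<open>The sign in \<open>dx\<^sub>J \<and> dx\<^sub>K = wedge_sign J K dx\<^sub>J\<^sub>\<union>\<^sub>K\<close> for disjoint \<open>J\<close> and \<open>K\<close>.\<close>

definition wedge_sign :: "'n::linorder set \<Rightarrow> 'n set \<Rightarrow> complex" where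
  "wedge_sign J K = (- 1) ^ card {(j, k). j \<in> J \<and> k \<in> K \<and> k < j}"

lemma wedge_sign_Un_right:
  fixes J :: "'n::{finite,linorder} set"
  assumes "K \<inter> L = {}"
  shows "wedge_sign J (K \<union> L) = wedge_sign J K * wedge_sign J L"
proof -
  have "{(j, k). j \<in> J \<and> k \<in> K \<union> L \<and> k < j}
      = {(j, k). j \<in> J \<and> k \<in> K \<and> k < j} \<union> {(j, k). j \<in> J \<and> k \<in> L \<and> k < j}" by auto
  moreover have "{(j, k). j \<in> J \<and> k \<in> K \<and> k < j} \<inter> {(j, k). j \<in> J \<and> k \<in> L \<and> k < j} = {}"
    using assms by auto
  ultimately show ?thesis
    by (simp add: wedge_sign_def card_Un_disjoint power_add)
qed

lemma wedge_sign_Un_left: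
  fixes J :: "'n::{finite,linorder} set"
  assumes "J \<inter> K = {}"
  shows "wedge_sign (J \<union> K) L = wedge_sign J L * wedge_sign K L"
proof -
  have "{(j, k). j \<in> J \<union> K \<and> k \<in> L \<and> k < j}
      = {(j, k). j \<in> J \<and> k \<in> L \<and> k < j} \<union> {(j, k). j \<in> K \<and> k \<in> L \<and> k < j}" by auto
  moreover have "{(j, k). j \<in> J \<and> k \<in> L \<and> k < j} \<inter> {(j, k). j \<in> K \<and> k \<in> L \<and> k < j} = {}"
    using assms by auto
  ultimately show ?thesis
    by (simp add: wedge_sign_def card_Un_disjoint power_add)
qed

lemma wedge_sign_commute:
  fixes J :: "'n::{finite,linorder} set"
  assumes "J \<inter> K = {}" and "even (card J)"
  shows "wedge_sign J K = wedge_sign K J"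
proof -
  let ?A = "{(j, k). j \<in> J \<and> k \<in> K \<and> k < j}"
  let ?B = "{(j, k). j \<in> J \<and> k \<in> K \<and> j < k}"
  let ?C = "{(k, j). k \<in> K \<and> j \<in> J \<and> j < k}"
  have "?A \<union> ?B = J \<times> K"
    using assms(1) by (auto simp: not_less)
  moreover have "?A \<inter> ?B = {}" by auto
  ultimately have "card ?A + card ?B = card J * card K"
    using card_Un_disjoint[of ?A ?B] by (simp add: card_cartesian_product)
  moreover have "card ?B = card ?C"
    by (rule bij_betw_same_card[of prod.swap]) (auto simp: bij_betw_def inj_on_def image_def)
  ultimately have "even (card ?A + card ?C)" using assms by simp
  then have "(-1 :: complex) ^ card ?A = (-1) ^ card ?C"
    by (auto simp: uminus_power_if)
  then show ?thesis by (simp add: wedge_sign_def)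
qed

lemma wedge_sign_empty [simp]: "wedge_sign {} K = 1" "wedge_sign J {} = 1"
  by (simp_all add: wedge_sign_def)

lemma even_card_split:
  fixes K :: "'n::finite set"
  assumes "J \<subseteq> K" "odd (card K)"
  shows "odd (card J) \<or> odd (card (K - J))"
proof -
  have "card K = card J + card (K - J)"
    using assms by (metis card_Diff_subset card_mono finite_class.finite_code le_add_diff_inverse)
  then show ?thesis using assms by auto
qed

instantiation evform :: ("{finite,linorder}") comm_ring_1
begin

lift_definition zero_evform :: "'a evform" is "\<lambda>_. 0" by simp
lift_definition one_evform :: "'a evform" is "\<lambda>K. if K = {} then 1 else 0" by auto
lift_definition plus_evform :: "'a evform \<Rightarrow> 'a evform \<Rightarrow> 'a evform" is "\<lambda>\<alpha> \<beta> K. \<alpha> K + \<beta> K" by simp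
lift_definition minus_evform :: "'a evform \<Rightarrow> 'a evform \<Rightarrow> 'a evform" is "\<lambda>\<alpha> \<beta> K. \<alpha> K - \<beta> K" by simp
lift_definition uminus_evform :: "'a evform \<Rightarrow> 'a evform" is "\<lambda>\<alpha> K. - \<alpha> K" by simp
lift_definition times_evform :: "'a evform \<Rightarrow> 'a evform \<Rightarrow> 'a evform"
  is "\<lambda>\<alpha> \<beta> K. \<Sum>J\<in>Pow K. wedge_sign J (K - J) * \<alpha> J * \<beta> (K - J)"
  by (intro sum.neutral ballI) (metis PowD even_card_split mult_zero_left mult_zero_right)

instance
proof
  fix \<alpha> \<beta> \<gamma> :: "'a evform"
  show "\<alpha> + \<beta> + \<gamma> = \<alpha> + (\<beta> + \<gamma>)" by transfer (simp add: add.assoc)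
  show "\<alpha> + \<beta> = \<beta> + \<alpha>" by transfer (simp add: add.commute)
  show "0 + \<alpha> = \<alpha>" by transfer simp
  show "- \<alpha> + \<alpha> = 0" by transfer simp
  show "\<alpha> - \<beta> = \<alpha> + - \<beta>" by transfer simp
  show "(0 :: 'a evform) \<noteq> 1" by transfer (metis zero_neq_one)
  show "(\<alpha> + \<beta>) * \<gamma> = \<alpha> * \<gamma> + \<beta> * \<gamma>"
    by transfer (simp add: algebra_simps sum.distrib)
  show "1 * \<alpha> = \<alpha>"
  proof transfer
    fix \<alpha> :: "'a set \<Rightarrow> complex"
    show "(\<lambda>K. \<Sum>J\<in>Pow K. wedge_sign J (K - J) * (if J = {} then 1 else 0) * \<alpha> (K - J)) = \<alpha>"
    proof
      fix K :: "'a set"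
      have "(\<Sum>J\<in>Pow K. wedge_sign J (K - J) * (if J = {} then 1 else 0) * \<alpha> (K - J))
          = (\<Sum>J\<in>Pow K. if J = {} then \<alpha> K else 0)" by (intro sum.cong) auto
      then show "(\<Sum>J\<in>Pow K. wedge_sign J (K - J) * (if J = {} then 1 else 0) * \<alpha> (K - J)) = \<alpha> K"
        by simp
    qed
  qed
  show "\<alpha> * \<beta> = \<beta> * \<alpha>"
  proof transfer
    fix \<alpha> \<beta> :: "'a set \<Rightarrow> complex"
    assume \<alpha>: "\<forall>K. odd (card K) \<longrightarrow> \<alpha> K = 0"
    show "(\<lambda>K. \<Sum>J\<in>Pow K. wedge_sign J (K - J) * \<alpha> J * \<beta> (K - J))
        = (\<lambda>K. \<Sum>J\<in>Pow K. wedge_sign J (K - J) * \<beta> J * \<alpha> (K - J))"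
    proof
      fix K :: "'a set"
      have "wedge_sign J (K - J) * \<alpha> J * \<beta> (K - J) = wedge_sign (K - J) J * \<beta> (K - J) * \<alpha> J" for J
        using \<alpha> wedge_sign_commute[of J "K - J"] by (cases "even (card J)") auto
      then have "(\<Sum>J\<in>Pow K. wedge_sign J (K - J) * \<alpha> J * \<beta> (K - J))
          = (\<Sum>J\<in>Pow K. wedge_sign (K - J) J * \<beta> (K - J) * \<alpha> J)" by (intro sum.cong refl)
      also have "\<dots> = (\<Sum>J\<in>Pow K. wedge_sign J (K - J) * \<beta> J * \<alpha> (K - J))"
        by (rule sum.reindex_bij_witness[of _ "\<lambda>J. K - J" "\<lambda>J. K - J"])
           (auto simp: double_diff)
      finally show "(\<Sum>J\<in>Pow K. wedge_sign J (K - J) * \<alpha> J * \<beta> (K - J))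
          = (\<Sum>J\<in>Pow K. wedge_sign J (K - J) * \<beta> J * \<alpha> (K - J))" .
    qed
  qed
  show "\<alpha> * \<beta> * \<gamma> = \<alpha> * (\<beta> * \<gamma>)"
  proof transfer
    fix \<alpha> \<beta> \<gamma> :: "'a set \<Rightarrow> complex"
    show "(\<lambda>K. \<Sum>J\<in>Pow K. wedge_sign J (K - J) *
              (\<Sum>L\<in>Pow J. wedge_sign L (J - L) * \<alpha> L * \<beta> (J - L)) * \<gamma> (K - J))
        = (\<lambda>K. \<Sum>L\<in>Pow K. wedge_sign L (K - L) * \<alpha> L *
              (\<Sum>M\<in>Pow (K - L). wedge_sign M (K - L - M) * \<beta> M * \<gamma> (K - L - M)))"
    proof
      fix K :: "'a set"
      have eq: "wedge_sign J (K - J) * (wedge_sign L (J - L) * \<alpha> L * \<beta> (J - L)) * \<gamma> (K - J)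
          = wedge_sign L (K - L) * \<alpha> L *
            (wedge_sign (J - L) (K - L - (J - L)) * \<beta> (J - L) * \<gamma> (K - L - (J - L)))"
        if "L \<subseteq> J" "J \<subseteq> K" for J L
      proof -
        have d: "K - L - (J - L) = K - J" using that by auto
        have "wedge_sign (L \<union> (J - L)) (K - J) = wedge_sign L (K - J) * wedge_sign (J - L) (K - J)"
          by (rule wedge_sign_Un_left) auto
        moreover have "L \<union> (J - L) = J" using that by auto
        moreover have "wedge_sign L ((J - L) \<union> (K - J)) = wedge_sign L (J - L) * wedge_sign L (K - J)"
          by (rule wedge_sign_Un_right) auto
        moreover have "(J - L) \<union> (K - J) = K - L" using that by auto
        ultimately show ?thesis unfolding d by (simp add: mult_ac)
      qed
      have "(\<Sum>J\<in>Pow K. wedge_sign J (K - J) *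
              (\<Sum>L\<in>Pow J. wedge_sign L (J - L) * \<alpha> L * \<beta> (J - L)) * \<gamma> (K - J))
          = (\<Sum>(J, L)\<in>Sigma (Pow K) Pow. wedge_sign J (K - J) *
              (wedge_sign L (J - L) * \<alpha> L * \<beta> (J - L)) * \<gamma> (K - J))"
        by (simp add: sum.Sigma sum_distrib_left sum_distrib_right)
      also have "\<dots> = (\<Sum>(L, M)\<in>Sigma (Pow K) (\<lambda>L. Pow (K - L)). wedge_sign L (K - L) * \<alpha> L *
              (wedge_sign M (K - L - M) * \<beta> M * \<gamma> (K - L - M)))"
      proof (rule sum.reindex_bij_witness[of _ "\<lambda>(L, M). (L \<union> M, L)" "\<lambda>(J, L). (L, J - L)"], goal_cases)
        case (5 JL)
        then show ?case
          by (cases JL) (simp only: prod.case eq mem_Sigma_iff Pow_iff)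
      qed auto
      also have "\<dots> = (\<Sum>L\<in>Pow K. wedge_sign L (K - L) * \<alpha> L *
              (\<Sum>M\<in>Pow (K - L). wedge_sign M (K - L - M) * \<beta> M * \<gamma> (K - L - M)))"
        by (simp add: sum.Sigma sum_distrib_left)
      finally show "(\<Sum>J\<in>Pow K. wedge_sign J (K - J) *
              (\<Sum>L\<in>Pow J. wedge_sign L (J - L) * \<alpha> L * \<beta> (J - L)) * \<gamma> (K - J)) = \<dots>" .
    qed
  qed
qed

end

lift_definition const_form :: "complex \<Rightarrow> 'n::{finite,linorder} evform"
  is "\<lambda>z K. if K = {} then z else 0" by auto

text \<open>\<open>form2 B\<close> is \<open>\<Sum>\<^sub>k\<^sub><\<^sub>l B\<^sub>k\<^sub>l dx\<^sub>k \<and> dx\<^sub>l\<close>.\<close>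

lift_definition form2 :: "('n \<Rightarrow> 'n \<Rightarrow> complex) \<Rightarrow> 'n::{finite,linorder} evform"
  is "\<lambda>B K. if card K = 2 then B (Min K) (Max K) else 0" by auto

lift_definition deg_part :: "nat \<Rightarrow> 'n evform \<Rightarrow> 'n::{finite,linorder} evform"
  is "\<lambda>p \<alpha> K. if card K = p then \<alpha> K else 0" by auto


section \<open>Power series of forms and of matrices of forms\<close>

text \<open>
  These are applied to (matrices of) forms without component of degree \<open>0\<close>, whose powers with
  exponent \<open>k > CARD('n)\<close> vanish (already those with \<open>2 k > CARD('n)\<close>); the sums are the full series.
\<close>

definition fps_form :: "complex fps \<Rightarrow> 'n::{finite,linorder} evform \<Rightarrow> 'n evform" where
  "fps_form f \<alpha> = (\<Sum>k\<le>CARD('n). const_form (fps_nth f k) * \<alpha> ^ k)"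

definition fps_mat :: "complex fps \<Rightarrow> 'n::{finite,linorder} evform mat \<Rightarrow> 'n evform mat" where
  "fps_mat f R = Matrix.mat (dim_row R) (dim_row R)
     (\<lambda>(i, j). \<Sum>k\<le>CARD('n). const_form (fps_nth f k) * (R ^\<^sub>m k) $$ (i, j))"

definition tr :: "'a::comm_monoid_add mat \<Rightarrow> 'a" where
  "tr A = (\<Sum>i<dim_row A. A $$ (i, i))"

definition fps_z_over_sinh :: "complex fps" where
  "fps_z_over_sinh = fps_X / (fps_const (1 / 2) * (fps_exp 1 - fps_exp (- 1)))"


section \<open>Riemannian manifolds\<close>

primrec Ck_on :: "nat \<Rightarrow> ('a::real_normed_vector \<Rightarrow> 'b::real_normed_vector) \<Rightarrow> 'a set \<Rightarrow> bool" where
  "Ck_on 0 f S \<longleftrightarrow> continuous_on S f"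
| "Ck_on (Suc k) f S \<longleftrightarrow>
     f differentiable_on S \<and> (\<forall>v. Ck_on k (\<lambda>x. frechet_derivative f (at x) v) S)"

text \<open>Used on open subsets of \<open>real ^ 'n\<close> only.\<close>

definition smooth_on :: "('a::real_normed_vector \<Rightarrow> 'b::real_normed_vector) \<Rightarrow> 'a set \<Rightarrow> bool" where
  "smooth_on f S \<longleftrightarrow> (\<forall>k. Ck_on k f S)"

definition pderiv_at :: "'n \<Rightarrow> (real ^ 'n \<Rightarrow> 'b::real_normed_vector) \<Rightarrow> real ^ 'n \<Rightarrow> 'b" where
  "pderiv_at k f x = frechet_derivative f (at x) (axis k 1)"

text \<open>The coordinate change from the chart \<open>b\<close> to the chart \<open>a\<close>.\<close>

definition coord_change ::
    "('i \<Rightarrow> 'm set) \<Rightarrow> ('i \<Rightarrow> 'm \<Rightarrow> real ^ 'n) \<Rightarrow> 'i \<Rightarrow> 'i \<Rightarrow> real ^ 'n \<Rightarrow> real ^ 'n" where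
  "coord_change U \<phi> a b = \<phi> a \<circ> inv_into (U b) (\<phi> b)"

locale smooth_manifold =
  fixes I :: "'i set"
    and U :: "'i \<Rightarrow> 'm::{t2_space,second_countable_topology} set"
    and \<phi> :: "'i \<Rightarrow> 'm \<Rightarrow> real ^ 'n"
  assumes open_domain: "a \<in> I \<Longrightarrow> open (U a)"
    and cover: "(\<Union>a\<in>I. U a) = UNIV"
    and open_range: "a \<in> I \<Longrightarrow> open (\<phi> a ` U a)"
    and chart: "a \<in> I \<Longrightarrow> homeomorphism (U a) (\<phi> a ` U a) (\<phi> a) (inv_into (U a) (\<phi> a))"
    and smooth_change: "a \<in> I \<Longrightarrow> b \<in> I \<Longrightarrow> smooth_on (coord_change U \<phi> a b) (\<phi> b ` (U a \<inter> U b))"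

text \<open>
  \<open>g a x\<close> is the Gram matrix of the coordinate vector fields of the chart \<open>a\<close> at the point with
  coordinates \<open>x\<close>.
\<close>

locale riemannian_manifold = smooth_manifold I U \<phi>
  for I :: "'i set" and U :: "'i \<Rightarrow> 'm::{t2_space,second_countable_topology} set"
    and \<phi> :: "'i \<Rightarrow> 'm \<Rightarrow> real ^ 'n" +
  fixes g :: "'i \<Rightarrow> real ^ 'n \<Rightarrow> real ^ 'n ^ 'n"
  assumes smooth_metric: "a \<in> I \<Longrightarrow> smooth_on (g a) (\<phi> a ` U a)"
    and sym_metric: "a \<in> I \<Longrightarrow> x \<in> \<phi> a ` U a \<Longrightarrow> Finite_Cartesian_Product.transpose (g a x) = g a x"
    and pos_metric: "a \<in> I \<Longrightarrow> x \<in> \<phi> a ` U a \<Longrightarrow> v \<noteq> 0 \<Longrightarrow> v \<bullet> (g a x *v v) > 0"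
    and metric_change: "a \<in> I \<Longrightarrow> b \<in> I \<Longrightarrow> p \<in> U a \<inter> U b \<Longrightarrow>
      D = frechet_derivative (coord_change U \<phi> a b) (at (\<phi> b p)) \<Longrightarrow>
      u \<bullet> (g b (\<phi> b p) *v v) = D u \<bullet> (g a (\<phi> a p) *v D v)"

text \<open>
  The Levi-Civita connection as the torsion-free metric connection, in the coordinates of each
  chart: \<open>\<nabla>\<^sub>k v = \<partial>\<^sub>k v + \<Gamma>\<^sub>k v\<close>.  Its behaviour under coordinate changes follows from
  uniqueness.
\<close>

locale levi_civita = riemannian_manifold I U \<phi> g
  for I :: "'i set" and U :: "'i \<Rightarrow> 'm::{t2_space,second_countable_topology} set"
    and \<phi> :: "'i \<Rightarrow> 'm \<Rightarrow> real ^ 'n" and g :: "'i \<Rightarrow> real ^ 'n \<Rightarrow> real ^ 'n ^ 'n" +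
  fixes \<Gamma> :: "'i \<Rightarrow> 'n \<Rightarrow> real ^ 'n \<Rightarrow> real ^ 'n ^ 'n"
  assumes smooth_connection: "a \<in> I \<Longrightarrow> smooth_on (\<Gamma> a k) (\<phi> a ` U a)"
    and torsion_free: "a \<in> I \<Longrightarrow> x \<in> \<phi> a ` U a \<Longrightarrow> \<Gamma> a k x *v axis l 1 = \<Gamma> a l x *v axis k 1"
    and metric_connection: "a \<in> I \<Longrightarrow> x \<in> \<phi> a ` U a \<Longrightarrow>
      pderiv_at k (\<lambda>y. u \<bullet> (g a y *v v)) x
        = (\<Gamma> a k x *v u) \<bullet> (g a x *v v) + u \<bullet> (g a x *v (\<Gamma> a k x *v v))"


section \<open>Vector bundles with connection and their characteristic forms\<close>

text \<open>
  A complex vector bundle with connection, trivialised over each chart domain: \<open>transition E a b p\<close> maps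
  components with respect to the frame over \<open>U b\<close> to components with respect to the frame over
  \<open>U a\<close>, and \<open>conn E a k x\<close> is the \<open>dx\<^sub>k\<close>-component of the connection matrix over \<open>U a\<close>, that is
  \<open>\<nabla>\<^sub>k s\<^sub>j = \<Sum>\<^sub>i conn E a k x $$ (i, j) s\<^sub>i\<close> for the frame \<open>(s\<^sub>j)\<close>.
\<close>

datatype ('i, 'm, 'n) vbundle = Bundle
  (rank: nat)
  (transition: "'i \<Rightarrow> 'i \<Rightarrow> 'm \<Rightarrow> complex mat")
  (conn: "'i \<Rightarrow> 'n \<Rightarrow> real ^ 'n \<Rightarrow> complex mat")

definition curvature_coeff ::
    "('i, 'm, 'n) vbundle \<Rightarrow> 'i \<Rightarrow> real ^ ('n::{finite,linorder}) \<Rightarrow> 'n \<Rightarrow> 'n \<Rightarrow> nat \<Rightarrow> nat \<Rightarrow> complex" where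
  "curvature_coeff E a x k l i j =
     pderiv_at k (\<lambda>y. conn E a l y $$ (i, j)) x - pderiv_at l (\<lambda>y. conn E a k y $$ (i, j)) x
     + (conn E a k x * conn E a l x - conn E a l x * conn E a k x) $$ (i, j)"

definition curvature ::
    "('i, 'm, 'n) vbundle \<Rightarrow> 'i \<Rightarrow> real ^ ('n::{finite,linorder}) \<Rightarrow> 'n evform mat" where
  "curvature E a x = Matrix.mat (rank E) (rank E)
     (\<lambda>(i, j). form2 (\<lambda>k l. curvature_coeff E a x k l i j))"

definition ch_bundle ::
    "('i, 'm, 'n) vbundle \<Rightarrow> 'i \<Rightarrow> real ^ ('n::{finite,linorder}) \<Rightarrow> 'n evform" where
  "ch_bundle E a x = tr (fps_mat (fps_exp 1) (const_form (\<i> / (2 * pi)) \<cdot>\<^sub>m curvature E a x))"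

text \<open>\<open>det\<^sup>1\<^sup>/\<^sup>2\<close> is the square root with constant term \<open>1\<close>, given by the binomial series.\<close>

definition A_hat ::
    "('i, 'm, 'n) vbundle \<Rightarrow> 'i \<Rightarrow> real ^ ('n::{finite,linorder}) \<Rightarrow> 'n evform" where
  "A_hat E a x = fps_form (fps_binomial (1 / 2))
     (Determinant.det (fps_mat fps_z_over_sinh (const_form (\<i> / (4 * pi)) \<cdot>\<^sub>m curvature E a x)) - 1)"


subsection \<open>Operations on bundles, with the induced connections\<close>

definition triv_bundle :: "nat \<Rightarrow> ('i, 'm, 'n::finite) vbundle" where
  "triv_bundle r = Bundle r (\<lambda>a b p. 1\<^sub>m r) (\<lambda>a k x. 0\<^sub>m r r)"

definition block_diag :: "'a::zero mat \<Rightarrow> 'a mat \<Rightarrow> 'a mat" where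
  "block_diag A B =
     four_block_mat A (0\<^sub>m (dim_row A) (dim_col B)) (0\<^sub>m (dim_row B) (dim_col A)) B"

definition kron :: "'a::times mat \<Rightarrow> 'a mat \<Rightarrow> 'a mat" where
  "kron A B = Matrix.mat (dim_row A * dim_row B) (dim_col A * dim_col B)
     (\<lambda>(i, j). A $$ (i div dim_row B, j div dim_col B) * B $$ (i mod dim_row B, j mod dim_col B))"

definition sum_bundle ::
    "('i, 'm, 'n::finite) vbundle \<Rightarrow> ('i, 'm, 'n::finite) vbundle \<Rightarrow> ('i, 'm, 'n::finite) vbundle" where
  "sum_bundle E F = Bundle (rank E + rank F)
     (\<lambda>a b p. block_diag (transition E a b p) (transition F a b p))
     (\<lambda>a k x. block_diag (conn E a k x) (conn F a k x))"

definition tensor_bundle ::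
    "('i, 'm, 'n::finite) vbundle \<Rightarrow> ('i, 'm, 'n::finite) vbundle \<Rightarrow> ('i, 'm, 'n::finite) vbundle" where
  "tensor_bundle E F = Bundle (rank E * rank F)
     (\<lambda>a b p. kron (transition E a b p) (transition F a b p))
     (\<lambda>a k x. kron (conn E a k x) (1\<^sub>m (rank F)) + kron (1\<^sub>m (rank E)) (conn F a k x))"

text \<open>
  Index lists \<open>[i\<^sub>1, \<dots>, i\<^sub>d]\<close> of the basis vectors \<open>e\<^sub>i\<^sub>1 \<and> \<dots> \<and> e\<^sub>i\<^sub>d\<close> of the exterior power and
  \<open>e\<^sub>i\<^sub>1 \<dots> e\<^sub>i\<^sub>d\<close> of the symmetric power.
\<close>

definition ext_basis :: "nat \<Rightarrow> nat \<Rightarrow> nat list list" where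
  "ext_basis d r = filter (sorted_wrt (<)) (List.n_lists d [0..<r])"

definition sym_basis :: "nat \<Rightarrow> nat \<Rightarrow> nat list list" where
  "sym_basis d r = filter sorted (List.n_lists d [0..<r])"

text \<open>
  For matrices \<open>M\<^sub>0, \<dots>, M\<^sub>d\<^sub>-\<^sub>1\<close>, the coefficients of the basis vector with index list \<open>J\<close> in
  \<open>M\<^sub>0 e\<^sub>i\<^sub>1 \<and> \<dots> \<and> M\<^sub>d\<^sub>-\<^sub>1 e\<^sub>i\<^sub>d\<close> and in \<open>M\<^sub>0 e\<^sub>i\<^sub>1 \<dots> M\<^sub>d\<^sub>-\<^sub>1 e\<^sub>i\<^sub>d\<close>, respectively.
\<close>

definition ext_coeff :: "nat \<Rightarrow> (nat \<Rightarrow> 'a::comm_ring_1 mat) \<Rightarrow> nat list \<Rightarrow> nat list \<Rightarrow> 'a" where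
  "ext_coeff d M J K = Determinant.det (Matrix.mat d d (\<lambda>(s, t). M t $$ (J ! s, K ! t)))"

definition sym_coeff :: "nat \<Rightarrow> (nat \<Rightarrow> 'a::comm_ring_1 mat) \<Rightarrow> nat list \<Rightarrow> nat list \<Rightarrow> 'a" where
  "sym_coeff d M J K = (\<Sum>L | mset L = mset J. \<Prod>t<d. M t $$ (L ! t, K ! t))"

text \<open>The transition matrix acts on all factors; the connection acts by the Leibniz rule.\<close>

definition power_bundle ::
    "(nat \<Rightarrow> (nat \<Rightarrow> complex mat) \<Rightarrow> nat list \<Rightarrow> nat list \<Rightarrow> complex) \<Rightarrow> (nat \<Rightarrow> nat \<Rightarrow> nat list list)
      \<Rightarrow> nat \<Rightarrow> ('i, 'm, 'n::finite) vbundle \<Rightarrow> ('i, 'm, 'n::finite) vbundle" where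
  "power_bundle coe basis d E =
     (let B = basis d (rank E); N = length B in
      Bundle N
        (\<lambda>a b p. Matrix.mat N N (\<lambda>(i, j). coe d (\<lambda>t. transition E a b p) (B ! i) (B ! j)))
        (\<lambda>a k x. Matrix.mat N N (\<lambda>(i, j).
           \<Sum>s<d. coe d (\<lambda>t. if t = s then conn E a k x else 1\<^sub>m (rank E)) (B ! i) (B ! j))))"

definition ext_bundle :: "nat \<Rightarrow> ('i, 'm, 'n::finite) vbundle \<Rightarrow> ('i, 'm, 'n::finite) vbundle" where
  "ext_bundle = power_bundle ext_coeff ext_basis"

definition sym_bundle :: "nat \<Rightarrow> ('i, 'm, 'n::finite) vbundle \<Rightarrow> ('i, 'm, 'n::finite) vbundle" where
  "sym_bundle = power_bundle sym_coeff sym_basis"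


subsection \<open>Virtual bundles\<close>

text \<open>\<open>Diff E F\<close> is the formal difference \<open>E - F\<close>.\<close>

datatype ('i, 'm, 'n) virt = Diff "('i, 'm, 'n::finite) vbundle" "('i, 'm, 'n) vbundle"

definition virt_of :: "('i, 'm, 'n::finite) vbundle \<Rightarrow> ('i, 'm, 'n) virt" where
  "virt_of E = Diff E (triv_bundle 0)"

instantiation virt :: (type, type, finite) "{zero,one,plus,uminus,times}"
begin

definition zero_virt :: "('a, 'b, 'c) virt" where
  "zero_virt = virt_of (triv_bundle 0)"

definition one_virt :: "('a, 'b, 'c) virt" where
  "one_virt = virt_of (triv_bundle 1)"

fun plus_virt :: "('a, 'b, 'c) virt \<Rightarrow> ('a, 'b, 'c) virt \<Rightarrow> ('a, 'b, 'c) virt" where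
  "Diff E F + Diff E' F' = Diff (sum_bundle E E') (sum_bundle F F')"

fun uminus_virt :: "('a, 'b, 'c) virt \<Rightarrow> ('a, 'b, 'c) virt" where
  "- Diff E F = Diff F E"

fun times_virt :: "('a, 'b, 'c) virt \<Rightarrow> ('a, 'b, 'c) virt \<Rightarrow> ('a, 'b, 'c) virt" where
  "Diff E F * Diff E' F' =
     Diff (sum_bundle (tensor_bundle E E') (tensor_bundle F F'))
          (sum_bundle (tensor_bundle E F') (tensor_bundle F E'))"

instance ..

end

definition virt_sum :: "('i, 'm, 'n::finite) virt list \<Rightarrow> ('i, 'm, 'n) virt" where
  "virt_sum Vs = foldr (+) Vs 0"

text \<open>
  Power series \<open>\<Sum>\<^sub>i t\<^sup>i V\<^sub>i\<close> of virtual bundles are sequences.  The inverse is that of a series with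
  \<open>V\<^sub>0 = 1\<close>: in K-theory it satisfies \<open>W\<^sub>0 = 1\<close> and \<open>\<Sum>\<^sub>j\<^sub>\<le>\<^sub>n V\<^sub>j W\<^sub>n\<^sub>-\<^sub>j = 0\<close> for \<open>n > 0\<close>.
\<close>

fun series_inverse :: "(nat \<Rightarrow> ('i, 'm, 'n::finite) virt) \<Rightarrow> nat \<Rightarrow> ('i, 'm, 'n) virt" where
  "series_inverse V 0 = 1"
| "series_inverse V (Suc n) = - virt_sum (map (\<lambda>j. V (Suc j) * series_inverse V (n - j)) [0..<Suc n])"

definition series_quotient ::
    "(nat \<Rightarrow> ('i, 'm, 'n::finite) virt) \<Rightarrow> (nat \<Rightarrow> ('i, 'm, 'n) virt) \<Rightarrow> nat \<Rightarrow> ('i, 'm, 'n) virt" where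
  "series_quotient V W n = virt_sum (map (\<lambda>j. V j * series_inverse W (n - j)) [0..<Suc n])"

fun ext_virt :: "nat \<Rightarrow> ('i, 'm, 'n::finite) virt \<Rightarrow> ('i, 'm, 'n) virt" where
  "ext_virt i (Diff E F) =
     series_quotient (\<lambda>j. virt_of (ext_bundle j E)) (\<lambda>j. virt_of (ext_bundle j F)) i"

fun sym_virt :: "nat \<Rightarrow> ('i, 'm, 'n::finite) virt \<Rightarrow> ('i, 'm, 'n) virt" where
  "sym_virt i (Diff E F) =
     series_quotient (\<lambda>j. virt_of (sym_bundle j E)) (\<lambda>j. virt_of (sym_bundle j F)) i"

fun ch :: "('i, 'm, 'n) virt \<Rightarrow> 'i \<Rightarrow> real ^ ('n::{finite,linorder}) \<Rightarrow> 'n evform" where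
  "ch (Diff E F) a x = ch_bundle E a x - ch_bundle F a x"


section \<open>Spin manifolds of dimension 8\<close>

text \<open>
  The complex Clifford algebra of \<open>\<real>\<^sup>8\<close> is the full matrix algebra of rank \<open>16\<close>, so \<open>16\<times>16\<close>
  matrices satisfying the Clifford relations are a model of the irreducible Clifford module, that
  is, of the full spinor module, and any two models are conjugate.
\<close>

definition clifford8 :: "(nat \<Rightarrow> complex mat) \<Rightarrow> bool" where
  "clifford8 c \<longleftrightarrow> (\<forall>i<8. c i \<in> carrier_mat 16 16) \<and>
     (\<forall>i<8. \<forall>j<8. c i * c j + c j * c i = (if i = j then - 2 else 0) \<cdot>\<^sub>m 1\<^sub>m 16)"

definition cliff_vec :: "(nat \<Rightarrow> complex mat) \<Rightarrow> (nat \<Rightarrow> real) \<Rightarrow> complex mat" where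
  "cliff_vec c v = Matrix.mat 16 16 (\<lambda>(p, q). \<Sum>i<8. of_real (v i) * c i $$ (p, q))"

text \<open>The group \<open>Spin(8)\<close>: products of an even number of unit vectors.\<close>

inductive_set spin8 :: "(nat \<Rightarrow> complex mat) \<Rightarrow> complex mat set" for c where
  one: "1\<^sub>m 16 \<in> spin8 c"
| mult: "S \<in> spin8 c \<Longrightarrow> (\<Sum>i<8. (u i)\<^sup>2) = 1 \<Longrightarrow> (\<Sum>i<8. (v i)\<^sup>2) = 1 \<Longrightarrow>
    S * (cliff_vec c u * cliff_vec c v) \<in> spin8 c"

text \<open>
  \<open>e a j\<close> is the coordinate expression of the \<open>j\<close>-th vector field of a local frame over \<open>U a\<close>;
  the transition matrix of two frames is given by \<open>e b j = \<Sum>\<^sub>i frame_change \<dots> a b p (i, j) e a i\<close>.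
\<close>

definition frame_change ::
    "('i \<Rightarrow> 'm set) \<Rightarrow> ('i \<Rightarrow> 'm \<Rightarrow> real ^ 8) \<Rightarrow> ('i \<Rightarrow> real ^ 8 \<Rightarrow> real ^ 8 ^ 8) \<Rightarrow>
     ('i \<Rightarrow> nat \<Rightarrow> real ^ 8 \<Rightarrow> real ^ 8) \<Rightarrow> 'i \<Rightarrow> 'i \<Rightarrow> 'm \<Rightarrow> nat \<times> nat \<Rightarrow> real" where
  "frame_change U \<phi> g e a b p = (\<lambda>(i, j).
     frechet_derivative (coord_change U \<phi> a b) (at (\<phi> b p)) (e b j (\<phi> b p))
       \<bullet> (g a (\<phi> a p) *v e a i (\<phi> a p)))"

text \<open>
  A spin structure, as orthonormal frames over the chart domains together with lifts \<open>\<sigma>\<close> of their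
  transition matrices to \<open>Spin(8)\<close> that satisfy the cocycle condition.  The existence of the lifts
  forces the transition matrices into \<open>SO(8)\<close>, so an orientation is included.  Continuous lifts of
  smooth maps along the covering \<open>Spin(8) \<rightarrow> SO(8)\<close> are smooth.
\<close>

locale spin_manifold8 = levi_civita I U \<phi> g \<Gamma>
  for I :: "'i set" and U :: "'i \<Rightarrow> 'm::{t2_space,second_countable_topology} set"
    and \<phi> :: "'i \<Rightarrow> 'm \<Rightarrow> real ^ 8" and g :: "'i \<Rightarrow> real ^ 8 \<Rightarrow> real ^ 8 ^ 8"
    and \<Gamma> :: "'i \<Rightarrow> 8 \<Rightarrow> real ^ 8 \<Rightarrow> real ^ 8 ^ 8" +
  fixes e :: "'i \<Rightarrow> nat \<Rightarrow> real ^ 8 \<Rightarrow> real ^ 8"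
    and c :: "nat \<Rightarrow> complex mat"
    and \<sigma> :: "'i \<Rightarrow> 'i \<Rightarrow> 'm \<Rightarrow> complex mat"
  assumes smooth_frame: "a \<in> I \<Longrightarrow> i < 8 \<Longrightarrow> smooth_on (e a i) (\<phi> a ` U a)"
    and orthonormal_frame: "a \<in> I \<Longrightarrow> x \<in> \<phi> a ` U a \<Longrightarrow> i < 8 \<Longrightarrow> j < 8 \<Longrightarrow>
      e a i x \<bullet> (g a x *v e a j x) = (if i = j then 1 else 0)"
    and clifford: "clifford8 c"
    and lift_spin: "a \<in> I \<Longrightarrow> b \<in> I \<Longrightarrow> p \<in> U a \<inter> U b \<Longrightarrow> \<sigma> a b p \<in> spin8 c"
    and lift_covers: "a \<in> I \<Longrightarrow> b \<in> I \<Longrightarrow> p \<in> U a \<inter> U b \<Longrightarrow> j < 8 \<Longrightarrow>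
      \<sigma> a b p * c j = cliff_vec c (\<lambda>i. frame_change U \<phi> g e a b p (i, j)) * \<sigma> a b p"
    and lift_cocycle: "a \<in> I \<Longrightarrow> b \<in> I \<Longrightarrow> d \<in> I \<Longrightarrow> p \<in> U a \<inter> U b \<inter> U d \<Longrightarrow>
      \<sigma> a b p * \<sigma> b d p = \<sigma> a d p"
    and lift_continuous: "a \<in> I \<Longrightarrow> b \<in> I \<Longrightarrow> i < 16 \<Longrightarrow> j < 16 \<Longrightarrow>
      continuous_on (U a \<inter> U b) (\<lambda>p. \<sigma> a b p $$ (i, j))"

text \<open>
  The connection matrix of \<open>TX\<close> in the orthonormal frame: its \<open>dx\<^sub>k\<close>-component has the entries
  \<open>g(\<nabla>\<^sub>k e\<^sub>j, e\<^sub>i)\<close>.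
\<close>

definition tangent_conn ::
    "('i \<Rightarrow> real ^ 8 \<Rightarrow> real ^ 8 ^ 8) \<Rightarrow> ('i \<Rightarrow> 8 \<Rightarrow> real ^ 8 \<Rightarrow> real ^ 8 ^ 8) \<Rightarrow>
     ('i \<Rightarrow> nat \<Rightarrow> real ^ 8 \<Rightarrow> real ^ 8) \<Rightarrow> 'i \<Rightarrow> 8 \<Rightarrow> real ^ 8 \<Rightarrow> nat \<times> nat \<Rightarrow> real" where
  "tangent_conn g \<Gamma> e a k x = (\<lambda>(i, j).
     (pderiv_at k (e a j) x + \<Gamma> a k x *v e a j x) \<bullet> (g a x *v e a i x))"

definition complex_tangent_bundle ::
    "('i \<Rightarrow> 'm set) \<Rightarrow> ('i \<Rightarrow> 'm \<Rightarrow> real ^ 8) \<Rightarrow> ('i \<Rightarrow> real ^ 8 \<Rightarrow> real ^ 8 ^ 8) \<Rightarrow>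
     ('i \<Rightarrow> 8 \<Rightarrow> real ^ 8 \<Rightarrow> real ^ 8 ^ 8) \<Rightarrow> ('i \<Rightarrow> nat \<Rightarrow> real ^ 8 \<Rightarrow> real ^ 8) \<Rightarrow> ('i, 'm, 8) vbundle" where
  "complex_tangent_bundle U \<phi> g \<Gamma> e = Bundle 8
     (\<lambda>a b p. Matrix.mat 8 8 (\<lambda>ij. of_real (frame_change U \<phi> g e a b p ij)))
     (\<lambda>a k x. Matrix.mat 8 8 (\<lambda>ij. of_real (tangent_conn g \<Gamma> e a k x ij)))"

text \<open>
  The differential of the covering \<open>Spin(8) \<rightarrow> SO(8)\<close> sends \<open>S = - 1/4 \<Sum>\<^sub>i\<^sub>j A\<^sub>i\<^sub>j c\<^sub>i c\<^sub>j\<close> to the skew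
  matrix \<open>A\<close>, i.e. \<open>S c\<^sub>j - c\<^sub>j S = \<Sum>\<^sub>i A\<^sub>i\<^sub>j c\<^sub>i\<close>.
\<close>

definition spin_lift :: "(nat \<Rightarrow> complex mat) \<Rightarrow> (nat \<times> nat \<Rightarrow> real) \<Rightarrow> complex mat" where
  "spin_lift c A = Matrix.mat 16 16
     (\<lambda>pq. - (1 / 4) * (\<Sum>i<8. \<Sum>j<8. of_real (A (i, j)) * (c i * c j) $$ pq))"

definition spinor_bundle ::
    "('i \<Rightarrow> real ^ 8 \<Rightarrow> real ^ 8 ^ 8) \<Rightarrow> ('i \<Rightarrow> 8 \<Rightarrow> real ^ 8 \<Rightarrow> real ^ 8 ^ 8) \<Rightarrow>
     ('i \<Rightarrow> nat \<Rightarrow> real ^ 8 \<Rightarrow> real ^ 8) \<Rightarrow> (nat \<Rightarrow> complex mat) \<Rightarrow> ('i \<Rightarrow> 'i \<Rightarrow> 'm \<Rightarrow> complex mat) \<Rightarrow>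
     ('i, 'm, 8) vbundle" where
  "spinor_bundle g \<Gamma> e c \<sigma> = Bundle 16 \<sigma> (\<lambda>a k x. spin_lift c (tangent_conn g \<Gamma> e a k x))"

end

theory Submission
  imports Defs
begin

text \<open>
  The conceptual reason for the two identities is modularity: the three forms in them are the
  first coefficients, in the expansion in \<open>t = e\<^sup>2\<^sup>\<pi>\<^sup>\<i>\<^sup>\<tau>\<close>, of a modular form of weight \<open>4\<close> over \<open>SL\<^sub>2(\<int>)\<close>, and
  every such form is a multiple of \<open>E\<^sub>4 = 1 + 240 t + 2160 t\<^sup>2 + \<dots>\<close>.  In degree \<open>8\<close> a direct verification is possible,
  and it is the one carried out here.

  Everything happens at one point.  Let \<open>Y = (\<i>/2\<pi>) R\<close> be the matrix of the curvature of \<open>TX\<close> in the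
  orthonormal frame.  It is a skew \<open>8 \<times> 8\<close> matrix of \<open>2\<close>-forms, because the Levi-Civita connection is
  metric (\<open>tangent_conn_skew\<close>).  Hence the traces of its odd powers vanish, its powers with exponent
  at least \<open>5\<close> vanish, and with \<open>p = tr Y\<^sup>2\<close>, \<open>q = tr Y\<^sup>4\<close> every form in the statement is a linear
  combination \<open>jet p q a b c d = a + b p + c q + d p\<^sup>2\<close>, where \<open>p\<^sup>3 = p q = q\<^sup>2 = 0\<close>.  The work consists in
  finding these combinations:

    \<open>A\<close> is \<open>1 - p/48 + q/5760 + p\<^sup>2/4608\<close>, and \<open>ch(\<Delta>)\<close> is \<open>16 + p - q/24 + p\<^sup>2/32\<close>;

    the Chern characters of \<open>W\<close>, \<open>\<and>\<^sup>2W\<close>, \<open>\<and>\<^sup>4W\<close> and \<open>S\<^sup>2W\<close> are \<open>p/2 + q/24\<close>, \<open>- p - q/3 + p\<^sup>2/8\<close>,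
    \<open>- 2p - 8q/3 + 5p\<^sup>2/4\<close> and \<open>p + q/3 + p\<^sup>2/8\<close>.

  Substitution gives \<open>48 - q/30 + p\<^sup>2/48\<close> for the form on the right-hand sides, and \<open>- 8q + 5p\<^sup>2\<close> and
  \<open>- 72q + 45p\<^sup>2\<close> for the two on the left.

  Three tools produce the combinations.  The Chern character is additive and multiplicative
  (\<open>ch_bundle_sum_bundle\<close>, \<open>ch_bundle_tensor_bundle\<close>), since the curvature of a tensor product is
  \<open>R \<otimes> 1 + 1 \<otimes> R'\<close>.  For exterior and symmetric powers, \<open>d!\<close> times the Chern character is a signed or
  unsigned sum over permutations of products of traces of powers of \<open>exp Y\<close>, which Newton's
  identities reduce to the power sums \<open>tr exp(m Y)\<close> (\<open>ch_bundle_ext_bundle\<close>, \<open>ch_bundle_sym_bundle\<close>,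
  \<open>newton_identity\<close>).  The same identities evaluate the determinant in the \<open>A\<close>-form, because an
  \<open>8 \<times> 8\<close> determinant is the trace on the eighth exterior power (\<open>det_eq_cycle_sum\<close>).  The
  traces of the powers of the spinor curvature follow from the Clifford relations alone
  (\<open>spin_trace_values\<close>): moving a generator cyclically around the trace of a product gives a
  recursion.
\<close>


section \<open>Even forms and their degree filtration\<close>

lemma coeff_form_const: "coeff_form (const_form z) K = (if K = {} then z else 0)"
  by transfer simp

lemma coeff_form_zero [simp]: "coeff_form 0 K = 0"
  by transfer simp

lemma coeff_form_one: "coeff_form 1 K = (if K = {} then 1 else 0)"
  by transfer simp

lemma coeff_form_add [simp]: "coeff_form (\<alpha> + \<beta>) K = coeff_form \<alpha> K + coeff_form \<beta> K"
  by transfer simp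

lemma coeff_form_diff [simp]: "coeff_form (\<alpha> - \<beta>) K = coeff_form \<alpha> K - coeff_form \<beta> K"
  by transfer simp

lemma coeff_form_uminus [simp]: "coeff_form (- \<alpha>) K = - coeff_form \<alpha> K"
  by transfer simp

lemma coeff_form_mult:
  "coeff_form (\<alpha> * \<beta>) K = (\<Sum>J\<in>Pow K. wedge_sign J (K - J) * coeff_form \<alpha> J * coeff_form \<beta> (K - J))"
  by transfer simp

lemma coeff_form_sum [simp]: "coeff_form (sum f S) K = (\<Sum>i\<in>S. coeff_form (f i) K)"
  by (induction S rule: infinite_finite_induct) auto

lemma coeff_form_const_mult [simp]: "coeff_form (const_form z * \<alpha>) K = z * coeff_form \<alpha> K"
proof -
  have "coeff_form (const_form z * \<alpha>) K = (\<Sum>J\<in>Pow K. if J = {} then z * coeff_form \<alpha> K else 0)"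
    unfolding coeff_form_mult by (rule sum.cong) (auto simp: coeff_form_const)
  then show ?thesis by simp
qed

lemma const_form_0 [simp]: "const_form 0 = 0"
  and const_form_1 [simp]: "const_form 1 = 1"
  and const_form_add: "const_form (y + z) = const_form y + const_form z"
  and const_form_diff: "const_form (y - z) = const_form y - const_form z"
  and const_form_uminus: "const_form (- z) = - const_form z"
  and const_form_mult: "const_form (y * z) = const_form y * const_form z"
  by (rule evform_eqI, simp add: coeff_form_const coeff_form_one)+

lemma const_form_sum: "const_form (sum f S) = (\<Sum>i\<in>S. const_form (f i))"
  by (induction S rule: infinite_finite_induct) (auto simp: const_form_add)

lemma const_form_of_nat: "const_form (of_nat n) = of_nat n"
  by (induction n) (auto simp: const_form_add)

lemma const_form_of_int: "const_form (of_int n) = of_int n"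
  by (cases n) (auto simp: const_form_uminus const_form_of_nat simp flip: of_nat_Suc)

lemma const_form_numeral: "const_form (numeral n) = numeral n"
  using const_form_of_nat[of "numeral n"] by simp

lemma const_form_prod: "const_form (prod f S) = (\<Prod>i\<in>S. const_form (f i))"
  by (induction S rule: infinite_finite_induct) (auto simp: const_form_mult)

lemma const_form_power: "const_form (z ^ k) = const_form z ^ k"
  by (induction k) (auto simp: const_form_mult)

lemma evform_eq_uminus_imp_0: "\<alpha> = - \<alpha> \<Longrightarrow> \<alpha> = (0 :: 'n::{finite,linorder} evform)"
proof (rule evform_eqI)
  fix K assume "\<alpha> = - \<alpha>"
  then have "coeff_form \<alpha> K = - coeff_form \<alpha> K"
    by (metis coeff_form_uminus)
  then show "coeff_form \<alpha> K = coeff_form 0 K" by simp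
qed

lemma deg_part_add: "deg_part p (\<alpha> + \<beta>) = deg_part p \<alpha> + deg_part p \<beta>"
  by transfer auto

lemma deg_part_const_mult: "deg_part p (const_form z * \<alpha>) = const_form z * deg_part p \<alpha>"
  by (rule evform_eqI) (simp add: deg_part.rep_eq)

lemma deg_part_const: "p > 0 \<Longrightarrow> deg_part p (const_form z) = 0"
  by (rule evform_eqI) (auto simp: deg_part.rep_eq coeff_form_const)

lemma form2_add: "form2 (\<lambda>k l. A k l + B k l) = form2 A + form2 B"
  by transfer auto

lemma form2_uminus: "form2 (\<lambda>k l. - A k l) = - form2 A"
  by transfer auto

lemma form2_0 [simp]: "form2 (\<lambda>k l. 0) = 0"
  by transfer auto

lemma form2_cmult: "form2 (\<lambda>k l. z * A k l) = const_form z * form2 A"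
  by (rule evform_eqI) (simp add: form2.rep_eq)

lemma form2_sum: "form2 (\<lambda>k l. \<Sum>i\<in>S. A i k l) = (\<Sum>i\<in>S. form2 (A i))"
  by (induction S rule: infinite_finite_induct) (auto simp: form2_add)

text \<open>
  The ideals of this filtration replace a grading: the argument only uses that products of forms of
  large degree vanish.
\<close>

definition of_degree_ge :: "nat \<Rightarrow> 'n::{finite,linorder} evform \<Rightarrow> bool" where
  "of_degree_ge p \<alpha> \<longleftrightarrow> (\<forall>K. card K < p \<longrightarrow> coeff_form \<alpha> K = 0)"

lemma of_degree_ge_0 [simp]: "of_degree_ge 0 \<alpha>" "of_degree_ge p 0"
  by (auto simp: of_degree_ge_def)

lemma of_degree_ge_add: "of_degree_ge p \<alpha> \<Longrightarrow> of_degree_ge p \<beta> \<Longrightarrow> of_degree_ge p (\<alpha> + \<beta>)"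
  by (auto simp: of_degree_ge_def)

lemma of_degree_ge_sum: "(\<And>i. i \<in> S \<Longrightarrow> of_degree_ge p (f i)) \<Longrightarrow> of_degree_ge p (sum f S)"
  by (auto simp: of_degree_ge_def)

lemma of_degree_ge_form2: "of_degree_ge 2 (form2 B)"
  by (auto simp: of_degree_ge_def form2.rep_eq)

lemma of_degree_ge_mult:
  assumes "of_degree_ge p \<alpha>" "of_degree_ge q \<beta>"
  shows "of_degree_ge (p + q) (\<alpha> * \<beta>)"
  unfolding of_degree_ge_def
proof (intro allI impI)
  fix K :: "'a set"
  assume K: "card K < p + q"
  have "coeff_form \<alpha> J * coeff_form \<beta> (K - J) = 0" if "J \<subseteq> K" for J
  proof -
    have "card J + card (K - J) = card K"
      using that by (metis card_Diff_subset card_mono finite_class.finite_code le_add_diff_inverse)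
    then have "card J < p \<or> card (K - J) < q" using K by auto
    then show ?thesis using assms by (auto simp: of_degree_ge_def)
  qed
  then show "coeff_form (\<alpha> * \<beta>) K = 0"
    unfolding coeff_form_mult by (intro sum.neutral) (auto simp: mult.assoc)
qed

lemma of_degree_ge_const_mult: "of_degree_ge p \<alpha> \<Longrightarrow> of_degree_ge p (const_form z * \<alpha>)"
  using of_degree_ge_mult[of 0 "const_form z" p \<alpha>] by simp

lemma of_degree_ge_imp_0:
  fixes \<alpha> :: "'n::{finite,linorder} evform"
  assumes "of_degree_ge p \<alpha>" "p > CARD('n)"
  shows "\<alpha> = 0"
proof (rule evform_eqI)
  fix K :: "'n set"
  have "card K \<le> CARD('n)" by (intro card_mono) auto
  then show "coeff_form \<alpha> K = coeff_form 0 K" using assms by (auto simp: of_degree_ge_def)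
qed


section \<open>Matrices indexed by arbitrary finite sets\<close>

text \<open>
  Matrices are functions of two indices from an arbitrary type, and every sum runs over an explicit
  finite set \<open>I\<close>.  So one notion of matrix serves for bundles (indices below the rank), for tensor
  products (pairs) and for tensor powers (lists), and a change of index set is a bijection.
\<close>

definition kmul :: "'i set \<Rightarrow> ('i \<Rightarrow> 'i \<Rightarrow> 'a::comm_ring_1) \<Rightarrow> ('i \<Rightarrow> 'i \<Rightarrow> 'a) \<Rightarrow> 'i \<Rightarrow> 'i \<Rightarrow> 'a" where
  "kmul I F H i j = (\<Sum>l\<in>I. F i l * H l j)"

definition kone :: "'i \<Rightarrow> 'i \<Rightarrow> 'a::comm_ring_1" where
  "kone i j = (if i = j then 1 else 0)"

primrec kpow :: "'i set \<Rightarrow> ('i \<Rightarrow> 'i \<Rightarrow> 'a::comm_ring_1) \<Rightarrow> nat \<Rightarrow> 'i \<Rightarrow> 'i \<Rightarrow> 'a" where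
  "kpow I F 0 = kone"
| "kpow I F (Suc k) = kmul I (kpow I F k) F"

definition ktr :: "'i set \<Rightarrow> ('i \<Rightarrow> 'i \<Rightarrow> 'a::comm_ring_1) \<Rightarrow> 'a" where
  "ktr I F = (\<Sum>i\<in>I. F i i)"

lemma kmul_assoc: "kmul I (kmul I F G) H = kmul I F (kmul I G H)"
proof (intro ext)
  fix i j
  have "kmul I (kmul I F G) H i j = (\<Sum>l\<in>I. \<Sum>m\<in>I. F i m * G m l * H l j)"
    by (simp add: kmul_def sum_distrib_right)
  also have "\<dots> = (\<Sum>m\<in>I. \<Sum>l\<in>I. F i m * G m l * H l j)"
    by (rule sum.swap)
  also have "\<dots> = kmul I F (kmul I G H) i j"
    by (simp add: kmul_def sum_distrib_left mult.assoc)
  finally show "kmul I (kmul I F G) H i j = kmul I F (kmul I G H) i j" .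
qed

lemma kmul_cong:
  assumes "\<And>l. l \<in> I \<Longrightarrow> F i l = F' i l" "\<And>l. l \<in> I \<Longrightarrow> H l j = H' l j"
  shows "kmul I F H i j = kmul I F' H' i j"
  unfolding kmul_def using assms by (intro sum.cong) auto

lemma sum_kone_left [simp]: "finite I \<Longrightarrow> i \<in> I \<Longrightarrow> (\<Sum>l\<in>I. kone i l * f l) = f i"
proof -
  assume "finite I" "i \<in> I"
  have "(\<Sum>l\<in>I. kone i l * f l) = (\<Sum>l\<in>I. if l = i then f l else 0)"
    by (intro sum.cong) (auto simp: kone_def)
  then show ?thesis using \<open>finite I\<close> \<open>i \<in> I\<close> by simp
qed

lemma sum_kone_right [simp]: "finite I \<Longrightarrow> j \<in> I \<Longrightarrow> (\<Sum>l\<in>I. f l * kone l j) = f j"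
proof -
  assume "finite I" "j \<in> I"
  have "(\<Sum>l\<in>I. f l * kone l j) = (\<Sum>l\<in>I. if l = j then f l else 0)"
    by (intro sum.cong) (auto simp: kone_def)
  then show ?thesis using \<open>finite I\<close> \<open>j \<in> I\<close> by simp
qed

lemma kmul_kone_left: "finite I \<Longrightarrow> i \<in> I \<Longrightarrow> kmul I kone F i j = F i j"
  by (simp add: kmul_def)

lemma kmul_kone_right: "finite I \<Longrightarrow> j \<in> I \<Longrightarrow> kmul I F kone i j = F i j"
  by (simp add: kmul_def)

lemma kpow_add:
  assumes "finite I" "j \<in> I"
  shows "kpow I F (m + n) i j = kmul I (kpow I F m) (kpow I F n) i j"
  using \<open>j \<in> I\<close>
proof (induction n arbitrary: j)
  case 0
  then show ?case using assms by (simp add: kmul_kone_right)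
next
  case (Suc n)
  have "kpow I F (m + Suc n) i j = kmul I (kmul I (kpow I F m) (kpow I F n)) F i j"
    using Suc by (auto intro: kmul_cong)
  then show ?case by (simp add: kmul_assoc)
qed

lemma kpow_cong:
  assumes "\<And>i j. i \<in> I \<Longrightarrow> j \<in> I \<Longrightarrow> F i j = F' i j" "j \<in> I"
  shows "kpow I F k i j = kpow I F' k i j"
  using \<open>j \<in> I\<close>
proof (induction k arbitrary: j)
  case (Suc k)
  then show ?case using assms(1) by (auto intro!: kmul_cong)
qed simp

lemma kpow_bij_betw:
  assumes f: "bij_betw f I J" and "i \<in> I" "j \<in> I"
  shows "kpow J F k (f i) (f j) = kpow I (\<lambda>i j. F (f i) (f j)) k i j"
  using \<open>j \<in> I\<close>
proof (induction k arbitrary: j)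
  case 0
  then show ?case using f \<open>i \<in> I\<close> by (auto simp: kone_def bij_betw_def inj_on_def)
next
  case (Suc k)
  have "kpow J F (Suc k) (f i) (f j) = (\<Sum>l\<in>I. kpow J F k (f i) (f l) * F (f l) (f j))"
    unfolding kpow.simps kmul_def by (rule sum.reindex_bij_betw[OF f, symmetric])
  then show ?case using Suc by (simp add: kmul_def)
qed

lemma ktr_kpow_bij_betw:
  assumes f: "bij_betw f I J"
  shows "ktr J (kpow J F k) = ktr I (kpow I (\<lambda>i j. F (f i) (f j)) k)"
  unfolding ktr_def sum.reindex_bij_betw[OF f, symmetric]
  by (intro sum.cong refl kpow_bij_betw[OF f])

lemma kpow_scale: "kpow I (\<lambda>i j. c * F i j) k i j = c ^ k * kpow I F k i j"
  by (induction k arbitrary: j) (simp_all add: kmul_def sum_distrib_left mult_ac)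

text \<open>Transposing a skew kernel reverses the order of the factors, so odd powers stay skew.\<close>

lemma kpow_skew:
  assumes "\<And>i j. i \<in> I \<Longrightarrow> j \<in> I \<Longrightarrow> F i j = - F j i" "finite I" "i \<in> I" "j \<in> I"
  shows "kpow I F k i j = (- 1) ^ k * kpow I F k j i"
  using assms(3,4)
proof (induction k arbitrary: i j)
  case 0
  then show ?case by (simp add: kone_def)
next
  case (Suc k)
  have "kpow I F (Suc k) i j = (\<Sum>l\<in>I. (- 1) ^ Suc k * (F j l * kpow I F k l i))"
    unfolding kpow.simps kmul_def
  proof (intro sum.cong refl)
    fix l assume "l \<in> I"
    then show "kpow I F k i l * F l j = (- 1) ^ Suc k * (F j l * kpow I F k l i)"
      using Suc.IH[of i l] assms(1)[of l j] Suc.prems by (simp add: mult_ac)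
  qed
  also have "\<dots> = (- 1) ^ Suc k * kmul I F (kpow I F k) j i"
    by (simp add: kmul_def sum_distrib_left)
  also have "kmul I F (kpow I F k) j i = kmul I (kpow I F (Suc 0)) (kpow I F k) j i"
    by (rule kmul_cong) (simp_all add: kmul_kone_left \<open>finite I\<close> Suc.prems)
  also have "\<dots> = kpow I F (Suc k) j i"
    using kpow_add[of I i F "Suc 0" k j] \<open>finite I\<close> Suc.prems by simp
  finally show ?case .
qed

lemma ktr_kpow_odd_skew:
  fixes F :: "'i \<Rightarrow> 'i \<Rightarrow> 'n::{finite,linorder} evform"
  assumes "\<And>i j. i \<in> I \<Longrightarrow> j \<in> I \<Longrightarrow> F i j = - F j i" "finite I" "odd k"
  shows "ktr I (kpow I F k) = 0"
proof -
  have "kpow I F k i i = 0" if "i \<in> I" for i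
    using kpow_skew[OF assms(1,2) that that, where k = k] \<open>odd k\<close> by (intro evform_eq_uminus_imp_0) simp
  then show ?thesis by (simp add: ktr_def)
qed

lemma of_degree_ge_kpow:
  assumes "\<And>i j. i \<in> I \<Longrightarrow> j \<in> I \<Longrightarrow> of_degree_ge p (F i j)" "j \<in> I"
  shows "i \<in> I \<Longrightarrow> of_degree_ge (k * p) (kpow I F k i j)"
  using \<open>j \<in> I\<close>
proof (induction k arbitrary: j)
  case (Suc k)
  have "of_degree_ge (k * p + p) (kpow I F k i l * F l j)" if "l \<in> I" for l
    using Suc that assms by (intro of_degree_ge_mult) auto
  then show ?case by (auto simp: kmul_def add.commute intro: of_degree_ge_sum)
qed simp

text \<open>
  The sum stops at the dimension, where powers of matrices of \<open>2\<close>-forms have long vanished; so this is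
  \<open>exp (z F)\<close>.
\<close>

definition kexp :: "complex \<Rightarrow> 'i set \<Rightarrow> ('i \<Rightarrow> 'i \<Rightarrow> 'n::{finite,linorder} evform) \<Rightarrow> 'i \<Rightarrow> 'i \<Rightarrow> 'n evform" where
  "kexp z I F i j = (\<Sum>k\<le>CARD('n). const_form (z ^ k / fact k) * kpow I F k i j)"

text \<open>
  For nilpotent arguments the truncated Cauchy product is the product of the truncations.
\<close>

lemma sum_square_eq_triangle:
  fixes X :: "nat \<Rightarrow> nat \<Rightarrow> 'a::comm_monoid_add"
  assumes "\<And>m n. m + n > N \<Longrightarrow> X m n = 0"
  shows "(\<Sum>m\<le>N. \<Sum>n\<le>N. X m n) = (\<Sum>k\<le>N. \<Sum>m\<le>k. X m (k - m))"
proof -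
  have "(\<Sum>m\<le>N. \<Sum>n\<le>N. X m n) = (\<Sum>(m, n)\<in>{..N} \<times> {..N}. X m n)"
    by (simp add: sum.cartesian_product)
  also have "\<dots> = (\<Sum>(m, n)\<in>{(m, n). m + n \<le> N}. X m n)"
    by (rule sum.mono_neutral_right) (auto, meson assms not_le)
  also have "\<dots> = (\<Sum>k\<le>N. \<Sum>m\<le>k. X m (k - m))"
    by (rule sum.triangle_reindex_eq)
  finally show ?thesis .
qed

definition kseries :: "complex fps \<Rightarrow> 'i set \<Rightarrow> ('i \<Rightarrow> 'i \<Rightarrow> 'n::{finite,linorder} evform) \<Rightarrow> 'i \<Rightarrow> 'i \<Rightarrow> 'n evform" where
  "kseries f I F i j = (\<Sum>k\<le>CARD('n). const_form (fps_nth f k) * kpow I F k i j)"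

lemma kexp_eq_kseries: "kexp z = kseries (fps_exp z)"
  by (simp add: kexp_def kseries_def fun_eq_iff)

lemma ktr_kseries:
  fixes F :: "'i \<Rightarrow> 'i \<Rightarrow> 'n::{finite,linorder} evform"
  shows "ktr I (kseries f I F) = (\<Sum>k\<le>CARD('n). const_form (fps_nth f k) * ktr I (kpow I F k))"
  unfolding ktr_def kseries_def sum_distrib_left by (rule sum.swap)

lemma kseries_mult:
  fixes F :: "'i \<Rightarrow> 'i \<Rightarrow> 'n::{finite,linorder} evform"
  assumes F: "\<And>i j. i \<in> I \<Longrightarrow> j \<in> I \<Longrightarrow> of_degree_ge 2 (F i j)"
    and I: "finite I" "i \<in> I" "j \<in> I"
  shows "kmul I (kseries f I F) (kseries g I F) i j = kseries (f * g) I F i j"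
proof -
  let ?N = "CARD('n)"
  define X where "X m n = const_form (fps_nth f m * fps_nth g n) * kpow I F (m + n) i j" for m n
  have "kmul I (kseries f I F) (kseries g I F) i j =
      (\<Sum>l\<in>I. \<Sum>m\<le>?N. \<Sum>n\<le>?N. const_form (fps_nth f m) * kpow I F m i l *
         (const_form (fps_nth g n) * kpow I F n l j))"
    by (simp add: kmul_def kseries_def sum_product)
  also have "\<dots> = (\<Sum>m\<le>?N. \<Sum>n\<le>?N. \<Sum>l\<in>I. const_form (fps_nth f m) * kpow I F m i l *
         (const_form (fps_nth g n) * kpow I F n l j))"
    by (rule trans[OF sum.swap sum.cong[OF refl sum.swap]])
  also have "\<dots> = (\<Sum>m\<le>?N. \<Sum>n\<le>?N. X m n)"
    unfolding X_def kpow_add[OF I(1,3)] kmul_def const_form_mult sum_distrib_left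
    by (intro sum.cong refl) (simp add: mult_ac)
  also have "\<dots> = (\<Sum>k\<le>?N. \<Sum>m\<le>k. X m (k - m))"
  proof (rule sum_square_eq_triangle)
    fix m n assume "m + n > ?N"
    then have "kpow I F (m + n) i j = 0"
      by (intro of_degree_ge_imp_0[OF of_degree_ge_kpow[of I 2]] F I) auto
    then show "X m n = 0" by (simp add: X_def)
  qed
  also have "\<dots> = kseries (f * g) I F i j"
    unfolding kseries_def fps_mult_nth const_form_sum sum_distrib_right atLeast0AtMost
    by (intro sum.cong refl) (simp add: X_def)
  finally show ?thesis .
qed

lemma kseries_1: "kseries 1 I F i j = kone i j"
proof -
  have "kseries 1 I F i j = (\<Sum>k\<le>CARD('a). if k = 0 then kone i j else 0)"
    unfolding kseries_def by (intro sum.cong) auto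
  then show ?thesis by simp
qed

lemma kpow_kseries:
  fixes F :: "'i \<Rightarrow> 'i \<Rightarrow> 'n::{finite,linorder} evform"
  assumes F: "\<And>i j. i \<in> I \<Longrightarrow> j \<in> I \<Longrightarrow> of_degree_ge 2 (F i j)"
    and I: "finite I" "i \<in> I" "j \<in> I"
  shows "kpow I (kseries f I F) k i j = kseries (f ^ k) I F i j"
  using \<open>j \<in> I\<close>
proof (induction k arbitrary: j)
  case 0
  then show ?case by (simp add: kseries_1)
next
  case (Suc k)
  have "kpow I (kseries f I F) (Suc k) i j = kmul I (kseries (f ^ k) I F) (kseries f I F) i j"
    using Suc by (auto intro: kmul_cong)
  then show ?case by (simp add: kseries_mult[OF F I(1,2) Suc.prems] mult.commute)
qed

text \<open>
  This is \<open>F \<otimes> 1 + 1 \<otimes> H\<close>, the way a Lie algebra acts on a tensor product.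
\<close>

definition ktensor :: "('i \<Rightarrow> 'i \<Rightarrow> 'a::comm_ring_1) \<Rightarrow> ('j \<Rightarrow> 'j \<Rightarrow> 'a) \<Rightarrow> 'i \<times> 'j \<Rightarrow> 'i \<times> 'j \<Rightarrow> 'a" where
  "ktensor F H = (\<lambda>(i, i') (j, j'). F i j * kone i' j' + kone i j * H i' j')"

lemma ktensor_Pair: "ktensor F H (i, i') (j, j') = F i j * kone i' j' + kone i j * H i' j'"
  by (simp add: ktensor_def)

lemma sum_choose_pascal:
  fixes a :: "nat \<Rightarrow> nat \<Rightarrow> 'a::comm_ring_1"
  shows "(\<Sum>m\<le>k. of_nat (k choose m) * (a (Suc m) (k - m) + a m (Suc (k - m))))
    = (\<Sum>m\<le>Suc k. of_nat (Suc k choose m) * a m (Suc k - m))"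
proof -
  have "(\<Sum>m\<le>k. of_nat (k choose m) * a m (Suc (k - m))) = (\<Sum>m\<le>Suc k. of_nat (k choose m) * a m (Suc k - m))"
    by (simp add: Suc_diff_le binomial_eq_0)
  also have "\<dots> = a 0 (Suc k) + (\<Sum>m\<le>k. of_nat (k choose Suc m) * a (Suc m) (k - m))"
    unfolding sum.atMost_Suc_shift by simp
  finally show ?thesis
    unfolding sum.atMost_Suc_shift by (simp add: distrib_left distrib_right sum.distrib)
qed

text \<open>
  The two summands commute, so this is the binomial theorem.
\<close>

lemma kpow_ktensor:
  assumes "finite I" "finite J" "j \<in> I" "j' \<in> J"
  shows "kpow (I \<times> J) (ktensor F H) k (i, i') (j, j')
    = (\<Sum>m\<le>k. of_nat (k choose m) * (kpow I F m i j * kpow J H (k - m) i' j'))"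
  using assms(3,4)
proof (induction k arbitrary: j j')
  case 0
  then show ?case by (simp add: kone_def)
next
  case (Suc k)
  let ?c = "\<lambda>m. of_nat (k choose m)"
  have "kpow (I \<times> J) (ktensor F H) (Suc k) (i, i') (j, j') =
    (\<Sum>l\<in>I. \<Sum>l'\<in>J. \<Sum>m\<le>k. ?c m * (kpow I F m i l * kpow J H (k - m) i' l') *
       (F l j * kone l' j' + kone l j * H l' j'))"
    unfolding kpow.simps kmul_def sum.cartesian_product'
    by (intro sum.cong refl) (simp add: Suc.IH ktensor_Pair sum_distrib_right)
  also have "\<dots> = (\<Sum>m\<le>k. \<Sum>l\<in>I. \<Sum>l'\<in>J. ?c m * (kpow I F m i l * kpow J H (k - m) i' l') *
       (F l j * kone l' j' + kone l j * H l' j'))"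
    by (rule trans[OF sum.cong[OF refl sum.swap] sum.swap])
  also have "\<dots> = (\<Sum>m\<le>k. ?c m * (kpow I F (Suc m) i j * kpow J H (k - m) i' j' +
       kpow I F m i j * kpow J H (Suc (k - m)) i' j'))"
  proof (intro sum.cong refl)
    fix m
    have "(\<Sum>l\<in>I. \<Sum>l'\<in>J. ?c m * (kpow I F m i l * kpow J H (k - m) i' l') * (F l j * kone l' j' + kone l j * H l' j'))
      = ?c m * ((\<Sum>l\<in>I. kpow I F m i l * F l j) * (\<Sum>l'\<in>J. kpow J H (k - m) i' l' * kone l' j') +
          (\<Sum>l\<in>I. kpow I F m i l * kone l j) * (\<Sum>l'\<in>J. kpow J H (k - m) i' l' * H l' j'))"
      unfolding sum_product sum.distrib[symmetric] unfolding sum_distrib_left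
      by (intro sum.cong refl) (simp add: algebra_simps)
    then show "(\<Sum>l\<in>I. \<Sum>l'\<in>J. ?c m * (kpow I F m i l * kpow J H (k - m) i' l') * (F l j * kone l' j' + kone l j * H l' j'))
      = ?c m * (kpow I F (Suc m) i j * kpow J H (k - m) i' j' + kpow I F m i j * kpow J H (Suc (k - m)) i' j')"
      using assms Suc.prems by (simp add: kmul_def)
  qed
  also have "\<dots> = (\<Sum>m\<le>Suc k. of_nat (Suc k choose m) * (kpow I F m i j * kpow J H (Suc k - m) i' j'))"
    by (rule sum_choose_pascal)
  finally show ?case .
qed

text \<open>
  The exponential turns the Leibniz action into the group action \<open>exp F \<otimes> exp H\<close>.  This is why the
  Chern character is multiplicative.
\<close>

lemma kexp_ktensor:
  fixes F :: "'i \<Rightarrow> 'i \<Rightarrow> 'n::{finite,linorder} evform" and H :: "'j \<Rightarrow> 'j \<Rightarrow> 'n evform"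
  assumes F: "\<And>i j. i \<in> I \<Longrightarrow> j \<in> I \<Longrightarrow> of_degree_ge 2 (F i j)"
    and H: "\<And>i j. i \<in> J \<Longrightarrow> j \<in> J \<Longrightarrow> of_degree_ge 2 (H i j)"
    and I: "finite I" "i \<in> I" "j \<in> I" and J: "finite J" "i' \<in> J" "j' \<in> J"
  shows "kexp z (I \<times> J) (ktensor F H) (i, i') (j, j') = kexp z I F i j * kexp z J H i' j'"
proof -
  let ?N = "CARD('n)"
  define X where "X m n = const_form (z ^ m / fact m) * kpow I F m i j *
    (const_form (z ^ n / fact n) * kpow J H n i' j')" for m n
  have "kexp z I F i j * kexp z J H i' j' = (\<Sum>m\<le>?N. \<Sum>n\<le>?N. X m n)"
    by (simp add: kexp_def sum_product X_def)
  also have "\<dots> = (\<Sum>k\<le>?N. \<Sum>m\<le>k. X m (k - m))"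
  proof (rule sum_square_eq_triangle)
    fix m n assume mn: "m + n > ?N"
    have "of_degree_ge (m * 2 + n * 2) (kpow I F m i j * kpow J H n i' j')"
      by (intro of_degree_ge_mult of_degree_ge_kpow F H I J)
    then have "kpow I F m i j * kpow J H n i' j' = 0"
      by (rule of_degree_ge_imp_0) (use mn in auto)
    moreover have "X m n = (const_form (z ^ m / fact m) * const_form (z ^ n / fact n)) *
        (kpow I F m i j * kpow J H n i' j')"
      by (simp add: X_def mult_ac)
    ultimately show "X m n = 0" by simp
  qed
  also have "\<dots> = kexp z (I \<times> J) (ktensor F H) (i, i') (j, j')"
    unfolding kexp_def
  proof (rule sum.cong[OF refl])
    fix k
    have "X m (k - m) = const_form (z ^ k / fact k) * (of_nat (k choose m) * (kpow I F m i j * kpow J H (k - m) i' j'))"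
      if "m \<le> k" for m
    proof -
      have "z ^ m / fact m * (z ^ (k - m) / fact (k - m)) = z ^ k / fact k * of_nat (k choose m)"
        using that by (simp add: binomial_fact power_add[symmetric])
      then have "const_form (z ^ m / fact m) * const_form (z ^ (k - m) / fact (k - m))
        = const_form (z ^ k / fact k) * (of_nat (k choose m) :: 'n evform)"
        by (metis const_form_mult const_form_of_nat)
      moreover have "X m (k - m) = (const_form (z ^ m / fact m) * const_form (z ^ (k - m) / fact (k - m))) *
          (kpow I F m i j * kpow J H (k - m) i' j')"
        by (simp add: X_def mult_ac)
      ultimately show ?thesis by (simp add: mult.assoc)
    qed
    then show "(\<Sum>m\<le>k. X m (k - m)) = const_form (z ^ k / fact k) * kpow (I \<times> J) (ktensor F H) k (i, i') (j, j')"
      using I J by (simp add: kpow_ktensor sum_distrib_left)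
  qed
  finally show ?thesis ..
qed

lemma kexp_bij_betw:
  assumes "bij_betw f I J" "i \<in> I" "j \<in> I"
  shows "kexp z J F (f i) (f j) = kexp z I (\<lambda>i j. F (f i) (f j)) i j"
  unfolding kexp_def by (simp only: kpow_bij_betw[OF assms])

lemma kexp_cong:
  assumes "\<And>i j. i \<in> I \<Longrightarrow> j \<in> I \<Longrightarrow> F i j = F' i j" "j \<in> I"
  shows "kexp z I F i j = kexp z I F' i j"
  unfolding kexp_def by (simp only: kpow_cong[OF assms])

lemma ktr_kexp: "ktr I (kexp z I F) = (\<Sum>k\<le>CARD('n). const_form (z ^ k / fact k) * ktr I (kpow I F k))"
  for F :: "'i \<Rightarrow> 'i \<Rightarrow> 'n::{finite,linorder} evform"
  unfolding ktr_def kexp_def sum_distrib_left by (rule sum.swap)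


section \<open>Tensor powers\<close>

definition kcomm :: "'i set \<Rightarrow> ('i \<Rightarrow> 'i \<Rightarrow> 'a::comm_ring_1) \<Rightarrow> ('i \<Rightarrow> 'i \<Rightarrow> 'a) \<Rightarrow> 'i \<Rightarrow> 'i \<Rightarrow> 'a" where
  "kcomm I F H i j = kmul I F H i j - kmul I H F i j"

lemma kmul_ktensor:
  assumes "finite I" "finite J" "i \<in> I" "j \<in> I" "i' \<in> J" "j' \<in> J"
  shows "kmul (I \<times> J) (ktensor F H) (ktensor F' H') (i, i') (j, j') =
    kmul I F F' i j * kone i' j' + kone i j * kmul J H H' i' j' + F i j * H' i' j' + F' i j * H i' j'"
proof -
  have "kmul (I \<times> J) (ktensor F H) (ktensor F' H') (i, i') (j, j') = (\<Sum>l\<in>I. \<Sum>l'\<in>J.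
      (F i l * kone i' l' + kone i l * H i' l') * (F' l j * kone l' j' + kone l j * H' l' j'))"
    unfolding kmul_def sum.cartesian_product' by (simp add: ktensor_Pair)
  also have "\<dots> = (\<Sum>l\<in>I. \<Sum>l'\<in>J. (F i l * F' l j) * (kone i' l' * kone l' j'))
      + (\<Sum>l\<in>I. \<Sum>l'\<in>J. (F i l * kone l j) * (kone i' l' * H' l' j'))
      + (\<Sum>l\<in>I. \<Sum>l'\<in>J. (kone i l * F' l j) * (H i' l' * kone l' j'))
      + (\<Sum>l\<in>I. \<Sum>l'\<in>J. (kone i l * kone l j) * (H i' l' * H' l' j'))"
    unfolding sum.distrib[symmetric] by (intro sum.cong refl) (simp add: algebra_simps)
  also have "\<dots> = kmul I F F' i j * kone i' j' + F i j * H' i' j' + F' i j * H i' j' + kone i j * kmul J H H' i' j'"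
    unfolding sum_product[symmetric] using assms by (simp add: kmul_def)
  finally show ?thesis by (simp add: add_ac)
qed

text \<open>
  The mixed terms of the two products agree and cancel, so \<open>F, H \<mapsto> F \<otimes> 1 + 1 \<otimes> H\<close> is a homomorphism of
  Lie algebras.  It carries the quadratic part of a curvature to the quadratic part.
\<close>

lemma kcomm_ktensor:
  assumes "finite I" "finite J" "i \<in> I" "j \<in> I" "i' \<in> J" "j' \<in> J"
  shows "kcomm (I \<times> J) (ktensor F H) (ktensor F' H') (i, i') (j, j') =
    ktensor (kcomm I F F') (kcomm J H H') (i, i') (j, j')"
  unfolding kcomm_def kmul_ktensor[OF assms] ktensor_Pair by (simp add: algebra_simps)

lemma kmul_bij_betw:
  assumes f: "bij_betw f I J"
  shows "kmul J F H (f i) (f j) = kmul I (\<lambda>i j. F (f i) (f j)) (\<lambda>i j. H (f i) (f j)) i j"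
  unfolding kmul_def by (rule sum.reindex_bij_betw[OF f, symmetric])

lemma kcomm_bij_betw:
  assumes "bij_betw f I J"
  shows "kcomm J F H (f i) (f j) = kcomm I (\<lambda>i j. F (f i) (f j)) (\<lambda>i j. H (f i) (f j)) i j"
  unfolding kcomm_def by (simp only: kmul_bij_betw[OF assms])

lemma kcomm_cong:
  assumes "\<And>i j. i \<in> I \<Longrightarrow> j \<in> I \<Longrightarrow> F i j = F' i j" "\<And>i j. i \<in> I \<Longrightarrow> j \<in> I \<Longrightarrow> H i j = H' i j"
    and "i \<in> I" "j \<in> I"
  shows "kcomm I F H i j = kcomm I F' H' i j"
  unfolding kcomm_def using assms by (intro arg_cong2[where f = minus] kmul_cong) auto

text \<open>
  The index lists of the standard basis of the \<open>d\<close>-th tensor power.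
\<close>

definition ilists :: "nat \<Rightarrow> 'i set \<Rightarrow> 'i list set" where
  "ilists d I = {L. set L \<subseteq> I \<and> length L = d}"

lemma finite_ilists [simp]: "finite I \<Longrightarrow> finite (ilists d I)"
  unfolding ilists_def by (rule finite_lists_length_eq)

lemma ilists_0 [simp]: "ilists 0 I = {[]}"
  by (auto simp: ilists_def)

lemma ilists_nth: "L \<in> ilists d I \<Longrightarrow> t < d \<Longrightarrow> L ! t \<in> I"
  by (auto simp: ilists_def)

lemma bij_betw_Cons_ilists: "bij_betw (\<lambda>(x, L). x # L) (I \<times> ilists d I) (ilists (Suc d) I)"
  by (auto simp: bij_betw_def inj_on_def ilists_def image_iff length_Suc_conv)

lemma bij_betw_snoc_ilists: "bij_betw (\<lambda>(L, x). L @ [x]) (ilists d I \<times> I) (ilists (Suc d) I)"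
proof -
  have "L \<in> (\<lambda>(L, x). L @ [x]) ` (ilists d I \<times> I)" if "L \<in> ilists (Suc d) I" for L
    using that by (cases L rule: rev_cases) (auto simp: ilists_def image_iff)
  then show ?thesis by (auto simp: bij_betw_def inj_on_def) (auto simp: ilists_def)
qed

text \<open>
  The derivation \<open>A \<otimes> 1 \<otimes> \<dots> + \<dots> + 1 \<otimes> \<dots> \<otimes> A\<close> of the \<open>d\<close>-th tensor power.  The form of the definition
  follows that of the connection on a power bundle.
\<close>

definition leibniz :: "nat \<Rightarrow> ('i \<Rightarrow> 'i \<Rightarrow> 'a::comm_ring_1) \<Rightarrow> 'i list \<Rightarrow> 'i list \<Rightarrow> 'a" where
  "leibniz d A L K = (\<Sum>s<d. \<Prod>t<d. (if t = s then A else kone) (L ! t) (K ! t))"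

lemma prod_kone_nth: "length L = d \<Longrightarrow> length K = d \<Longrightarrow> (\<Prod>t<d. kone (L ! t) (K ! t)) = kone L K"
proof (cases "L = K")
  case False
  assume "length L = d" "length K = d"
  with False obtain t where "t < d" "L ! t \<noteq> K ! t" by (metis nth_equalityI)
  then show ?thesis using False by (intro prod_zero[THEN trans]) (auto simp: kone_def)
qed (simp add: kone_def)

lemma leibniz_0 [simp]: "leibniz 0 A L K = 0"
  by (simp add: leibniz_def)

lemma leibniz_Cons:
  assumes "length L = d" "length K = d"
  shows "leibniz (Suc d) A (x # L) (y # K) = ktensor A (leibniz d A) (x, L) (y, K)"
proof -
  have "leibniz (Suc d) A (x # L) (y # K) = A x y * (\<Prod>t<d. kone (L ! t) (K ! t)) +
      (\<Sum>s<d. kone x y * (\<Prod>t<d. (if t = s then A else kone) (L ! t) (K ! t)))"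
    unfolding leibniz_def sum.lessThan_Suc_shift prod.lessThan_Suc_shift by simp
  then show ?thesis
    using assms by (simp add: prod_kone_nth ktensor_Pair leibniz_def sum_distrib_left)
qed

lemma ilists_Suc_cases:
  assumes "L \<in> ilists (Suc d) I"
  obtains x L' where "L = x # L'" "x \<in> I" "L' \<in> ilists d I"
  using assms by (auto simp: ilists_def length_Suc_conv)

lemma kcomm_leibniz:
  assumes "finite I" "L \<in> ilists d I" "K \<in> ilists d I"
  shows "kcomm (ilists d I) (leibniz d A) (leibniz d B) L K = leibniz d (kcomm I A B) L K"
  using assms(2,3)
proof (induction d arbitrary: L K)
  case 0
  then show ?case by (simp add: kcomm_def kmul_def)
next
  case (Suc d)
  obtain x L' where L: "L = x # L'" "x \<in> I" "L' \<in> ilists d I" using Suc.prems(1) by (rule ilists_Suc_cases)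
  obtain y K' where K: "K = y # K'" "y \<in> I" "K' \<in> ilists d I" using Suc.prems(2) by (rule ilists_Suc_cases)
  have len: "length M = d" if "M \<in> ilists d I" for M using that by (simp add: ilists_def)
  have "kcomm (ilists (Suc d) I) (leibniz (Suc d) A) (leibniz (Suc d) B) L K =
      kcomm (I \<times> ilists d I) (\<lambda>i j. leibniz (Suc d) A (case i of (x, L) \<Rightarrow> x # L) (case j of (x, L) \<Rightarrow> x # L))
        (\<lambda>i j. leibniz (Suc d) B (case i of (x, L) \<Rightarrow> x # L) (case j of (x, L) \<Rightarrow> x # L)) (x, L') (y, K')"
    using kcomm_bij_betw[OF bij_betw_Cons_ilists[of I d], of _ _ "(x, L')" "(y, K')"] by (simp add: L K)
  also have "\<dots> = kcomm (I \<times> ilists d I) (ktensor A (leibniz d A)) (ktensor B (leibniz d B)) (x, L') (y, K')"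
    using L K by (intro kcomm_cong) (auto simp: leibniz_Cons len)
  also have "\<dots> = ktensor (kcomm I A B) (leibniz d (kcomm I A B)) (x, L') (y, K')"
    using L K assms by (simp add: kcomm_ktensor ktensor_Pair Suc.IH)
  also have "\<dots> = leibniz (Suc d) (kcomm I A B) L K"
    using L K by (simp add: leibniz_Cons len)
  finally show ?case .
qed

lemma of_degree_ge_kone_mult: "of_degree_ge p \<alpha> \<Longrightarrow> of_degree_ge p (kone i j * \<alpha>)"
  by (simp add: kone_def)

lemma of_degree_ge_leibniz:
  assumes "\<And>i j. i \<in> I \<Longrightarrow> j \<in> I \<Longrightarrow> of_degree_ge p (F i j)" "L \<in> ilists d I" "K \<in> ilists d I"
  shows "of_degree_ge p (leibniz d F L K)"
  using assms(2,3)
proof (induction d arbitrary: L K)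
  case (Suc d)
  obtain x L' where L: "L = x # L'" "x \<in> I" "L' \<in> ilists d I" using Suc.prems(1) by (rule ilists_Suc_cases)
  obtain y K' where K: "K = y # K'" "y \<in> I" "K' \<in> ilists d I" using Suc.prems(2) by (rule ilists_Suc_cases)
  show ?case
    using L K assms(1) Suc.IH
    by (auto simp: ilists_def leibniz_Cons ktensor_Pair mult.commute[of _ "kone _ _"]
        intro!: of_degree_ge_add of_degree_ge_kone_mult)
qed simp

lemma kexp_leibniz:
  fixes F :: "'i \<Rightarrow> 'i \<Rightarrow> 'n::{finite,linorder} evform"
  assumes F: "\<And>i j. i \<in> I \<Longrightarrow> j \<in> I \<Longrightarrow> of_degree_ge 2 (F i j)"
    and I: "finite I" "L \<in> ilists d I" "K \<in> ilists d I"
  shows "kexp z (ilists d I) (leibniz d F) L K = (\<Prod>t<d. kexp z I F (L ! t) (K ! t))"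
  using I(2,3)
proof (induction d arbitrary: L K)
  case 0
  have "kpow {[]} (leibniz 0 F) k [] [] = (if k = 0 then 1 else 0)" for k
    by (induction k) (simp_all add: kone_def kmul_def)
  then have "kexp z {[]} (leibniz 0 F) [] [] = (\<Sum>k\<le>CARD('n). if k = 0 then 1 else 0)"
    unfolding kexp_def by (intro sum.cong refl) auto
  then show ?case using 0 by (simp del: leibniz_0)
next
  case (Suc d)
  obtain x L' where L: "L = x # L'" "x \<in> I" "L' \<in> ilists d I" using Suc.prems(1) by (rule ilists_Suc_cases)
  obtain y K' where K: "K = y # K'" "y \<in> I" "K' \<in> ilists d I" using Suc.prems(2) by (rule ilists_Suc_cases)
  have len: "length M = d" if "M \<in> ilists d I" for M using that by (simp add: ilists_def)
  have "kexp z (ilists (Suc d) I) (leibniz (Suc d) F) L K = kexp z (I \<times> ilists d I)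
      (\<lambda>i j. leibniz (Suc d) F (case i of (x, L) \<Rightarrow> x # L) (case j of (x, L) \<Rightarrow> x # L)) (x, L') (y, K')"
    using kexp_bij_betw[OF bij_betw_Cons_ilists[of I d], of "(x, L')" "(y, K')"] L K by simp
  also have "\<dots> = kexp z (I \<times> ilists d I) (ktensor F (leibniz d F)) (x, L') (y, K')"
    using L K by (intro kexp_cong) (auto simp: leibniz_Cons len)
  also have "\<dots> = kexp z I F x y * kexp z (ilists d I) (leibniz d F) L' K'"
    by (rule kexp_ktensor) (use F I L K in \<open>auto intro: of_degree_ge_leibniz\<close>)
  also have "\<dots> = (\<Prod>t<Suc d. kexp z I F (L ! t) (K ! t))"
    unfolding prod.lessThan_Suc_shift using L K Suc.IH by simp
  finally show ?case .
qed


section \<open>Exterior powers as alternating kernels\<close>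

text \<open>
  An alternating function of a list with a repeated entry equals its own negative; it has to vanish for
  both complex numbers and forms.
\<close>

class comm_ring_1_no_2_torsion = comm_ring_1 +
  assumes eq_uminus_imp_0: "x = - x \<Longrightarrow> x = 0"

instance complex :: comm_ring_1_no_2_torsion
  by standard simp

instance evform :: ("{finite,linorder}") comm_ring_1_no_2_torsion
  by standard (rule evform_eq_uminus_imp_0)

text \<open>
  Operators on the tensor power that commute with the permutations of the factors, and therefore descend
  to the exterior and to the symmetric power.
\<close>

definition equivariant :: "nat \<Rightarrow> ('i list \<Rightarrow> 'i list \<Rightarrow> 'a) \<Rightarrow> bool" where
  "equivariant d F \<longleftrightarrow> (\<forall>\<sigma> J K. \<sigma> permutes {..<d} \<longrightarrow> length J = d \<longrightarrow> length K = d \<longrightarrow>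
     F (permute_list \<sigma> J) (permute_list \<sigma> K) = F J K)"

lemma equivariantD:
  "equivariant d F \<Longrightarrow> \<sigma> permutes {..<d} \<Longrightarrow> length J = d \<Longrightarrow> length K = d \<Longrightarrow>
    F (permute_list \<sigma> J) (permute_list \<sigma> K) = F J K"
  by (auto simp: equivariant_def)

lemma permute_list_in_ilists: "\<sigma> permutes {..<d} \<Longrightarrow> L \<in> ilists d I \<Longrightarrow> permute_list \<sigma> L \<in> ilists d I"
  by (auto simp: ilists_def)

lemma permute_list_inv:
  assumes "\<sigma> permutes {..<d}" "length L = d"
  shows "permute_list (inv_into UNIV \<sigma>) (permute_list \<sigma> L) = L" "permute_list \<sigma> (permute_list (inv_into UNIV \<sigma>) L) = L"
proof -
  have "permute_list (inv_into UNIV \<sigma>) (permute_list \<sigma> L) = permute_list (\<sigma> \<circ> inv_into UNIV \<sigma>) L"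
    using assms permutes_inv by (intro permute_list_compose[symmetric]) auto
  then show "permute_list (inv_into UNIV \<sigma>) (permute_list \<sigma> L) = L"
    using assms(1) by (simp add: permutes_inv_o)
  have "permute_list \<sigma> (permute_list (inv_into UNIV \<sigma>) L) = permute_list (inv_into UNIV \<sigma> \<circ> \<sigma>) L"
    using assms permutes_inv by (intro permute_list_compose[symmetric]) auto
  then show "permute_list \<sigma> (permute_list (inv_into UNIV \<sigma>) L) = L"
    using assms(1) by (simp add: permutes_inv_o)
qed

lemma bij_betw_permute_list: "\<sigma> permutes {..<d} \<Longrightarrow> bij_betw (permute_list \<sigma>) (ilists d I) (ilists d I)"
  by (rule bij_betw_byWitness[of _ "permute_list (inv_into UNIV \<sigma>)"])
     (auto simp: permute_list_inv ilists_def permutes_inv)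

lemma equivariant_kone: "equivariant d kone"
  unfolding equivariant_def kone_def by (metis permute_list_inv(1))

lemma equivariant_kmul:
  assumes F: "equivariant d F" and H: "equivariant d H"
  shows "equivariant d (kmul (ilists d I) F H)"
  unfolding equivariant_def
proof (intro allI impI)
  fix \<sigma> and J K :: "'a list"
  assume \<sigma>: "\<sigma> permutes {..<d}" and len: "length J = d" "length K = d"
  have "kmul (ilists d I) F H (permute_list \<sigma> J) (permute_list \<sigma> K) =
      kmul (ilists d I) (\<lambda>J K. F (permute_list \<sigma> J) (permute_list \<sigma> K))
        (\<lambda>J K. H (permute_list \<sigma> J) (permute_list \<sigma> K)) J K"
    by (rule kmul_bij_betw[OF bij_betw_permute_list[OF \<sigma>]])
  also have "\<dots> = kmul (ilists d I) F H J K"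
    by (rule kmul_cong) (auto simp: ilists_def equivariantD[OF F \<sigma>] equivariantD[OF H \<sigma>] len)
  finally show "kmul (ilists d I) F H (permute_list \<sigma> J) (permute_list \<sigma> K) = kmul (ilists d I) F H J K" .
qed

lemma equivariant_kpow: "equivariant d F \<Longrightarrow> equivariant d (kpow (ilists d I) F k)"
  by (induction k) (simp_all add: equivariant_kone equivariant_kmul)

lemma equivariant_prod:
  "equivariant d (\<lambda>J K. \<Prod>t<d. A (J ! t) (K ! t :: 'a))"
  unfolding equivariant_def
proof (intro allI impI)
  fix \<sigma> and J K :: "'a list"
  assume \<sigma>: "\<sigma> permutes {..<d}" and len: "length J = d" "length K = d"
  have "(\<Prod>t<d. A (permute_list \<sigma> J ! t) (permute_list \<sigma> K ! t)) = (\<Prod>t<d. A (J ! \<sigma> t) (K ! \<sigma> t))"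
    using \<sigma> len by (intro prod.cong refl) (simp add: permute_list_nth)
  also have "\<dots> = (\<Prod>t<d. A (J ! t) (K ! t))"
    by (rule prod.permute[OF \<sigma>, unfolded comp_def, symmetric])
  finally show "(\<Prod>t<d. A (permute_list \<sigma> J ! t) (permute_list \<sigma> K ! t)) = (\<Prod>t<d. A (J ! t) (K ! t))" .
qed

lemma equivariant_leibniz: "equivariant d (leibniz d A)"
  unfolding equivariant_def
proof (intro allI impI)
  fix \<sigma> and J K :: "'a list"
  assume \<sigma>: "\<sigma> permutes {..<d}" and len: "length J = d" "length K = d"
  have "leibniz d A (permute_list \<sigma> J) (permute_list \<sigma> K) =
      (\<Sum>s<d. \<Prod>t<d. (if \<sigma> t = \<sigma> s then A else kone) (J ! \<sigma> t) (K ! \<sigma> t))"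
    unfolding leibniz_def using \<sigma> len
    by (intro sum.cong prod.cong refl) (simp add: permute_list_nth permutes_inj[OF \<sigma>, THEN inj_eq])
  also have "\<dots> = (\<Sum>s<d. \<Prod>t<d. (if t = \<sigma> s then A else kone) (J ! t) (K ! t))"
    by (intro sum.cong refl prod.permute[OF \<sigma>, unfolded comp_def, symmetric])
  also have "\<dots> = leibniz d A J K"
    unfolding leibniz_def by (rule sum.permute[OF \<sigma>, unfolded comp_def, symmetric])
  finally show "leibniz d A (permute_list \<sigma> J) (permute_list \<sigma> K) = leibniz d A J K" .
qed

text \<open>
  The matrix that an equivariant operator \<open>F\<close> induces on the exterior power: the coefficient of
  \<open>e\<^sub>J\<close> in the image of \<open>e\<^sub>K\<close> collects the coefficients of all rearrangements of \<open>J\<close> with their signs.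
\<close>

definition alt_kernel :: "nat \<Rightarrow> ('i list \<Rightarrow> 'i list \<Rightarrow> 'a::comm_ring_1) \<Rightarrow> 'i list \<Rightarrow> 'i list \<Rightarrow> 'a" where
  "alt_kernel d F J K = (\<Sum>\<sigma> | \<sigma> permutes {..<d}. of_int (sign \<sigma>) * F (permute_list \<sigma> J) K)"

lemma permutes_lessThan_permutation: "\<sigma> permutes {..<d::nat} \<Longrightarrow> permutation \<sigma>"
  unfolding permutation_permutes by (intro exI[of _ "{..<d}"]) simp

lemma sign_mult_self: "of_int (sign \<sigma>) * (of_int (sign \<sigma>) * x) = (x :: 'a::comm_ring_1)"
  by (simp add: sign_def)

lemma alt_permute_left:
  assumes \<tau>: "\<tau> permutes {..<d}" and "length J = d"
  shows "alt_kernel d F (permute_list \<tau> J) K = of_int (sign \<tau>) * alt_kernel d F J K"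
proof -
  have "of_int (sign \<tau>) * alt_kernel d F J K =
      (\<Sum>\<sigma> | \<sigma> permutes {..<d}. of_int (sign \<tau>) * (of_int (sign (\<tau> \<circ> \<sigma>)) * F (permute_list (\<tau> \<circ> \<sigma>) J) K))"
    unfolding alt_kernel_def sum_distrib_left by (rule setum_permutations_compose_left[OF \<tau>])
  also have "\<dots> = alt_kernel d F (permute_list \<tau> J) K"
    unfolding alt_kernel_def using assms permutes_lessThan_permutation
    by (intro sum.cong refl) (auto simp: permute_list_compose sign_compose sign_mult_self mult.assoc)
  finally show ?thesis ..
qed

lemma alt_permute_right:
  assumes F: "equivariant d F" and \<tau>: "\<tau> permutes {..<d}" and len: "length J = d" "length K = d"
  shows "alt_kernel d F J (permute_list \<tau> K) = of_int (sign \<tau>) * alt_kernel d F J K"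
proof -
  have "alt_kernel d F J (permute_list \<tau> K) =
      (\<Sum>\<sigma> | \<sigma> permutes {..<d}. of_int (sign (\<sigma> \<circ> \<tau>)) * F (permute_list (\<sigma> \<circ> \<tau>) J) (permute_list \<tau> K))"
    unfolding alt_kernel_def by (rule sum_permutations_compose_right[OF \<tau>])
  also have "\<dots> = of_int (sign \<tau>) * alt_kernel d F J K"
    unfolding alt_kernel_def sum_distrib_left using assms permutes_lessThan_permutation
    by (intro sum.cong refl) (auto simp: permute_list_compose sign_compose equivariantD[OF F])
  finally show ?thesis .
qed

lemma alt_not_distinct:
  fixes F :: "'i list \<Rightarrow> 'i list \<Rightarrow> 'a::comm_ring_1_no_2_torsion"
  assumes F: "equivariant d F" and len: "length J = d" "length K = d" and K: "\<not> distinct K"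
  shows "alt_kernel d F J K = 0"
proof -
  obtain a b where ab: "a < d" "b < d" "a \<noteq> b" "K ! a = K ! b"
    using K len by (auto simp: distinct_conv_nth)
  let ?\<tau> = "Transposition.transpose a b"
  have \<tau>: "?\<tau> permutes {..<d}" using ab by (simp add: permutes_swap_id)
  have "permute_list ?\<tau> K = K"
    by (rule nth_equalityI)
       (use \<tau> len ab in \<open>auto simp: permute_list_nth Transposition.transpose_def\<close>)
  then have "alt_kernel d F J K = - alt_kernel d F J K"
    using alt_permute_right[OF F \<tau> len] ab by (simp add: sign_swap_id)
  then show ?thesis by (rule eq_uminus_imp_0)
qed

text \<open>
  The index lists of the standard basis of the exterior power.
\<close>

definition inc_lists :: "nat \<Rightarrow> 'i::linorder set \<Rightarrow> 'i list set" where
  "inc_lists d I = {L \<in> ilists d I. sorted_wrt (<) L}"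

lemma inc_lists_subset: "inc_lists d I \<subseteq> ilists d I"
  by (auto simp: inc_lists_def)

lemma inc_lists_eq: "inc_lists d I = {L \<in> ilists d I. sorted L \<and> distinct L}"
  by (auto simp: inc_lists_def strict_sorted_iff)

lemma permute_list_distinct_eq_imp_id:
  assumes "\<sigma> permutes {..<d}" "length L = d" "distinct L" "permute_list \<sigma> L = L"
  shows "\<sigma> = id"
proof
  fix t
  show "\<sigma> t = id t"
  proof (cases "t < d")
    case True
    then have "L ! \<sigma> t = L ! t" using assms by (metis permute_list_nth)
    moreover have "\<sigma> t < d" using assms(1) True by (metis lessThan_iff permutes_in_image)
    ultimately show ?thesis using assms True by (simp add: nth_eq_iff_index_eq)
  qed (use assms permutes_not_in in fastforce)
qed

lemma bij_betw_inc_lists_permutes: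
  "bij_betw (\<lambda>(M, \<tau>). permute_list \<tau> M) (inc_lists d I \<times> {\<tau>. \<tau> permutes {..<d}}) {L \<in> ilists d I. distinct L}"
  unfolding bij_betw_def
proof
  show "inj_on (\<lambda>(M, \<tau>). permute_list \<tau> M) (inc_lists d I \<times> {\<tau>. \<tau> permutes {..<d}})"
  proof (rule inj_onI, clarify)
    fix M \<tau> M' \<tau>' assume *: "M \<in> inc_lists d I" "M' \<in> inc_lists d I" "\<tau> permutes {..<d}" "\<tau>' permutes {..<d}"
      and eq: "permute_list \<tau> M = permute_list \<tau>' M'"
    have len: "length M = d" "length M' = d" using * by (auto simp: inc_lists_def ilists_def)
    have "mset M = mset M'" using eq * len by (metis mset_permute_list)
    then have M: "M = M'" using * unfolding inc_lists_eq
      by (metis (no_types, lifting) mem_Collect_eq properties_for_sort sorted_sort_id)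
    \<comment> \<open>the two permutations differ by one that fixes the distinct list \<open>M\<close>\<close>
    have "permute_list (\<tau> \<circ> inv_into UNIV \<tau>') M = permute_list (inv_into UNIV \<tau>') (permute_list \<tau> M)"
      using * len permutes_inv by (intro permute_list_compose) auto
    also have "\<dots> = M" using eq M permute_list_inv(1)[OF *(4) len(2)] by simp
    finally have "\<tau> \<circ> inv_into UNIV \<tau>' = id"
      using * len by (intro permute_list_distinct_eq_imp_id[of _ d M] permutes_compose permutes_inv)
        (auto simp: inc_lists_eq)
    then have "\<tau> \<circ> inv_into UNIV \<tau>' \<circ> \<tau>' = \<tau>'" by simp
    then have "\<tau> = \<tau>'" using *(4) by (simp add: comp_assoc permutes_inv_o)
    then show "M = M' \<and> \<tau> = \<tau>'" using M by simp
  qed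
  show "(\<lambda>(M, \<tau>). permute_list \<tau> M) ` (inc_lists d I \<times> {\<tau>. \<tau> permutes {..<d}}) = {L \<in> ilists d I. distinct L}"
  proof (intro equalityI subsetI)
    fix L assume L: "L \<in> {L \<in> ilists d I. distinct L}"
    have "mset L = mset (sort L)" by simp
    then obtain p where p: "p permutes {..<length (sort L)}" "permute_list p (sort L) = L"
      by (rule mset_eq_permutation)
    moreover have "sort L \<in> inc_lists d I" using L by (auto simp: inc_lists_eq ilists_def)
    ultimately show "L \<in> (\<lambda>(M, \<tau>). permute_list \<tau> M) ` (inc_lists d I \<times> {\<tau>. \<tau> permutes {..<d}})"
      using L by (intro image_eqI[of _ _ "(sort L, p)"]) (auto simp: ilists_def)
  qed (auto simp: inc_lists_eq ilists_def)
qed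

text \<open>
  Every list without repetition is a permutation of exactly one increasing list.
\<close>

lemma sum_ilists_distinct:
  fixes f :: "'i::linorder list \<Rightarrow> 'a::comm_ring_1"
  assumes "finite I" and f: "\<And>L. L \<in> ilists d I \<Longrightarrow> \<not> distinct L \<Longrightarrow> f L = 0"
  shows "(\<Sum>L\<in>ilists d I. f L) = (\<Sum>M\<in>inc_lists d I. \<Sum>\<tau> | \<tau> permutes {..<d}. f (permute_list \<tau> M))"
proof -
  have "(\<Sum>L\<in>ilists d I. f L) = (\<Sum>L\<in>{L \<in> ilists d I. distinct L}. f L)"
    by (rule sum.mono_neutral_right) (use assms in auto)
  also have "\<dots> = (\<Sum>(M, \<tau>)\<in>inc_lists d I \<times> {\<tau>. \<tau> permutes {..<d}}. f (permute_list \<tau> M))"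
    by (subst sum.reindex_bij_betw[OF bij_betw_inc_lists_permutes, symmetric]) (simp add: case_prod_unfold)
  finally show ?thesis by (simp add: sum.cartesian_product)
qed

text \<open>
  Passing to the exterior power respects products: a sum over increasing lists and all
  their permutations is a sum over all lists, as alternating functions vanish on repetitions.
\<close>

lemma kmul_alt:
  fixes F :: "'i::linorder list \<Rightarrow> 'i list \<Rightarrow> 'a::comm_ring_1_no_2_torsion"
  assumes I: "finite I" and F: "equivariant d F" and J: "J \<in> ilists d I"
  shows "kmul (inc_lists d I) (alt_kernel d F) (alt_kernel d H) J K = alt_kernel d (kmul (ilists d I) F H) J K"
proof -
  have len: "length M = d" if "M \<in> ilists d I" for M using that by (simp add: ilists_def)
  have "alt_kernel d (kmul (ilists d I) F H) J K = (\<Sum>N\<in>ilists d I. alt_kernel d F J N * H N K)"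
    unfolding alt_kernel_def kmul_def sum_distrib_left sum_distrib_right by (subst sum.swap) (simp add: mult.assoc)
  also have "\<dots> = (\<Sum>M\<in>inc_lists d I. \<Sum>\<tau> | \<tau> permutes {..<d}.
      alt_kernel d F J (permute_list \<tau> M) * H (permute_list \<tau> M) K)"
    by (rule sum_ilists_distinct[OF I]) (simp add: alt_not_distinct[OF F] len J)
  also have "\<dots> = (\<Sum>M\<in>inc_lists d I. alt_kernel d F J M * alt_kernel d H M K)"
    unfolding alt_kernel_def[of d H] sum_distrib_left
    by (intro sum.cong refl) (use len J inc_lists_subset[of d I] in \<open>auto simp: alt_permute_right[OF F] mult_ac\<close>)
  finally show ?thesis by (simp add: kmul_def)
qed

lemma alt_kone:
  assumes "J \<in> inc_lists d I" "K \<in> inc_lists d I"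
  shows "alt_kernel d kone J K = (kone J K :: 'a::comm_ring_1)"
proof -
  have "(kone (permute_list \<sigma> J) K :: 'a) = (if \<sigma> = id then kone J K else 0)" if "\<sigma> permutes {..<d}" for \<sigma>
  proof (cases "permute_list \<sigma> J = K")
    case True
    have "(J, \<sigma>) = (K, id)"
      using bij_betw_inc_lists_permutes[of d I, unfolded bij_betw_def, THEN conjunct1]
      by (rule inj_onD) (use True assms that permutes_id in auto)
    then show ?thesis by simp
  next
    case False
    then show ?thesis by (auto simp: kone_def)
  qed
  then have "alt_kernel d kone J K = (\<Sum>\<sigma> | \<sigma> permutes {..<d}. if \<sigma> = id then kone J K else (0 :: 'a))"
    unfolding alt_kernel_def by (intro sum.cong refl) auto
  then show ?thesis by (simp add: finite_permutations permutes_id)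
qed

lemma kpow_alt:
  fixes F :: "'i::linorder list \<Rightarrow> 'i list \<Rightarrow> 'a::comm_ring_1_no_2_torsion"
  assumes I: "finite I" and F: "equivariant d F" and J: "J \<in> inc_lists d I" and K: "K \<in> inc_lists d I"
  shows "kpow (inc_lists d I) (alt_kernel d F) k J K = alt_kernel d (kpow (ilists d I) F k) J K"
  using K
proof (induction k arbitrary: K)
  case 0
  then show ?case using J by (simp add: alt_kone)
next
  case (Suc k)
  have "kpow (inc_lists d I) (alt_kernel d F) (Suc k) J K =
      kmul (inc_lists d I) (alt_kernel d (kpow (ilists d I) F k)) (alt_kernel d F) J K"
    unfolding kpow.simps by (rule kmul_cong) (simp_all add: Suc.IH)
  also have "\<dots> = alt_kernel d (kpow (ilists d I) F (Suc k)) J K"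
    using kmul_alt[OF I equivariant_kpow[OF F], of J] J by (simp add: inc_lists_subset[THEN subsetD])
  finally show ?case .
qed

text \<open>
  The \<open>d!\<close> permutations of an increasing list contribute equally to the sum over all lists.  The sum on the
  right-hand side no longer sees the order of the indices and factors into traces.
\<close>

lemma ktr_alt:
  fixes F :: "'i::linorder list \<Rightarrow> 'i list \<Rightarrow> 'a::comm_ring_1_no_2_torsion"
  assumes I: "finite I" and F: "equivariant d F"
  shows "of_nat (fact d) * ktr (inc_lists d I) (alt_kernel d F) = (\<Sum>L\<in>ilists d I. alt_kernel d F L L)"
proof -
  have len: "length M = d" if "M \<in> ilists d I" for M using that by (simp add: ilists_def)
  have "(\<Sum>L\<in>ilists d I. alt_kernel d F L L) = (\<Sum>M\<in>inc_lists d I. \<Sum>\<tau> | \<tau> permutes {..<d}.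
      alt_kernel d F (permute_list \<tau> M) (permute_list \<tau> M))"
    by (rule sum_ilists_distinct[OF I]) (simp add: alt_not_distinct[OF F] len)
  also have "\<dots> = (\<Sum>M\<in>inc_lists d I. \<Sum>\<tau> | \<tau> permutes {..<d}. alt_kernel d F M M)"
  proof (intro sum.cong refl)
    fix M \<tau> assume "M \<in> inc_lists d I" and \<tau>: "\<tau> \<in> {\<tau>. \<tau> permutes {..<d}}"
    then have M: "length M = d" by (simp add: inc_lists_def ilists_def)
    have "alt_kernel d F (permute_list \<tau> M) (permute_list \<tau> M) = of_int (sign \<tau>) * alt_kernel d F M (permute_list \<tau> M)"
      by (rule alt_permute_left) (use \<tau> M in auto)
    also have "alt_kernel d F M (permute_list \<tau> M) = of_int (sign \<tau>) * alt_kernel d F M M"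
      by (rule alt_permute_right[OF F]) (use \<tau> M in auto)
    finally show "alt_kernel d F (permute_list \<tau> M) (permute_list \<tau> M) = alt_kernel d F M M"
      by (simp only: sign_mult_self)
  qed
  also have "\<dots> = of_nat (fact d) * ktr (inc_lists d I) (alt_kernel d F)"
    by (simp add: ktr_def sum_distrib_left card_permutations[OF card_lessThan])
  finally show ?thesis ..
qed


section \<open>Symmetric powers and Newton's identities\<close>

text \<open>
  The matrix induced on the symmetric power.  A monomial is represented by each of its distinct
  rearrangements once, so the sum runs over lists and not over permutations.
\<close>

definition sym_kernel :: "('i list \<Rightarrow> 'i list \<Rightarrow> 'a::comm_ring_1) \<Rightarrow> 'i list \<Rightarrow> 'i list \<Rightarrow> 'a" where
  "sym_kernel F J K = (\<Sum>L | mset L = mset J. F L K)"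

definition sorted_lists :: "nat \<Rightarrow> 'i::linorder set \<Rightarrow> 'i list set" where
  "sorted_lists d I = {L \<in> ilists d I. sorted L}"

lemma mset_eq_ilists: "mset L = mset J \<Longrightarrow> J \<in> ilists d I \<Longrightarrow> L \<in> ilists d I"
  using mset_eq_setD[of L J] mset_eq_length[of L J] by (auto simp: ilists_def)

lemma finite_mset_eq [simp]: "finite {L. mset L = mset J}"
proof (rule finite_subset)
  have "J \<in> ilists (length J) (set J)" by (simp add: ilists_def)
  then show "{L. mset L = mset J} \<subseteq> ilists (length J) (set J)"
    using mset_eq_ilists by blast
qed simp

lemma bij_betw_permute_list_mset:
  assumes "\<sigma> permutes {..<length J}"
  shows "bij_betw (permute_list \<sigma>) {L. mset L = mset J} {L. mset L = mset J}"
proof (rule bij_betw_byWitness[of _ "permute_list (inv_into UNIV \<sigma>)"])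
  have len: "length L = length J" if "L \<in> {L. mset L = mset J}" for L
    using that mset_eq_length[of L J] by simp
  show "\<forall>L\<in>{L. mset L = mset J}. permute_list (inv_into UNIV \<sigma>) (permute_list \<sigma> L) = L"
    "\<forall>L\<in>{L. mset L = mset J}. permute_list \<sigma> (permute_list (inv_into UNIV \<sigma>) L) = L"
    using permute_list_inv[OF assms len] by auto
  have "permute_list \<tau> L \<in> {L. mset L = mset J}" if "L \<in> {L. mset L = mset J}" "\<tau> permutes {..<length J}" for L \<tau>
    using that(1) mset_permute_list[of \<tau> L] that(2) unfolding len[OF that(1)] by simp
  then show "permute_list \<sigma> ` {L. mset L = mset J} \<subseteq> {L. mset L = mset J}"
    "permute_list (inv_into UNIV \<sigma>) ` {L. mset L = mset J} \<subseteq> {L. mset L = mset J}"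
    using assms permutes_inv[OF assms] by (blast intro: image_subsetI)+
qed

lemma sym_kernel_permute_right:
  assumes F: "equivariant d F" and \<tau>: "\<tau> permutes {..<d}" and len: "length J = d" "length K = d"
  shows "sym_kernel F J (permute_list \<tau> K) = sym_kernel F J K"
proof -
  have "sym_kernel F J (permute_list \<tau> K) = (\<Sum>L | mset L = mset J. F (permute_list \<tau> L) (permute_list \<tau> K))"
    unfolding sym_kernel_def
    by (rule sum.reindex_bij_betw[OF bij_betw_permute_list_mset, symmetric]) (use \<tau> len in auto)
  also have "\<dots> = sym_kernel F J K"
    unfolding sym_kernel_def
  proof (intro sum.cong refl equivariantD[OF F \<tau> _ len(2)])
    fix L assume "L \<in> {L. mset L = mset J}"
    then show "length L = d" using len mset_eq_length[of L J] by simp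
  qed
  finally show ?thesis .
qed

lemma sym_kernel_mset_eq:
  assumes F: "equivariant d F" and "mset N = mset M" and len: "length J = d" "length M = d"
  shows "sym_kernel F J N = sym_kernel F J M"
proof -
  obtain \<tau> where "\<tau> permutes {..<length M}" "permute_list \<tau> M = N"
    using assms(2) by (rule mset_eq_permutation)
  then show ?thesis using sym_kernel_permute_right[OF F _ len, of \<tau>] len by auto
qed

lemma sum_ilists_sorted:
  fixes f :: "'i::linorder list \<Rightarrow> 'a::comm_monoid_add"
  assumes "finite I"
  shows "(\<Sum>L\<in>ilists d I. f L) = (\<Sum>M\<in>sorted_lists d I. \<Sum>N | mset N = mset M. f N)"
proof -
  have "(\<Sum>M\<in>sorted_lists d I. \<Sum>N \<in> {N \<in> ilists d I. sort N = M}. f N) = (\<Sum>L\<in>ilists d I. f L)"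
    by (rule sum.group) (use assms in \<open>simp_all add: sorted_lists_def\<close>, auto simp: ilists_def)
  moreover have "{N \<in> ilists d I. sort N = M} = {N. mset N = mset M}" if "M \<in> sorted_lists d I" for M
    using that mset_eq_ilists[of _ M d I] by (auto simp: sorted_lists_def intro: properties_for_sort)
  ultimately show ?thesis by simp
qed

text \<open>
  As for exterior powers; here every list is a rearrangement of exactly one sorted list.
\<close>

lemma kmul_sym_kernel:
  fixes F :: "'i::linorder list \<Rightarrow> 'i list \<Rightarrow> 'a::comm_ring_1"
  assumes I: "finite I" and F: "equivariant d F" and J: "J \<in> ilists d I"
  shows "kmul (sorted_lists d I) (sym_kernel F) (sym_kernel H) J K = sym_kernel (kmul (ilists d I) F H) J K"
proof -
  have "sym_kernel (kmul (ilists d I) F H) J K = (\<Sum>N\<in>ilists d I. sym_kernel F J N * H N K)"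
    unfolding sym_kernel_def kmul_def sum_distrib_right by (rule sum.swap)
  also have "\<dots> = (\<Sum>M\<in>sorted_lists d I. \<Sum>N | mset N = mset M. sym_kernel F J N * H N K)"
    by (rule sum_ilists_sorted[OF I])
  also have "\<dots> = (\<Sum>M\<in>sorted_lists d I. sym_kernel F J M * sym_kernel H M K)"
    unfolding sym_kernel_def[of H] sum_distrib_left
  proof (intro sum.cong refl)
    fix M N assume "M \<in> sorted_lists d I" "N \<in> {N. mset N = mset M}"
    then have "sym_kernel F J N = sym_kernel F J M"
      by (intro sym_kernel_mset_eq[OF F]) (use J in \<open>auto simp: sorted_lists_def ilists_def\<close>)
    then show "sym_kernel F J N * H N K = sym_kernel F J M * H N K" by simp
  qed
  finally show ?thesis by (simp add: kmul_def)
qed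

lemma sym_kernel_kone:
  assumes "J \<in> sorted_lists d I" "K \<in> sorted_lists d I"
  shows "sym_kernel kone J K = (kone J K :: 'a::comm_ring_1)"
proof -
  have "sym_kernel kone J K = (\<Sum>L | mset L = mset J. if L = K then 1 else (0 :: 'a))"
    unfolding sym_kernel_def kone_def by simp
  also have "\<dots> = (if mset K = mset J then 1 else 0)"
    by (simp add: sum.delta')
  also have "mset K = mset J \<longleftrightarrow> J = K"
    using assms properties_for_sort[of J K] by (auto simp: sorted_lists_def sorted_sort_id)
  also have "(if J = K then 1 else 0) = (kone J K :: 'a)" by (simp add: kone_def)
  finally show ?thesis .
qed

lemma kpow_sym_kernel:
  fixes F :: "'i::linorder list \<Rightarrow> 'i list \<Rightarrow> 'a::comm_ring_1"
  assumes I: "finite I" and F: "equivariant d F" and J: "J \<in> sorted_lists d I" and K: "K \<in> sorted_lists d I"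
  shows "kpow (sorted_lists d I) (sym_kernel F) k J K = sym_kernel (kpow (ilists d I) F k) J K"
  using K
proof (induction k arbitrary: K)
  case 0
  then show ?case using J by (simp add: sym_kernel_kone)
next
  case (Suc k)
  have "kpow (sorted_lists d I) (sym_kernel F) (Suc k) J K =
      kmul (sorted_lists d I) (sym_kernel (kpow (ilists d I) F k)) (sym_kernel F) J K"
    unfolding kpow.simps by (rule kmul_cong) (simp_all add: Suc.IH)
  also have "\<dots> = sym_kernel (kpow (ilists d I) F (Suc k)) J K"
    using J kmul_sym_kernel[OF I equivariant_kpow[OF F], of J] by (simp add: sorted_lists_def)
  finally show ?case .
qed

text \<open>
  A sorted list \<open>M\<close> with repetitions has fewer than \<open>d!\<close> rearrangements, but each of them arises from
  \<open>c\<close> permutations, where \<open>c\<close> is the order of the stabiliser of \<open>M\<close>.  The factor \<open>c\<close> that the sum over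
  permutations on the right picks up makes up for the missing rearrangements.
\<close>

lemma ktr_sym_kernel:
  fixes F :: "'i::linorder list \<Rightarrow> 'i list \<Rightarrow> 'a::comm_ring_1"
  assumes I: "finite I" and F: "equivariant d F"
  shows "of_nat (fact d) * ktr (sorted_lists d I) (sym_kernel F) =
    (\<Sum>L\<in>ilists d I. \<Sum>\<sigma> | \<sigma> permutes {..<d}. F (permute_list \<sigma> L) L)"
proof -
  let ?P = "{\<sigma>. \<sigma> permutes {..<d}}"
  have fP: "finite ?P" by (simp add: finite_permutations)
  have "(\<Sum>N | mset N = mset M. \<Sum>\<sigma>\<in>?P. F (permute_list \<sigma> N) N) = of_nat (fact d) * sym_kernel F M M"
    if "M \<in> sorted_lists d I" for M
  proof -
    have M: "length M = d" using that by (simp add: sorted_lists_def ilists_def)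
    \<comment> \<open>the order of the stabiliser of \<open>M\<close>, and the size of every fibre of \<open>\<sigma> \<mapsto> permute_list \<sigma> M\<close>\<close>
    define c where "c = card {\<sigma>. \<sigma> permutes {..<d} \<and> permute_list \<sigma> M = M}"
    have orbit: "\<exists>\<tau>\<in>?P. permute_list \<tau> M = N" if "mset N = mset M" for N
      using mset_eq_permutation[OF that] M by auto
    have fibre: "card {\<sigma>. \<sigma> permutes {..<d} \<and> permute_list \<sigma> M = N} = c" if N: "mset N = mset M" for N
    proof -
      obtain \<tau> where \<tau>: "\<tau> permutes {..<d}" "permute_list \<tau> M = N" using orbit[OF N] by auto
      have "bij_betw (\<lambda>\<sigma>. \<sigma> \<circ> \<tau>) {\<sigma> \<in> ?P. permute_list \<sigma> M = M} {\<sigma> \<in> ?P. permute_list \<sigma> M = N}"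
      proof (rule bij_betw_byWitness[of _ "\<lambda>\<sigma>. \<sigma> \<circ> inv_into UNIV \<tau>"])
        show "\<forall>\<sigma>\<in>{\<sigma> \<in> ?P. permute_list \<sigma> M = M}. \<sigma> \<circ> \<tau> \<circ> inv_into UNIV \<tau> = \<sigma>"
          using \<tau> by (simp add: comp_assoc permutes_inv_o)
        show "\<forall>\<sigma>\<in>{\<sigma> \<in> ?P. permute_list \<sigma> M = N}. \<sigma> \<circ> inv_into UNIV \<tau> \<circ> \<tau> = \<sigma>"
          using \<tau> by (simp add: comp_assoc permutes_inv_o)
        show "(\<lambda>\<sigma>. \<sigma> \<circ> \<tau>) ` {\<sigma> \<in> ?P. permute_list \<sigma> M = M} \<subseteq> {\<sigma> \<in> ?P. permute_list \<sigma> M = N}"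
          using \<tau> M by (auto simp: permutes_compose permute_list_compose)
        show "(\<lambda>\<sigma>. \<sigma> \<circ> inv_into UNIV \<tau>) ` {\<sigma> \<in> ?P. permute_list \<sigma> M = N} \<subseteq> {\<sigma> \<in> ?P. permute_list \<sigma> M = M}"
          using \<tau> M permute_list_inv(1)[OF \<tau>(1) M] permutes_inv[OF \<tau>(1)]
          by (auto simp: permutes_compose permute_list_compose)
      qed
      then have "card {\<sigma> \<in> ?P. permute_list \<sigma> M = M} = card {\<sigma> \<in> ?P. permute_list \<sigma> M = N}"
        by (rule bij_betw_same_card)
      then show ?thesis by (simp add: c_def)
    qed
    have img: "(\<lambda>\<sigma>. permute_list \<sigma> M) ` ?P \<subseteq> {N. mset N = mset M}"
      using M by auto
    have "fact d = (\<Sum>\<sigma>\<in>?P. 1 :: nat)"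
      by (simp add: card_permutations[OF card_lessThan])
    also have "\<dots> = (\<Sum>N | mset N = mset M. \<Sum>\<sigma>\<in>{\<sigma> \<in> ?P. permute_list \<sigma> M = N}. 1)"
      by (rule sum.group[OF fP _ img, symmetric]) simp
    also have "\<dots> = card {N. mset N = mset M} * c"
      by (simp add: fibre)
    finally have fact: "fact d = card {N. mset N = mset M} * c" .
    have "(\<Sum>\<sigma>\<in>?P. F (permute_list \<sigma> M) M) =
        (\<Sum>N | mset N = mset M. \<Sum>\<sigma>\<in>{\<sigma> \<in> ?P. permute_list \<sigma> M = N}. F (permute_list \<sigma> M) M)"
      by (rule sum.group[OF fP _ img, symmetric]) simp
    also have "\<dots> = (\<Sum>N | mset N = mset M. of_nat c * F N M)"
      by (intro sum.cong refl) (simp add: fibre)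
    finally have h: "(\<Sum>\<sigma>\<in>?P. F (permute_list \<sigma> M) M) = of_nat c * sym_kernel F M M"
      by (simp add: sym_kernel_def sum_distrib_left)
    \<comment> \<open>the summand of a rearrangement of \<open>M\<close> is that of \<open>M\<close>, by conjugation\<close>
    have "(\<Sum>\<sigma>\<in>?P. F (permute_list \<sigma> N) N) = (\<Sum>\<sigma>\<in>?P. F (permute_list \<sigma> M) M)" if N: "mset N = mset M" for N
    proof -
      obtain \<tau> where \<tau>: "\<tau> permutes {..<d}" "permute_list \<tau> M = N" using orbit[OF N] by auto
      have "(\<Sum>\<sigma>\<in>?P. F (permute_list \<sigma> M) M) = (\<Sum>\<sigma>\<in>?P. F (permute_list \<tau> (permute_list \<sigma> M)) N)"
        using \<tau> M by (intro sum.cong refl) (auto simp: equivariantD[OF F \<tau>(1), symmetric])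
      also have "\<dots> = (\<Sum>\<sigma>\<in>?P. F (permute_list (\<sigma> \<circ> \<tau>) M) N)"
        using \<tau> M by (intro sum.cong refl) (simp add: permute_list_compose)
      also have "\<dots> = (\<Sum>\<sigma>\<in>?P. F (permute_list \<sigma> M) N)"
        by (rule sum_permutations_compose_right[OF \<tau>(1), symmetric])
      also have "\<dots> = (\<Sum>\<sigma>\<in>?P. F (permute_list (\<tau> \<circ> \<sigma>) M) N)"
        by (rule setum_permutations_compose_left[OF \<tau>(1)])
      also have "\<dots> = (\<Sum>\<sigma>\<in>?P. F (permute_list \<sigma> N) N)"
        using \<tau> M by (intro sum.cong refl) (simp add: permute_list_compose)
      finally show ?thesis ..
    qed
    then show ?thesis by (simp add: h fact)
  qed
  then show ?thesis
    unfolding sum_ilists_sorted[OF I] ktr_def sum_distrib_left by simp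
qed

text \<open>
  The sign of a permutation for \<open>e = - 1\<close> and the trivial character for \<open>e = 1\<close>, so that exterior and
  symmetric powers are treated together.
\<close>

definition perm_weight :: "int \<Rightarrow> (nat \<Rightarrow> nat) \<Rightarrow> 'a::comm_ring_1" where
  "perm_weight e \<sigma> = (if evenperm \<sigma> then 1 else of_int e)"

lemma perm_weight_1: "perm_weight 1 \<sigma> = 1"
  by (simp add: perm_weight_def)

lemma perm_weight_comp:
  assumes "e * e = 1" "permutation \<sigma>" "permutation \<tau>"
  shows "perm_weight e (\<sigma> \<circ> \<tau>) = perm_weight e \<sigma> * (perm_weight e \<tau> :: 'a::comm_ring_1)"
proof -
  have "of_int e * of_int e = (1 :: 'a)" using assms(1) by (metis of_int_1 of_int_mult)
  then show ?thesis using assms by (simp add: perm_weight_def evenperm_comp)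
qed

text \<open>
  In \<open>cycle_sum\<close> below, the sum over \<open>L\<close> of the product belonging to \<open>\<sigma>\<close> is the product of \<open>tr (G\<^sup>l)\<close> over the cycle
  lengths \<open>l\<close> of \<open>\<sigma>\<close>.  Here the factor at position \<open>u\<close> is replaced by \<open>H\<close>; this is what makes an induction
  possible that shortens the cycle through one marked position.
\<close>

definition cycle_sum_at :: "int \<Rightarrow> nat \<Rightarrow> 'i set \<Rightarrow> nat \<Rightarrow> ('i \<Rightarrow> 'i \<Rightarrow> 'a::comm_ring_1) \<Rightarrow> ('i \<Rightarrow> 'i \<Rightarrow> 'a) \<Rightarrow> 'a" where
  "cycle_sum_at e d I u H G = (\<Sum>\<sigma> | \<sigma> permutes {..<d}. \<Sum>L\<in>ilists d I.
     perm_weight e \<sigma> * (\<Prod>t<d. (if t = u then H else G) (L ! \<sigma> t) (L ! t)))"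

definition cycle_sum :: "int \<Rightarrow> nat \<Rightarrow> 'i set \<Rightarrow> ('i \<Rightarrow> 'i \<Rightarrow> 'a::comm_ring_1) \<Rightarrow> 'a" where
  "cycle_sum e d I G = (\<Sum>\<sigma> | \<sigma> permutes {..<d}. \<Sum>L\<in>ilists d I.
     perm_weight e \<sigma> * (\<Prod>t<d. G (L ! \<sigma> t) (L ! t)))"

lemma cycle_sum_at_self: "cycle_sum_at e d I u G G = cycle_sum e d I G"
  by (simp add: cycle_sum_at_def cycle_sum_def)

text \<open>
  Conjugating \<open>\<sigma>\<close> and permuting the list by the transposition of \<open>u\<close> and \<open>v\<close> moves the mark.
\<close>

lemma cycle_sum_at_conjugate:
  fixes G H :: "'i \<Rightarrow> 'i \<Rightarrow> 'a::comm_ring_1"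
  assumes e: "e * e = 1" and uv: "u < d" "v < d"
  shows "cycle_sum_at e d I u H G = cycle_sum_at e d I v H G"
proof -
  let ?\<tau> = "Transposition.transpose u v"
  have \<tau>: "?\<tau> permutes {..<d}" using uv by (simp add: permutes_swap_id)
  have [simp]: "?\<tau> t < d \<longleftrightarrow> t < d" for t using permutes_in_image[OF \<tau>, of t] by simp
  let ?f = "\<lambda>w \<sigma> L. perm_weight e \<sigma> * (\<Prod>t<d. (if t = w then H else G) (L ! \<sigma> t) (L ! t))"
  have "cycle_sum_at e d I u H G = (\<Sum>\<sigma> | \<sigma> permutes {..<d}. \<Sum>L\<in>ilists d I. ?f u \<sigma> L)"
    by (simp add: cycle_sum_at_def)
  also have "\<dots> = (\<Sum>\<sigma> | \<sigma> permutes {..<d}. \<Sum>L\<in>ilists d I. ?f u (?\<tau> \<circ> \<sigma>) L)"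
    by (rule setum_permutations_compose_left[OF \<tau>])
  also have "\<dots> = (\<Sum>\<sigma> | \<sigma> permutes {..<d}. \<Sum>L\<in>ilists d I. ?f u (?\<tau> \<circ> (\<sigma> \<circ> ?\<tau>)) L)"
    by (rule sum_permutations_compose_right[OF \<tau>])
  also have "\<dots> = (\<Sum>\<sigma> | \<sigma> permutes {..<d}. \<Sum>L\<in>ilists d I. ?f u (?\<tau> \<circ> (\<sigma> \<circ> ?\<tau>)) (permute_list ?\<tau> L))"
    by (intro sum.cong refl sum.reindex_bij_betw[OF bij_betw_permute_list[OF \<tau>], symmetric])
  also have "\<dots> = cycle_sum_at e d I v H G"
    unfolding cycle_sum_at_def
  proof (intro sum.cong refl)
    fix \<sigma> L assume "\<sigma> \<in> {\<sigma>. \<sigma> permutes {..<d}}" and "L \<in> ilists d I"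
    then have \<sigma>: "\<sigma> permutes {..<d}" and L: "length L = d" by (auto simp: ilists_def)
    have [simp]: "\<sigma> t < d \<longleftrightarrow> t < d" for t using permutes_in_image[OF \<sigma>, of t] by simp
    have w: "perm_weight e (?\<tau> \<circ> (\<sigma> \<circ> ?\<tau>)) = (perm_weight e \<sigma> :: 'a)"
    proof -
      have "permutation \<sigma>" "permutation ?\<tau>" using \<sigma> \<tau> permutes_lessThan_permutation by auto
      then show ?thesis
        by (simp add: perm_weight_def evenperm_comp permutation_compose)
    qed
    have "(\<Prod>t<d. (if t = u then H else G) (permute_list ?\<tau> L ! (?\<tau> \<circ> (\<sigma> \<circ> ?\<tau>)) t) (permute_list ?\<tau> L ! t))
        = (\<Prod>t<d. (if ?\<tau> t = v then H else G) (L ! \<sigma> (?\<tau> t)) (L ! ?\<tau> t))"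
      using \<tau> L by (intro prod.cong refl) (auto simp: permute_list_nth transpose_eq_iff)
    also have "\<dots> = (\<Prod>t<d. (if t = v then H else G) (L ! \<sigma> t) (L ! t))"
      by (rule prod.permute[OF \<tau>, unfolded comp_def, symmetric])
    finally show "?f u (?\<tau> \<circ> (\<sigma> \<circ> ?\<tau>)) (permute_list ?\<tau> L) = ?f v \<sigma> L"
      by (simp only: w)
  qed
  finally show ?thesis .
qed

lemma sum_ilists_snoc: "(\<Sum>L\<in>ilists (Suc d) I. f L) = (\<Sum>L\<in>ilists d I. \<Sum>x\<in>I. f (L @ [x]))"
  by (subst sum.reindex_bij_betw[OF bij_betw_snoc_ilists, symmetric])
     (simp add: sum.cartesian_product case_prod_unfold)

text \<open>
  Sort the permutations of \<open>{..d}\<close> by what happens to the marked position \<open>d\<close>.  If it is fixed, it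
  contributes \<open>tr H\<close>.  Otherwise it is inserted into a cycle of a permutation of \<open>{..<d}\<close>, which multiplies the weight by
  \<open>e\<close>, and the sum over the index at \<open>d\<close> merges \<open>H\<close> with the factor \<open>G\<close> next to it in the cycle.
\<close>

lemma cycle_sum_at_Suc:
  fixes G H :: "'i \<Rightarrow> 'i \<Rightarrow> 'a::comm_ring_1"
  assumes e: "e * e = 1" and I: "finite I"
  shows "cycle_sum_at e (Suc d) I d H G = ktr I H * cycle_sum e d I G
    + of_int e * of_nat d * cycle_sum_at e d I (d - 1) (kmul I H G) G"
proof -
  let ?P = "{\<sigma>. \<sigma> permutes {..<d}}"
  let ?f = "\<lambda>\<sigma> L. perm_weight e \<sigma> * (\<Prod>t<Suc d. (if t = d then H else G) (L ! \<sigma> t) (L ! t))"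
  let ?p = "\<lambda>b \<sigma>. Transposition.transpose d b \<circ> \<sigma>"
  have "cycle_sum_at e (Suc d) I d H G = (\<Sum>\<sigma> | \<sigma> permutes insert d {..<d}. \<Sum>L\<in>ilists (Suc d) I. ?f \<sigma> L)"
    by (simp add: cycle_sum_at_def lessThan_Suc)
  also have "\<dots> = (\<Sum>b\<in>insert d {..<d}. \<Sum>\<sigma>\<in>?P. \<Sum>L\<in>ilists (Suc d) I. ?f (?p b \<sigma>) L)"
    by (rule sum_over_permutations_insert) auto
  also have "\<dots> = (\<Sum>b\<in>insert d {..<d}. \<Sum>\<sigma>\<in>?P. \<Sum>L\<in>ilists d I. \<Sum>x\<in>I. ?f (?p b \<sigma>) (L @ [x]))"
    by (simp only: sum_ilists_snoc)
  also have "\<dots> = (\<Sum>\<sigma>\<in>?P. \<Sum>L\<in>ilists d I. \<Sum>x\<in>I. ?f \<sigma> (L @ [x]))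
      + (\<Sum>b<d. \<Sum>\<sigma>\<in>?P. \<Sum>L\<in>ilists d I. \<Sum>x\<in>I. ?f (?p b \<sigma>) (L @ [x]))"
    by simp
  also have "(\<Sum>\<sigma>\<in>?P. \<Sum>L\<in>ilists d I. \<Sum>x\<in>I. ?f \<sigma> (L @ [x])) = ktr I H * cycle_sum e d I G"
    unfolding cycle_sum_def ktr_def sum_distrib_left sum_distrib_right
  proof (intro sum.cong refl)
    fix \<sigma> L x assume "\<sigma> \<in> ?P" "L \<in> ilists d I"
    then have \<sigma>: "\<sigma> permutes {..<d}" and L: "length L = d" by (auto simp: ilists_def)
    have "\<sigma> d = d" using \<sigma> permutes_not_in by fastforce
    moreover have "(\<Prod>t<d. (if t = d then H else G) ((L @ [x]) ! \<sigma> t) ((L @ [x]) ! t)) = (\<Prod>t<d. G (L ! \<sigma> t) (L ! t))"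
      using permutes_in_image[OF \<sigma>] L by (intro prod.cong refl) (auto simp: nth_append)
    ultimately show "?f \<sigma> (L @ [x]) = H x x * (perm_weight e \<sigma> * (\<Prod>t<d. G (L ! \<sigma> t) (L ! t)))"
      using L nth_append_length[of L x "[]"] by (simp add: mult_ac)
  qed
  also have "(\<Sum>b<d. \<Sum>\<sigma>\<in>?P. \<Sum>L\<in>ilists d I. \<Sum>x\<in>I. ?f (?p b \<sigma>) (L @ [x]))
      = (\<Sum>\<sigma>\<in>?P. \<Sum>b<d. \<Sum>L\<in>ilists d I. \<Sum>x\<in>I. ?f (?p b \<sigma>) (L @ [x]))"
    by (rule sum.swap)
  \<comment> \<open>name the place of insertion by the position \<open>u\<close> that is mapped to \<open>d\<close> afterwards\<close>
  also have "\<dots> = (\<Sum>\<sigma>\<in>?P. \<Sum>u<d. \<Sum>L\<in>ilists d I. \<Sum>x\<in>I. ?f (?p (\<sigma> u) \<sigma>) (L @ [x]))"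
    by (intro sum.cong refl sum.permute[unfolded comp_def]) auto
  also have "\<dots> = (\<Sum>\<sigma>\<in>?P. \<Sum>u<d. \<Sum>L\<in>ilists d I.
      of_int e * (perm_weight e \<sigma> * (\<Prod>t<d. (if t = u then kmul I H G else G) (L ! \<sigma> t) (L ! t))))"
  proof (intro sum.cong refl)
    fix \<sigma> u L assume "\<sigma> \<in> ?P" "L \<in> ilists d I" "u \<in> {..<d}"
    then have \<sigma>: "\<sigma> permutes {..<d}" and L: "length L = d" and u: "u < d" by (auto simp: ilists_def)
    have \<sigma>d: "\<sigma> d = d" using \<sigma> permutes_not_in by fastforce
    have \<sigma>_less: "\<sigma> t < d \<longleftrightarrow> t < d" for t using permutes_in_image[OF \<sigma>, of t] by simp
    have w: "perm_weight e (?p (\<sigma> u) \<sigma>) = of_int e * (perm_weight e \<sigma> :: 'a)"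
    proof -
      have "perm_weight e (?p (\<sigma> u) \<sigma>) = perm_weight e (Transposition.transpose d (\<sigma> u)) * (perm_weight e \<sigma> :: 'a)"
        using permutes_lessThan_permutation[OF \<sigma>] by (intro perm_weight_comp e) (auto simp: permutation_swap_id)
      moreover have "d \<noteq> \<sigma> u" using \<sigma>_less[of u] u by auto
      ultimately show ?thesis by (simp add: perm_weight_def evenperm_swap)
    qed
    define Q where "Q = (\<Prod>t\<in>{..<d} - {u}. G (L ! \<sigma> t) (L ! t))"
    have "?f (?p (\<sigma> u) \<sigma>) (L @ [x]) = of_int e * (perm_weight e \<sigma> * (H (L ! \<sigma> u) x * G x (L ! u) * Q))" for x
    proof -
      have "(\<Prod>t<d. (if t = d then H else G) ((L @ [x]) ! ?p (\<sigma> u) \<sigma> t) ((L @ [x]) ! t)) =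
          (\<Prod>t<d. if t = u then G x (L ! u) else G (L ! \<sigma> t) (L ! t))"
      proof (intro prod.cong refl)
        fix t assume t: "t \<in> {..<d}"
        have "\<sigma> t \<noteq> d" "\<sigma> t < d" using \<sigma>_less[of t] t by auto
        moreover have "\<sigma> t = \<sigma> u \<longleftrightarrow> t = u" using permutes_inj[OF \<sigma>] by (simp add: inj_eq)
        ultimately show "(if t = d then H else G) ((L @ [x]) ! ?p (\<sigma> u) \<sigma> t) ((L @ [x]) ! t) =
            (if t = u then G x (L ! u) else G (L ! \<sigma> t) (L ! t))"
          using t L by (auto simp: nth_append Transposition.transpose_def)
      qed
      also have "\<dots> = G x (L ! u) * Q"
        using u by (simp add: prod.remove[of _ u] Q_def)
      finally show ?thesis
        using \<sigma>d \<sigma>_less[of u] u L by (simp add: w nth_append mult_ac)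
    qed
    then have "(\<Sum>x\<in>I. ?f (?p (\<sigma> u) \<sigma>) (L @ [x])) = of_int e * (perm_weight e \<sigma> * (kmul I H G (L ! \<sigma> u) (L ! u) * Q))"
      by (simp add: kmul_def sum_distrib_left sum_distrib_right)
    also have "kmul I H G (L ! \<sigma> u) (L ! u) * Q = (\<Prod>t<d. (if t = u then kmul I H G else G) (L ! \<sigma> t) (L ! t))"
      using u by (simp add: prod.remove[of _ u] Q_def)
    finally show "(\<Sum>x\<in>I. ?f (?p (\<sigma> u) \<sigma>) (L @ [x])) =
      of_int e * (perm_weight e \<sigma> * (\<Prod>t<d. (if t = u then kmul I H G else G) (L ! \<sigma> t) (L ! t)))" .
  qed
  also have "\<dots> = (\<Sum>u<d. of_int e * cycle_sum_at e d I u (kmul I H G) G)"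
    unfolding cycle_sum_at_def sum_distrib_left by (rule sum.swap)
  also have "\<dots> = (\<Sum>u<d. of_int e * cycle_sum_at e d I (d - 1) (kmul I H G) G)"
    by (intro sum.cong refl arg_cong[where f = "\<lambda>x. of_int e * x"] cycle_sum_at_conjugate[OF e]) auto
  finally show ?thesis by (simp add: mult_ac)
qed

lemma cycle_sum_0: "cycle_sum e 0 I G = 1"
proof -
  have "{\<sigma>. \<sigma> permutes {..<0::nat}} = {id}" by auto
  then show ?thesis by (simp add: cycle_sum_def perm_weight_def)
qed

lemma cycle_sum_at_cong:
  assumes "\<And>i j. i \<in> I \<Longrightarrow> j \<in> I \<Longrightarrow> H i j = H' i j"
  shows "cycle_sum_at e d I u H G = cycle_sum_at e d I u H' G"
  unfolding cycle_sum_at_def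
proof (intro sum.cong refl arg_cong2[where f = "(*)"] prod.cong)
  fix \<sigma> L t assume "\<sigma> \<in> {\<sigma>. \<sigma> permutes {..<d}}" "L \<in> ilists d I" "t \<in> {..<d}"
  then have "L ! \<sigma> t \<in> I" "L ! t \<in> I"
    using permutes_in_image[of \<sigma> "{..<d}" t] by (auto intro: ilists_nth)
  then show "(if t = u then H else G) (L ! \<sigma> t) (L ! t) = (if t = u then H' else G) (L ! \<sigma> t) (L ! t)"
    by (cases "t = u") (simp_all add: assms)
qed

text \<open>
  The auxiliary sums of the recursion, with a power of \<open>G\<close> itself at the marked position.
\<close>

definition cycle_sum_power :: "int \<Rightarrow> 'i set \<Rightarrow> ('i \<Rightarrow> 'i \<Rightarrow> 'a::comm_ring_1) \<Rightarrow> nat \<Rightarrow> nat \<Rightarrow> 'a" where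
  "cycle_sum_power e I G d m = cycle_sum_at e (Suc d) I d (kpow I G m) G"

lemma cycle_sum_power_0:
  assumes "e * e = 1" "finite I"
  shows "cycle_sum_power e I G 0 m = ktr I (kpow I G m)"
  using cycle_sum_at_Suc[OF assms, of 0 "kpow I G m" G] by (simp add: cycle_sum_power_def cycle_sum_0)

lemma cycle_sum_power_Suc:
  assumes "e * e = 1" "finite I"
  shows "cycle_sum_power e I G (Suc d) m = ktr I (kpow I G m) * cycle_sum e (Suc d) I G
    + of_int e * of_nat (Suc d) * cycle_sum_power e I G d (Suc m)"
  using cycle_sum_at_Suc[OF assms, of "Suc d" "kpow I G m" G] by (simp add: cycle_sum_power_def)

lemma cycle_sum_Suc:
  assumes "finite I"
  shows "cycle_sum e (Suc d) I G = cycle_sum_power e I G d (Suc 0)"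
  unfolding cycle_sum_power_def cycle_sum_at_self[of e "Suc d" I d G, symmetric]
  by (rule cycle_sum_at_cong) (use assms in \<open>simp add: kmul_kone_left\<close>)

lemma cycle_sum_power_eq:
  fixes G :: "'i \<Rightarrow> 'i \<Rightarrow> 'a::comm_ring_1"
  assumes "e * e = 1" "finite I"
  shows "cycle_sum_power e I G d m = (\<Sum>j\<le>d. of_int (e ^ j) * of_nat (fact d div fact (d - j)) *
    (ktr I (kpow I G (m + j)) * cycle_sum e (d - j) I G))"
proof (induction d arbitrary: m)
  case 0
  then show ?case by (simp add: cycle_sum_power_0[OF assms] cycle_sum_0)
next
  case (Suc d)
  have fact: "fact (Suc d) div fact (d - j) = Suc d * (fact d div fact (d - j) :: nat)" for j
    by (simp add: div_mult_swap fact_dvd del: mult_Suc)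
  have "of_int e * of_nat (Suc d) * cycle_sum_power e I G d (Suc m) =
      (\<Sum>j\<le>d. of_int (e ^ Suc j) * of_nat (fact (Suc d) div fact (d - j)) *
        (ktr I (kpow I G (m + Suc j)) * cycle_sum e (d - j) I G))"
    unfolding Suc.IH sum_distrib_left fact of_nat_mult
    by (intro sum.cong refl) (simp add: mult_ac del: kpow.simps of_nat_Suc)
  then show ?case
    unfolding cycle_sum_power_Suc[OF assms] sum.atMost_Suc_shift by (simp del: kpow.simps fact_Suc)
qed

text \<open>
  For a diagonal \<open>G\<close>, \<open>cycle_sum e d\<close> is \<open>d!\<close> times the \<open>d\<close>-th elementary (\<open>e = - 1\<close>) or complete homogeneous
  (\<open>e = 1\<close>) symmetric polynomial in the eigenvalues, and \<open>tr (G\<^sup>j)\<close> is the \<open>j\<close>-th power sum.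
\<close>

lemma newton_identity:
  fixes G :: "'i \<Rightarrow> 'i \<Rightarrow> 'a::comm_ring_1"
  assumes "e * e = 1" "finite I"
  shows "cycle_sum e (Suc d) I G = (\<Sum>j\<le>d. of_int (e ^ j) * of_nat (fact d div fact (d - j)) *
    (ktr I (kpow I G (Suc j)) * cycle_sum e (d - j) I G))"
  using cycle_sum_power_eq[OF assms, of G d "Suc 0"] by (simp add: cycle_sum_Suc[OF assms(2)] del: kpow.simps)

lemma inc_lists_lessThan: "inc_lists n {..<n} = {[0..<n]}"
proof (intro equalityI subsetI)
  fix L assume "L \<in> inc_lists n {..<n}"
  then have L: "sorted L" "distinct L" "set L \<subseteq> {..<n}" "length L = n" by (auto simp: inc_lists_eq ilists_def)
  then have "set L = set [0..<n]"
    by (metis card_lessThan card_subset_eq distinct_card finite_lessThan lessThan_atLeast0 atLeast_upt)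
  then show "L \<in> {[0..<n]}" using L sorted_distinct_set_unique[of L "[0..<n]"] by simp
qed (auto simp: inc_lists_eq ilists_def)

text \<open>
  The determinant is the trace on the top exterior power, whose basis is the single increasing list.
\<close>

lemma det_eq_cycle_sum:
  fixes M :: "'a::comm_ring_1_no_2_torsion mat"
  assumes M: "M \<in> carrier_mat n n"
  shows "of_nat (fact n) * Determinant.det M = cycle_sum (- 1) n {..<n} (\<lambda>i j. M $$ (i, j))"
proof -
  let ?F = "\<lambda>J K. \<Prod>t<n. M $$ (J ! t, K ! t)"
  have F: "equivariant n ?F" by (rule equivariant_prod)
  have "Determinant.det M = alt_kernel n ?F [0..<n] [0..<n]"
    unfolding det_col[OF M] alt_kernel_def
  proof (intro sum.cong arg_cong2[where f = "(*)"] prod.cong)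
    fix \<sigma> t assume "\<sigma> \<in> {\<sigma>. \<sigma> permutes {..<n}}" "t \<in> {..<n}"
    then show "M $$ (\<sigma> t, t) = M $$ (permute_list \<sigma> [0..<n] ! t, [0..<n] ! t)"
      using permutes_in_image[of \<sigma> "{..<n}" t] by (simp add: permute_list_nth)
  qed (auto simp: atLeast0LessThan)
  then have "of_nat (fact n) * Determinant.det M = (\<Sum>L\<in>ilists n {..<n}. alt_kernel n ?F L L)"
    using ktr_alt[OF _ F, of "{..<n}"] by (simp add: inc_lists_lessThan ktr_def)
  also have "\<dots> = (\<Sum>L\<in>ilists n {..<n}. \<Sum>\<sigma> | \<sigma> permutes {..<n}. perm_weight (- 1) \<sigma> * (\<Prod>t<n. M $$ (L ! \<sigma> t, L ! t)))"
    unfolding alt_kernel_def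
    by (intro sum.cong refl arg_cong2[where f = "(*)"] prod.cong)
       (auto simp: sign_def perm_weight_def permute_list_nth ilists_def)
  also have "\<dots> = cycle_sum (- 1) n {..<n} (\<lambda>i j. M $$ (i, j))"
    unfolding cycle_sum_def by (rule sum.swap)
  finally show ?thesis .
qed


section \<open>Chern characters of sums and tensor products\<close>

lemma pderiv_at_eqI:
  assumes "(f has_derivative f') (at x)"
  shows "pderiv_at k f x = f' (axis k 1)"
  using frechet_derivative_at[OF assms] by (simp add: pderiv_at_def)

lemma pderiv_at_const [simp]: "pderiv_at k (\<lambda>y. c) x = 0"
  by (rule pderiv_at_eqI[of _ "\<lambda>_. 0"]) simp

lemma pderiv_at_add:
  assumes "f differentiable (at x)" "g differentiable (at x)"
  shows "pderiv_at k (\<lambda>y. f y + g y) x = pderiv_at k f x + pderiv_at k g x"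
proof -
  have "((\<lambda>y. f y + g y) has_derivative (\<lambda>v. frechet_derivative f (at x) v + frechet_derivative g (at x) v)) (at x)"
    using assms by (intro has_derivative_add) (auto simp: frechet_derivative_works)
  from pderiv_at_eqI[OF this] show ?thesis by (simp add: pderiv_at_def)
qed

lemma pderiv_at_cmult:
  fixes f :: "real ^ 'n \<Rightarrow> complex"
  assumes "f differentiable (at x)"
  shows "pderiv_at k (\<lambda>y. c * f y) x = c * pderiv_at k f x"
proof -
  have "((\<lambda>y. c * f y) has_derivative (\<lambda>v. c * frechet_derivative f (at x) v)) (at x)"
    using assms by (intro has_derivative_mult_right) (auto simp: frechet_derivative_works)
  from pderiv_at_eqI[OF this] show ?thesis by (simp add: pderiv_at_def)
qed

lemma pderiv_at_sum:
  assumes "\<And>i. i \<in> S \<Longrightarrow> f i differentiable (at x)"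
  shows "pderiv_at k (\<lambda>y. \<Sum>i\<in>S. f i y) x = (\<Sum>i\<in>S. pderiv_at k (f i) x)"
proof -
  have "((\<lambda>y. \<Sum>i\<in>S. f i y) has_derivative (\<lambda>v. \<Sum>i\<in>S. frechet_derivative (f i) (at x) v)) (at x)"
    using assms by (intro has_derivative_sum) (auto simp: frechet_derivative_works)
  from pderiv_at_eqI[OF this] show ?thesis by (simp add: pderiv_at_def)
qed

lemma differentiable_cmult:
  fixes f :: "'v::real_normed_vector \<Rightarrow> complex"
  shows "f differentiable (at x) \<Longrightarrow> (\<lambda>y. c * f y) differentiable (at x)"
  by (intro differentiable_mult differentiable_const)

text \<open>
  What is needed of a bundle at one point.  The condition holds for all bundles built from the tangent
  bundle, and it makes derivatives of the connection linear in the connection.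
\<close>

definition regular :: "('i, 'm, 'n::finite) vbundle \<Rightarrow> 'i \<Rightarrow> real ^ 'n \<Rightarrow> bool" where
  "regular E a x \<longleftrightarrow> (\<forall>k y. conn E a k y \<in> carrier_mat (rank E) (rank E)) \<and>
     (\<forall>k i j. i < rank E \<longrightarrow> j < rank E \<longrightarrow> (\<lambda>y. conn E a k y $$ (i, j)) differentiable (at x))"

definition conn_kernel :: "('i, 'm, 'n::finite) vbundle \<Rightarrow> 'i \<Rightarrow> 'n \<Rightarrow> real ^ 'n \<Rightarrow> nat \<Rightarrow> nat \<Rightarrow> complex" where
  "conn_kernel E a k y i j = conn E a k y $$ (i, j)"

text \<open>
  The entries of \<open>(\<i>/2\<pi>) R\<close>.
\<close>

definition chern_form :: "('i, 'm, 'n) vbundle \<Rightarrow> 'i \<Rightarrow> real ^ ('n::{finite,linorder}) \<Rightarrow> nat \<Rightarrow> nat \<Rightarrow> 'n evform" where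
  "chern_form E a x i j = const_form (\<i> / (2 * pi)) * form2 (\<lambda>k l. curvature_coeff E a x k l i j)"

lemma regular_differentiable:
  "regular E a x \<Longrightarrow> i < rank E \<Longrightarrow> j < rank E \<Longrightarrow> (\<lambda>y. conn_kernel E a k y i j) differentiable (at x)"
  by (simp add: regular_def conn_kernel_def)

lemma mat_mult_kmul:
  assumes "A \<in> carrier_mat n n" "B \<in> carrier_mat n n" "i < n" "j < n"
  shows "(A * B) $$ (i, j) = kmul {..<n} (\<lambda>i j. A $$ (i, j)) (\<lambda>i j. B $$ (i, j)) i j"
  using assms by (simp add: scalar_prod_def kmul_def atLeast0LessThan)

lemma pow_mat_kpow:
  assumes "A \<in> carrier_mat n n" "i < n" "j < n"
  shows "(A ^\<^sub>m k) $$ (i, j) = kpow {..<n} (\<lambda>i j. A $$ (i, j)) k i j"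
  using \<open>j < n\<close>
proof (induction k arbitrary: j)
  case 0
  then show ?case using assms by (simp add: kone_def)
next
  case (Suc k)
  have "(A ^\<^sub>m Suc k) $$ (i, j) = kmul {..<n} (\<lambda>i j. (A ^\<^sub>m k) $$ (i, j)) (\<lambda>i j. A $$ (i, j)) i j"
    unfolding pow_mat.simps by (rule mat_mult_kmul[OF pow_carrier_mat[OF assms(1)] assms(1,2) Suc.prems])
  also have "\<dots> = kpow {..<n} (\<lambda>i j. A $$ (i, j)) (Suc k) i j"
    unfolding kpow.simps by (rule kmul_cong) (auto simp: Suc.IH)
  finally show ?case .
qed

lemma curvature_coeff_regular:
  assumes "regular E a x" "i < rank E" "j < rank E"
  shows "curvature_coeff E a x k l i j =
    pderiv_at k (\<lambda>y. conn_kernel E a l y i j) x - pderiv_at l (\<lambda>y. conn_kernel E a k y i j) x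
    + kcomm {..<rank E} (conn_kernel E a k x) (conn_kernel E a l x) i j"
proof -
  have c: "conn E a k y \<in> carrier_mat (rank E) (rank E)" for k y
    using assms by (simp add: regular_def)
  have "(conn E a k x * conn E a l x - conn E a l x * conn E a k x) $$ (i, j) =
      (conn E a k x * conn E a l x) $$ (i, j) - (conn E a l x * conn E a k x) $$ (i, j)"
    using c[of k x] c[of l x] assms by (intro index_minus_mat) auto
  then show ?thesis
    unfolding curvature_coeff_def kcomm_def
    by (simp only: mat_mult_kmul[OF c c assms(2,3)] conn_kernel_def[abs_def])
qed

lemma of_degree_ge_chern_form: "of_degree_ge 2 (chern_form E a x i j)"
  unfolding chern_form_def by (intro of_degree_ge_const_mult of_degree_ge_form2)


text \<open>
  Both the Chern character (\<open>z = 1\<close>) and the \<open>A\<close>-form (\<open>z = 1/2\<close>) are power series in multiples of the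
  same matrix.
\<close>

lemma fps_mat_curvature_index:
  fixes E :: "('i, 'm, 'n::{finite,linorder}) vbundle"
  assumes "i < rank E" "j < rank E"
  shows "fps_mat f (const_form (z * (\<i> / (2 * pi))) \<cdot>\<^sub>m curvature E a x) $$ (i, j) =
    (\<Sum>k\<le>CARD('n). const_form (fps_nth f k * z ^ k) * kpow {..<rank E} (chern_form E a x) k i j)"
proof -
  let ?R = "const_form (z * (\<i> / (2 * pi))) \<cdot>\<^sub>m curvature E a x"
  have R: "?R \<in> carrier_mat (rank E) (rank E)" by (simp add: curvature_def)
  have "(?R ^\<^sub>m k) $$ (i, j) = const_form (z ^ k) * kpow {..<rank E} (chern_form E a x) k i j" for k
  proof -
    have "(?R ^\<^sub>m k) $$ (i, j) = kpow {..<rank E} (\<lambda>i j. ?R $$ (i, j)) k i j"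
      using assms by (intro pow_mat_kpow[OF R])
    also have "\<dots> = kpow {..<rank E} (\<lambda>i j. const_form z * chern_form E a x i j) k i j"
      by (rule kpow_cong)
         (use assms in \<open>auto simp: curvature_def chern_form_def simp flip: const_form_mult mult.assoc\<close>)
    also have "\<dots> = const_form (z ^ k) * kpow {..<rank E} (chern_form E a x) k i j"
      by (simp add: kpow_scale const_form_power)
    finally show ?thesis .
  qed
  then show ?thesis
    using assms R by (simp add: fps_mat_def const_form_mult mult.assoc curvature_def)
qed

lemma ch_bundle_eq_ktr:
  "ch_bundle E a x = ktr {..<rank E} (kexp 1 {..<rank E} (chern_form E a x))"
proof -
  have d: "dim_row (fps_mat (fps_exp 1) (const_form (\<i> / (2 * pi)) \<cdot>\<^sub>m curvature E a x)) = rank E"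
    by (simp add: fps_mat_def curvature_def)
  show ?thesis
    unfolding ch_bundle_def tr_def d ktr_def kexp_def
    using fps_mat_curvature_index[where z = 1 and f = "fps_exp 1"] by (intro sum.cong refl) simp
qed

lemma ch_bundle_bij_betw:
  assumes f: "bij_betw f {..<rank E} S"
    and "\<And>i j. i < rank E \<Longrightarrow> j < rank E \<Longrightarrow> chern_form E a x i j = F (f i) (f j)"
  shows "ch_bundle E a x = ktr S (kexp 1 S F)"
  unfolding ch_bundle_eq_ktr ktr_kexp ktr_kpow_bij_betw[OF f]
  by (intro sum.cong refl arg_cong2[where f = "(*)"]) (auto simp: ktr_def assms(2) intro!: sum.cong kpow_cong)

lemma regular_triv_bundle: "regular (triv_bundle r) a x"
  by (simp add: regular_def triv_bundle_def)

lemma chern_form_triv_bundle: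
  assumes "i < r" "j < r"
  shows "chern_form (triv_bundle r :: ('i, 'm, 'n::{finite,linorder}) vbundle) a x i j = 0"
proof -
  have "curvature_coeff (triv_bundle r :: ('i, 'm, 'n) vbundle) a x k l i j = 0" for k l
    using assms by (simp add: curvature_coeff_def triv_bundle_def)
  then show ?thesis by (simp add: chern_form_def)
qed

text \<open>
  The block diagonal matrix, on the disjoint union of the index sets.
\<close>

definition ksum :: "('i \<Rightarrow> 'i \<Rightarrow> 'a::comm_ring_1) \<Rightarrow> ('j \<Rightarrow> 'j \<Rightarrow> 'a) \<Rightarrow> 'i + 'j \<Rightarrow> 'i + 'j \<Rightarrow> 'a" where
  "ksum F H p q = (case p of Inl i \<Rightarrow> (case q of Inl j \<Rightarrow> F i j | Inr _ \<Rightarrow> 0)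
                  | Inr i \<Rightarrow> (case q of Inl _ \<Rightarrow> 0 | Inr j \<Rightarrow> H i j))"

lemma ksum_simps [simp]:
  "ksum F H (Inl i) (Inl j) = F i j" "ksum F H (Inr i') (Inr j') = H i' j'"
  "ksum F H (Inl i) (Inr j') = 0" "ksum F H (Inr i') (Inl j) = 0"
  by (simp_all add: ksum_def)

lemma kmul_ksum:
  assumes "finite I" "finite J"
  shows "kmul (I <+> J) (ksum F H) (ksum F' H') = ksum (kmul I F F') (kmul J H H')"
proof (intro ext)
  fix p q
  show "kmul (I <+> J) (ksum F H) (ksum F' H') p q = ksum (kmul I F F') (kmul J H H') p q"
    using assms by (cases p; cases q) (simp_all add: kmul_def sum.Plus)
qed

lemma kpow_ksum:
  fixes F :: "'i \<Rightarrow> 'i \<Rightarrow> 'a::comm_ring_1" and H :: "'j \<Rightarrow> 'j \<Rightarrow> 'a"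
  assumes "finite I" "finite J"
  shows "kpow (I <+> J) (ksum F H) k = ksum (kpow I F k) (kpow J H k)"
proof (induction k)
  case 0
  have "(kone p q :: 'a) = ksum kone kone p q" for p q :: "'i + 'j"
    by (cases p; cases q) (simp_all add: kone_def)
  then show ?case by (auto simp: fun_eq_iff)
qed (simp add: kmul_ksum[OF assms])

lemma ktr_ksum: "finite I \<Longrightarrow> finite J \<Longrightarrow> ktr (I <+> J) (ksum F H) = ktr I F + ktr J H"
  by (simp add: ktr_def sum.Plus)

lemma kcomm_ksum:
  assumes "finite I" "finite J"
  shows "kcomm (I <+> J) (ksum F H) (ksum F' H') p q = ksum (kcomm I F F') (kcomm J H H') p q"
  unfolding kcomm_def kmul_ksum[OF assms] by (cases p; cases q) (simp_all add: kcomm_def)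

definition split_index :: "nat \<Rightarrow> nat \<Rightarrow> nat + nat" where
  "split_index r i = (if i < r then Inl i else Inr (i - r))"

lemma bij_betw_split_index: "bij_betw (split_index r) {..<r + s} ({..<r} <+> {..<s})"
  by (rule bij_betw_byWitness[of _ "case_sum (\<lambda>i. i) (\<lambda>i. r + i)"]) (auto simp: split_index_def)

lemma conn_kernel_sum_bundle:
  assumes "regular E a x" "regular F a x" "i < rank E + rank F" "j < rank E + rank F"
  shows "conn_kernel (sum_bundle E F) a k y i j =
    ksum (conn_kernel E a k y) (conn_kernel F a k y) (split_index (rank E) i) (split_index (rank E) j)"
proof -
  have "conn E a k y \<in> carrier_mat (rank E) (rank E)" "conn F a k y \<in> carrier_mat (rank F) (rank F)"
    using assms by (auto simp: regular_def)
  then show ?thesis using assms(3,4)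
    by (auto simp: conn_kernel_def sum_bundle_def block_diag_def split_index_def)
qed

lemma regular_sum_bundle:
  assumes E: "regular E a x" and F: "regular F a x"
  shows "regular (sum_bundle E F) a x"
proof -
  have "conn (sum_bundle E F) a k y \<in> carrier_mat (rank E + rank F) (rank E + rank F)" for k y
    using assms by (auto simp: regular_def sum_bundle_def block_diag_def)
  moreover have "(\<lambda>y. conn_kernel (sum_bundle E F) a k y i j) differentiable (at x)"
    if "i < rank E + rank F" "j < rank E + rank F" for k i j
    unfolding conn_kernel_sum_bundle[OF assms that] split_index_def
    using that by (auto intro!: regular_differentiable assms)
  ultimately show ?thesis
    by (simp add: regular_def conn_kernel_def) (simp add: sum_bundle_def)
qed

lemma chern_form_sum_bundle:
  assumes E: "regular E a x" and F: "regular F a x" and ij: "i < rank E + rank F" "j < rank E + rank F"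
  shows "chern_form (sum_bundle E F) a x i j =
    ksum (chern_form E a x) (chern_form F a x) (split_index (rank E) i) (split_index (rank E) j)"
proof -
  let ?f = "split_index (rank E)"
  have r: "rank (sum_bundle E F) = rank E + rank F" by (simp add: sum_bundle_def)
  have "curvature_coeff (sum_bundle E F) a x k l i j =
      ksum (curvature_coeff E a x k l) (curvature_coeff F a x k l) (?f i) (?f j)" for k l
  proof -
    have "kcomm {..<rank E + rank F} (conn_kernel (sum_bundle E F) a k x) (conn_kernel (sum_bundle E F) a l x) i j =
        kcomm {..<rank E + rank F} (\<lambda>i j. ksum (conn_kernel E a k x) (conn_kernel F a k x) (?f i) (?f j))
          (\<lambda>i j. ksum (conn_kernel E a l x) (conn_kernel F a l x) (?f i) (?f j)) i j"
      using ij by (intro kcomm_cong) (auto simp: conn_kernel_sum_bundle[OF E F])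
    also have "\<dots> = ksum (kcomm {..<rank E} (conn_kernel E a k x) (conn_kernel E a l x))
        (kcomm {..<rank F} (conn_kernel F a k x) (conn_kernel F a l x)) (?f i) (?f j)"
      by (subst kcomm_bij_betw[OF bij_betw_split_index, symmetric]) (simp add: kcomm_ksum)
    finally show ?thesis
      unfolding curvature_coeff_regular[OF regular_sum_bundle[OF E F] ij[folded r]]
        conn_kernel_sum_bundle[OF E F ij] r
      using ij by (auto simp: split_index_def curvature_coeff_regular E F)
  qed
  then show ?thesis by (simp add: chern_form_def split_index_def)
qed

lemma ch_bundle_sum_bundle:
  assumes "regular E a x" "regular F a x"
  shows "ch_bundle (sum_bundle E F) a x = ch_bundle E a x + ch_bundle F a x"
proof -
  have r: "rank (sum_bundle E F) = rank E + rank F" by (simp add: sum_bundle_def)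
  have "ch_bundle (sum_bundle E F) a x = ktr ({..<rank E} <+> {..<rank F})
      (kexp 1 ({..<rank E} <+> {..<rank F}) (ksum (chern_form E a x) (chern_form F a x)))"
    by (rule ch_bundle_bij_betw[where f = "split_index (rank E)"])
       (simp_all add: r bij_betw_split_index chern_form_sum_bundle assms)
  also have "\<dots> = ch_bundle E a x + ch_bundle F a x"
    by (simp add: ktr_kexp kpow_ksum ktr_ksum ch_bundle_eq_ktr distrib_left sum.distrib)
  finally show ?thesis .
qed

definition pair_index :: "nat \<Rightarrow> nat \<Rightarrow> nat \<times> nat" where
  "pair_index s i = (i div s, i mod s)"

lemma pair_index_less: "i < r * s \<Longrightarrow> i div s < r \<and> i mod s < (s::nat)"
  by (cases "s = 0") (auto simp: less_mult_imp_div_less)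

lemma bij_betw_pair_index: "bij_betw (pair_index s) {..<r * s} ({..<r} \<times> {..<s})"
proof (rule bij_betw_byWitness[of _ "\<lambda>(i, j). i * s + j"])
  have "i * s + j < r * s" if "i < r" "j < s" for i j
  proof -
    have "i * s + j < Suc i * s" using that by simp
    also have "\<dots> \<le> r * s" using that by (intro mult_right_mono) auto
    finally show ?thesis .
  qed
  then show "(\<lambda>(i, j). i * s + j) ` ({..<r} \<times> {..<s}) \<subseteq> {..<r * s}" by auto
qed (auto simp: pair_index_def pair_index_less)

lemma conn_kernel_tensor_bundle:
  assumes "regular E a x" "regular F a x" "i < rank E * rank F" "j < rank E * rank F"
  shows "conn_kernel (tensor_bundle E F) a k y i j =
    ktensor (conn_kernel E a k y) (conn_kernel F a k y) (pair_index (rank F) i) (pair_index (rank F) j)"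
proof -
  have "conn E a k y \<in> carrier_mat (rank E) (rank E)" "conn F a k y \<in> carrier_mat (rank F) (rank F)"
    using assms by (auto simp: regular_def)
  then show ?thesis using assms(3,4) pair_index_less[OF assms(3)] pair_index_less[OF assms(4)]
    by (simp add: conn_kernel_def tensor_bundle_def kron_def pair_index_def ktensor_Pair kone_def)
qed

lemma regular_tensor_bundle:
  assumes E: "regular E a x" and F: "regular F a x"
  shows "regular (tensor_bundle E F) a x"
proof -
  have "conn (tensor_bundle E F) a k y \<in> carrier_mat (rank E * rank F) (rank E * rank F)" for k y
  proof -
    have "conn E a k y \<in> carrier_mat (rank E) (rank E)" "conn F a k y \<in> carrier_mat (rank F) (rank F)"
      using assms by (auto simp: regular_def)
    then show ?thesis by (auto simp: tensor_bundle_def kron_def)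
  qed
  moreover have "(\<lambda>y. conn_kernel (tensor_bundle E F) a k y i j) differentiable (at x)"
    if "i < rank E * rank F" "j < rank E * rank F" for k i j
    unfolding conn_kernel_tensor_bundle[OF assms that] pair_index_def ktensor_Pair
    using pair_index_less[OF that(1)] pair_index_less[OF that(2)]
    by (intro differentiable_add differentiable_mult differentiable_const regular_differentiable assms) auto
  ultimately show ?thesis
    by (simp add: regular_def conn_kernel_def) (simp add: tensor_bundle_def)
qed

lemma const_form_kone: "const_form (kone i j) = kone i j"
  by (simp add: kone_def)

lemma chern_form_tensor_bundle:
  assumes E: "regular E a x" and F: "regular F a x" and ij: "i < rank E * rank F" "j < rank E * rank F"
  shows "chern_form (tensor_bundle E F) a x i j =
    ktensor (chern_form E a x) (chern_form F a x) (pair_index (rank F) i) (pair_index (rank F) j)"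
proof -
  let ?f = "pair_index (rank F)"
  have r: "rank (tensor_bundle E F) = rank E * rank F" by (simp add: tensor_bundle_def)
  note less = pair_index_less[OF ij(1)] pair_index_less[OF ij(2)]
  have "curvature_coeff (tensor_bundle E F) a x k l i j =
      ktensor (curvature_coeff E a x k l) (curvature_coeff F a x k l) (?f i) (?f j)" for k l
  proof -
    have "kcomm {..<rank E * rank F} (conn_kernel (tensor_bundle E F) a k x) (conn_kernel (tensor_bundle E F) a l x) i j =
        kcomm {..<rank E * rank F} (\<lambda>i j. ktensor (conn_kernel E a k x) (conn_kernel F a k x) (?f i) (?f j))
          (\<lambda>i j. ktensor (conn_kernel E a l x) (conn_kernel F a l x) (?f i) (?f j)) i j"
      using ij by (intro kcomm_cong) (auto simp: conn_kernel_tensor_bundle[OF E F])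
    also have "\<dots> = ktensor (kcomm {..<rank E} (conn_kernel E a k x) (conn_kernel E a l x))
        (kcomm {..<rank F} (conn_kernel F a k x) (conn_kernel F a l x)) (?f i) (?f j)"
      using less by (subst kcomm_bij_betw[OF bij_betw_pair_index, symmetric]) (simp add: kcomm_ktensor pair_index_def)
    finally have comm: "kcomm {..<rank E * rank F} (conn_kernel (tensor_bundle E F) a k x) (conn_kernel (tensor_bundle E F) a l x) i j =
      ktensor (kcomm {..<rank E} (conn_kernel E a k x) (conn_kernel E a l x))
        (kcomm {..<rank F} (conn_kernel F a k x) (conn_kernel F a l x)) (?f i) (?f j)" .
    have deriv: "pderiv_at k (\<lambda>y. ktensor (conn_kernel E a l y) (conn_kernel F a l y) (?f i) (?f j)) x =
        ktensor (\<lambda>i j. pderiv_at k (\<lambda>y. conn_kernel E a l y i j) x) (\<lambda>i j. pderiv_at k (\<lambda>y. conn_kernel F a l y i j) x) (?f i) (?f j)" for k l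
      unfolding pair_index_def ktensor_Pair mult.commute[of _ "kone _ _"]
      using less by (simp add: pderiv_at_add pderiv_at_cmult differentiable_cmult regular_differentiable assms)
    show ?thesis
      unfolding curvature_coeff_regular[OF regular_tensor_bundle[OF E F] ij[folded r]]
        conn_kernel_tensor_bundle[OF E F ij] r comm deriv
      unfolding pair_index_def ktensor_Pair using less
      by (simp add: curvature_coeff_regular E F algebra_simps)
  qed
  then show ?thesis
    unfolding chern_form_def pair_index_def ktensor_Pair mult.commute[of _ "kone _ _"]
    by (simp only: form2_add form2_cmult const_form_kone distrib_left mult.left_commute)
qed

lemma ch_bundle_tensor_bundle:
  assumes "regular E a x" "regular F a x"
  shows "ch_bundle (tensor_bundle E F) a x = ch_bundle E a x * ch_bundle F a x"
proof -
  have r: "rank (tensor_bundle E F) = rank E * rank F" by (simp add: tensor_bundle_def)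
  have "ch_bundle (tensor_bundle E F) a x = ktr ({..<rank E} \<times> {..<rank F})
      (kexp 1 ({..<rank E} \<times> {..<rank F}) (ktensor (chern_form E a x) (chern_form F a x)))"
    by (rule ch_bundle_bij_betw[where f = "pair_index (rank F)"])
       (simp_all add: r bij_betw_pair_index chern_form_tensor_bundle assms)
  also have "\<dots> = ch_bundle E a x * ch_bundle F a x"
    unfolding ch_bundle_eq_ktr ktr_def sum_product sum.cartesian_product
    by (intro sum.cong refl) (auto simp: kexp_ktensor of_degree_ge_chern_form)
  finally show ?thesis .
qed


section \<open>Chern characters of exterior and symmetric powers\<close>

text \<open>
  The common shape of the passage to exterior and to symmetric powers: a combination, with constant
  coefficients, of rearrangements of the row index.  Constant coefficients commute with
  derivatives, which is all that the computation of the curvature needs besides the product rule.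
\<close>

definition reorder :: "('i list \<Rightarrow> 'q set) \<Rightarrow> ('q \<Rightarrow> int) \<Rightarrow> ('q \<Rightarrow> 'i list \<Rightarrow> 'i list) \<Rightarrow>
    ('i list \<Rightarrow> 'i list \<Rightarrow> 'a::comm_ring_1) \<Rightarrow> 'i list \<Rightarrow> 'i list \<Rightarrow> 'a" where
  "reorder Q w act F J K = (\<Sum>q\<in>Q J. of_int (w q) * F (act q J) K)"

lemma alt_eq_reorder: "alt_kernel d = reorder (\<lambda>_. {\<sigma>. \<sigma> permutes {..<d}}) sign permute_list"
  by (simp add: alt_kernel_def reorder_def fun_eq_iff)

lemma sym_kernel_eq_reorder: "sym_kernel = reorder (\<lambda>J. {L. mset L = mset J}) (\<lambda>_. 1) (\<lambda>L J. L)"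
  by (simp add: sym_kernel_def reorder_def fun_eq_iff)

definition leibniz_coeff :: "nat \<Rightarrow> nat \<Rightarrow> 'i list \<Rightarrow> 'i list \<Rightarrow> 'a::comm_ring_1" where
  "leibniz_coeff d s L K = (\<Prod>t\<in>{..<d} - {s}. kone (L ! t) (K ! t))"

text \<open>
  This form displays the linearity in \<open>A\<close>.
\<close>

lemma leibniz_eq_sum: "leibniz d A L K = (\<Sum>s<d. leibniz_coeff d s L K * A (L ! s) (K ! s))"
  unfolding leibniz_def leibniz_coeff_def by (intro sum.cong refl) (simp add: prod.remove mult.commute)

lemma const_form_leibniz_coeff: "const_form (leibniz_coeff d s L K) = leibniz_coeff d s L K"
  by (simp add: leibniz_coeff_def const_form_prod const_form_kone)

lemma differentiable_sum_family:
  fixes f :: "'q \<Rightarrow> real ^ 'n \<Rightarrow> complex"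
  shows "(\<And>i. i \<in> S \<Longrightarrow> f i differentiable (at x)) \<Longrightarrow> (\<lambda>y. \<Sum>i\<in>S. f i y) differentiable (at x)"
proof (induction S rule: infinite_finite_induct)
qed (auto intro: differentiable_add)

text \<open>
  The derivative terms of the curvature are carried along by linearity, and the commutator because both
  \<open>leibniz\<close> and the passage to the power respect it.  The hypotheses on \<open>reorder\<close> are what distinguishes
  the two kinds of powers.
\<close>

lemma chern_form_power_bundle:
  fixes E :: "('i, 'm, 'n::{finite,linorder}) vbundle"
    and basis :: "nat \<Rightarrow> nat \<Rightarrow> nat list list" and d :: nat
  defines "r \<equiv> rank E" and "B \<equiv> basis d (rank E)"
  assumes reg: "regular E a x"
    and B: "distinct B" "set B \<subseteq> ilists d {..<r}"
    and act: "\<And>J q. J \<in> set B \<Longrightarrow> q \<in> Q J \<Longrightarrow> act q J \<in> ilists d {..<r}"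
    and coe: "\<And>A J K. A \<in> carrier_mat r r \<Longrightarrow> J \<in> set B \<Longrightarrow> K \<in> set B \<Longrightarrow>
      (\<Sum>s<d. coe d (\<lambda>t. if t = s then A else 1\<^sub>m r) J K) = reorder Q w act (leibniz d (\<lambda>i j. A $$ (i, j))) J K"
    and mult: "\<And>(F :: nat list \<Rightarrow> nat list \<Rightarrow> complex) H J K. equivariant d F \<Longrightarrow> J \<in> set B \<Longrightarrow>
      kmul (set B) (reorder Q w act F) (reorder Q w act H) J K = reorder Q w act (kmul (ilists d {..<r}) F H) J K"
  shows "regular (power_bundle coe basis d E) a x"
    and "i < length B \<Longrightarrow> j < length B \<Longrightarrow> chern_form (power_bundle coe basis d E) a x i j
      = reorder Q w act (leibniz d (chern_form E a x)) (B ! i) (B ! j)"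
proof -
  let ?P = "power_bundle coe basis d E"
  let ?A = "conn_kernel E a"
  have rank: "rank ?P = length B" by (simp add: power_bundle_def B_def Let_def)
  have conn: "conn_kernel ?P a k y i j = reorder Q w act (leibniz d (?A k y)) (B ! i) (B ! j)"
    if "i < length B" "j < length B" for k y i j
    using that reg coe[of "conn E a k y" "B ! i" "B ! j", unfolded r_def]
    by (simp add: conn_kernel_def[abs_def] power_bundle_def B_def Let_def regular_def)
  have act': "act q (B ! i) ! s < r" if "i < length B" "q \<in> Q (B ! i)" "s < d" for i q s
    using that act[of "B ! i" q] B(2) ilists_nth[of _ d "{..<r}" s] by auto
  have B_less: "B ! i ! s < r" if "i < length B" "s < d" for i s
    using ilists_nth[OF subsetD[OF B(2) nth_mem[OF that(1)]] that(2)] by simp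
  show reg': "regular ?P a x"
  proof -
    have "conn ?P a k y \<in> carrier_mat (length B) (length B)" for k y
      by (simp add: power_bundle_def B_def Let_def)
    moreover have "(\<lambda>y. conn_kernel ?P a k y i j) differentiable (at x)" if "i < length B" "j < length B" for k i j
      unfolding conn[OF that] reorder_def leibniz_eq_sum
      using that by (intro differentiable_sum_family differentiable_cmult regular_differentiable[OF reg])
        (auto simp: act' B_less simp flip: r_def)
    ultimately show ?thesis
      by (simp add: regular_def conn_kernel_def rank)
  qed
  assume ij: "i < length B" "j < length B"
  have deriv: "pderiv_at k (\<lambda>y. conn_kernel ?P a l y i j) x =
      reorder Q w act (leibniz d (\<lambda>i j. pderiv_at k (\<lambda>y. ?A l y i j) x)) (B ! i) (B ! j)" for k l
  proof -
    have diff: "(\<lambda>y. ?A l y (act q (B ! i) ! s) (B ! j ! s)) differentiable (at x)" if "q \<in> Q (B ! i)" "s < d" for q s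
      using that ij by (intro regular_differentiable[OF reg]) (auto simp: act' B_less simp flip: r_def)
    have "pderiv_at k (\<lambda>y. conn_kernel ?P a l y i j) x = (\<Sum>q\<in>Q (B ! i). pderiv_at k (\<lambda>y. of_int (w q) *
        (\<Sum>s<d. leibniz_coeff d s (act q (B ! i)) (B ! j) * ?A l y (act q (B ! i) ! s) (B ! j ! s))) x)"
      unfolding conn[OF ij] reorder_def leibniz_eq_sum
      by (intro pderiv_at_sum differentiable_sum_family differentiable_cmult diff) auto
    also have "\<dots> = (\<Sum>q\<in>Q (B ! i). of_int (w q) * (\<Sum>s<d. leibniz_coeff d s (act q (B ! i)) (B ! j) *
        pderiv_at k (\<lambda>y. ?A l y (act q (B ! i) ! s) (B ! j ! s)) x))"
    proof (intro sum.cong refl)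
      fix q assume q: "q \<in> Q (B ! i)"
      let ?c = "\<lambda>s. leibniz_coeff d s (act q (B ! i)) (B ! j)"
      let ?g = "\<lambda>s y. ?A l y (act q (B ! i) ! s) (B ! j ! s)"
      have 1: "(\<lambda>y. ?c s * ?g s y) differentiable (at x)" if "s \<in> {..<d}" for s
        using that by (intro differentiable_cmult diff[OF q]) simp
      have "pderiv_at k (\<lambda>y. of_int (w q) * (\<Sum>s<d. ?c s * ?g s y)) x
          = of_int (w q) * pderiv_at k (\<lambda>y. \<Sum>s<d. ?c s * ?g s y) x"
        by (intro pderiv_at_cmult differentiable_sum_family 1)
      also have "pderiv_at k (\<lambda>y. \<Sum>s<d. ?c s * ?g s y) x = (\<Sum>s<d. pderiv_at k (\<lambda>y. ?c s * ?g s y) x)"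
        by (intro pderiv_at_sum 1)
      also have "\<dots> = (\<Sum>s<d. ?c s * pderiv_at k (?g s) x)"
        using diff[OF q] by (intro sum.cong refl pderiv_at_cmult) simp
      finally show "pderiv_at k (\<lambda>y. of_int (w q) * (\<Sum>s<d. ?c s * ?g s y)) x
          = of_int (w q) * (\<Sum>s<d. ?c s * pderiv_at k (?g s) x)" .
    qed
    finally show ?thesis by (simp add: reorder_def leibniz_eq_sum)
  qed
  have comm: "kcomm {..<length B} (conn_kernel ?P a k x) (conn_kernel ?P a l x) i j =
      reorder Q w act (leibniz d (kcomm {..<r} (?A k x) (?A l x))) (B ! i) (B ! j)" for k l
  proof -
    let ?F = "\<lambda>k. leibniz d (?A k x)"
    have bij: "bij_betw ((!) B) {..<length B} (set B)"
      using B(1) by (simp add: bij_betw_nth)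
    have Bi: "B ! i \<in> set B" and Bj: "B ! j \<in> ilists d {..<r}" using ij B(2) by auto
    have "kcomm {..<length B} (conn_kernel ?P a k x) (conn_kernel ?P a l x) i j =
        kcomm {..<length B} (\<lambda>i j. reorder Q w act (?F k) (B ! i) (B ! j)) (\<lambda>i j. reorder Q w act (?F l) (B ! i) (B ! j)) i j"
      using ij by (intro kcomm_cong) (auto simp: conn)
    also have "\<dots> = kcomm (set B) (reorder Q w act (?F k)) (reorder Q w act (?F l)) (B ! i) (B ! j)"
      by (rule kcomm_bij_betw[OF bij, symmetric])
    also have "\<dots> = reorder Q w act (kcomm (ilists d {..<r}) (?F k) (?F l)) (B ! i) (B ! j)"
      unfolding kcomm_def mult[OF equivariant_leibniz Bi] reorder_def
      by (simp add: right_diff_distrib sum_subtractf)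
    also have "\<dots> = reorder Q w act (leibniz d (kcomm {..<r} (?A k x) (?A l x))) (B ! i) (B ! j)"
      unfolding reorder_def using act[OF Bi] Bj by (intro sum.cong refl) (simp add: kcomm_leibniz)
    finally show ?thesis .
  qed
  have "curvature_coeff ?P a x k l i j =
      (\<Sum>q\<in>Q (B ! i). of_int (w q) * (\<Sum>s<d. leibniz_coeff d s (act q (B ! i)) (B ! j) *
        curvature_coeff E a x k l (act q (B ! i) ! s) (B ! j ! s)))" for k l
  proof -
    have "curvature_coeff ?P a x k l i j = (\<Sum>q\<in>Q (B ! i). of_int (w q) * (\<Sum>s<d. leibniz_coeff d s (act q (B ! i)) (B ! j) *
        (pderiv_at k (\<lambda>y. ?A l y (act q (B ! i) ! s) (B ! j ! s)) x - pderiv_at l (\<lambda>y. ?A k y (act q (B ! i) ! s) (B ! j ! s)) x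
         + kcomm {..<r} (?A k x) (?A l x) (act q (B ! i) ! s) (B ! j ! s))))"
      unfolding curvature_coeff_regular[OF reg' ij[folded rank]] rank deriv comm reorder_def leibniz_eq_sum
      by (simp add: distrib_left right_diff_distrib sum.distrib sum_subtractf)
    then show ?thesis
      using ij by (simp add: curvature_coeff_regular[OF reg] act' B_less r_def[symmetric])
  qed
  then show "chern_form ?P a x i j = reorder Q w act (leibniz d (chern_form E a x)) (B ! i) (B ! j)"
    unfolding chern_form_def reorder_def leibniz_eq_sum
    by (simp add: form2_sum form2_cmult const_form_leibniz_coeff const_form_of_int sum_distrib_left mult_ac)
qed

lemma set_ext_basis: "set (ext_basis d r) = inc_lists d {..<r}"
  by (auto simp: ext_basis_def set_n_lists inc_lists_def ilists_def)

lemma set_sym_basis: "set (sym_basis d r) = sorted_lists d {..<r}"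
  by (auto simp: sym_basis_def set_n_lists sorted_lists_def ilists_def)

lemma distinct_basis: "distinct (ext_basis d r)" "distinct (sym_basis d r)"
  by (simp_all add: ext_basis_def sym_basis_def distinct_n_lists)

lemma sum_ext_coeff:
  fixes A :: "'a::comm_ring_1 mat"
  assumes "J \<in> ilists d {..<r}" "K \<in> ilists d {..<r}"
  shows "(\<Sum>s<d. ext_coeff d (\<lambda>t. if t = s then A else 1\<^sub>m r) J K) = alt_kernel d (leibniz d (\<lambda>i j. A $$ (i, j))) J K"
proof -
  have "(\<Sum>s<d. ext_coeff d (\<lambda>t. if t = s then A else 1\<^sub>m r) J K) = (\<Sum>s<d. \<Sum>\<sigma> | \<sigma> permutes {..<d}.
      of_int (sign \<sigma>) * (\<Prod>t<d. (if t = s then (\<lambda>i j. A $$ (i, j)) else kone) (permute_list \<sigma> J ! t) (K ! t)))"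
  proof (intro sum.cong refl)
    fix s
    have "ext_coeff d (\<lambda>t. if t = s then A else 1\<^sub>m r) J K = (\<Sum>\<sigma> | \<sigma> permutes {..<d}. of_int (sign \<sigma>) *
        (\<Prod>t<d. Matrix.mat d d (\<lambda>(u, t). (if t = s then A else 1\<^sub>m r) $$ (J ! u, K ! t)) $$ (\<sigma> t, t)))"
      unfolding ext_coeff_def by (subst det_col[of _ d]) (simp_all add: atLeast0LessThan)
    also have "\<dots> = (\<Sum>\<sigma> | \<sigma> permutes {..<d}. of_int (sign \<sigma>) *
        (\<Prod>t<d. (if t = s then (\<lambda>i j. A $$ (i, j)) else kone) (permute_list \<sigma> J ! t) (K ! t)))"
    proof (intro sum.cong refl arg_cong2[where f = "(*)"] prod.cong)
      fix \<sigma> t assume "\<sigma> \<in> {\<sigma>. \<sigma> permutes {..<d}}" and t: "t \<in> {..<d}"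
      then have \<sigma>: "\<sigma> permutes {..<d}" and "\<sigma> t < d" using permutes_in_image by fastforce+
      then show "Matrix.mat d d (\<lambda>(u, t). (if t = s then A else 1\<^sub>m r) $$ (J ! u, K ! t)) $$ (\<sigma> t, t) =
          (if t = s then (\<lambda>i j. A $$ (i, j)) else kone) (permute_list \<sigma> J ! t) (K ! t)"
        using t assms ilists_nth[OF assms(1)] ilists_nth[OF assms(2)]
        by (auto simp: permute_list_nth kone_def ilists_def)
    qed
    finally show "ext_coeff d (\<lambda>t. if t = s then A else 1\<^sub>m r) J K = (\<Sum>\<sigma> | \<sigma> permutes {..<d}. of_int (sign \<sigma>) *
        (\<Prod>t<d. (if t = s then (\<lambda>i j. A $$ (i, j)) else kone) (permute_list \<sigma> J ! t) (K ! t)))" .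
  qed
  then show ?thesis
    unfolding alt_kernel_def leibniz_def sum_distrib_left by (subst (asm) sum.swap) simp
qed

lemma sum_sym_coeff:
  fixes A :: "'a::comm_ring_1 mat"
  assumes "J \<in> ilists d {..<r}" "K \<in> ilists d {..<r}"
  shows "(\<Sum>s<d. sym_coeff d (\<lambda>t. if t = s then A else 1\<^sub>m r) J K) = sym_kernel (leibniz d (\<lambda>i j. A $$ (i, j))) J K"
proof -
  have "(\<Sum>s<d. sym_coeff d (\<lambda>t. if t = s then A else 1\<^sub>m r) J K) = (\<Sum>s<d. \<Sum>L | mset L = mset J.
      \<Prod>t<d. (if t = s then (\<lambda>i j. A $$ (i, j)) else kone) (L ! t) (K ! t))"
    unfolding sym_coeff_def
  proof (intro sum.cong refl prod.cong)
    fix L t s assume "L \<in> {L. mset L = mset J}" "t \<in> {..<d}"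
    then have "L ! t < r" "K ! t < r"
      using ilists_nth[OF mset_eq_ilists[OF _ assms(1)], of L t] ilists_nth[OF assms(2), of t] by auto
    then show "(if t = s then A else 1\<^sub>m r) $$ (L ! t, K ! t) = (if t = s then (\<lambda>i j. A $$ (i, j)) else kone) (L ! t) (K ! t)"
      by (simp add: kone_def)
  qed
  then show ?thesis
    unfolding sym_kernel_def leibniz_def by (subst (asm) sum.swap) simp
qed

lemma
  fixes E :: "('i, 'm, 'n::{finite,linorder}) vbundle"
  assumes "regular E a x"
  shows regular_ext_bundle: "regular (ext_bundle d E) a x"
    and chern_form_ext_bundle: "i < length (ext_basis d (rank E)) \<Longrightarrow> j < length (ext_basis d (rank E)) \<Longrightarrow>
      chern_form (ext_bundle d E) a x i j =
        alt_kernel d (leibniz d (chern_form E a x)) (ext_basis d (rank E) ! i) (ext_basis d (rank E) ! j)"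
proof -
  note * = chern_form_power_bundle[where basis = ext_basis and coe = ext_coeff and d = d,
      OF assms, unfolded set_ext_basis, folded ext_bundle_def,
      where Q = "\<lambda>_. {\<sigma>. \<sigma> permutes {..<d}}" and w = sign and act = permute_list, folded alt_eq_reorder]
  have sub: "inc_lists d {..<rank E} \<subseteq> ilists d {..<rank E}" by (rule inc_lists_subset)
  show "regular (ext_bundle d E) a x"
    by (rule *(1)) (use sub in \<open>auto simp: distinct_basis kmul_alt permute_list_in_ilists intro!: sum_ext_coeff\<close>)
  show "chern_form (ext_bundle d E) a x i j =
        alt_kernel d (leibniz d (chern_form E a x)) (ext_basis d (rank E) ! i) (ext_basis d (rank E) ! j)"
    if "i < length (ext_basis d (rank E))" "j < length (ext_basis d (rank E))"
    by (rule *(2)) (use sub that in \<open>auto simp: distinct_basis kmul_alt permute_list_in_ilists intro!: sum_ext_coeff\<close>)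
qed

lemma
  fixes E :: "('i, 'm, 'n::{finite,linorder}) vbundle"
  assumes "regular E a x"
  shows regular_sym_bundle: "regular (sym_bundle d E) a x"
    and chern_form_sym_bundle: "i < length (sym_basis d (rank E)) \<Longrightarrow> j < length (sym_basis d (rank E)) \<Longrightarrow>
      chern_form (sym_bundle d E) a x i j =
        sym_kernel (leibniz d (chern_form E a x)) (sym_basis d (rank E) ! i) (sym_basis d (rank E) ! j)"
proof -
  note * = chern_form_power_bundle[where basis = sym_basis and coe = sym_coeff and d = d,
      OF assms, unfolded set_sym_basis, folded sym_bundle_def,
      where Q = "\<lambda>J. {L. mset L = mset J}" and w = "\<lambda>_. 1" and act = "\<lambda>L J. L", folded sym_kernel_eq_reorder]
  have sub: "sorted_lists d {..<rank E} \<subseteq> ilists d {..<rank E}" by (auto simp: sorted_lists_def)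
  show "regular (sym_bundle d E) a x"
    by (rule *(1)) (use sub in \<open>auto simp: distinct_basis kmul_sym_kernel intro: mset_eq_ilists intro!: sum_sym_coeff\<close>)
  show "chern_form (sym_bundle d E) a x i j =
        sym_kernel (leibniz d (chern_form E a x)) (sym_basis d (rank E) ! i) (sym_basis d (rank E) ! j)"
    if "i < length (sym_basis d (rank E))" "j < length (sym_basis d (rank E))"
    by (rule *(2)) (use sub that in \<open>auto simp: distinct_basis kmul_sym_kernel intro: mset_eq_ilists intro!: sum_sym_coeff\<close>)
qed

lemma kexp_leibniz_permute:
  assumes "\<And>i j. i \<in> I \<Longrightarrow> j \<in> I \<Longrightarrow> of_degree_ge 2 (F i j)" "finite I" "L \<in> ilists d I" "\<sigma> permutes {..<d}"
  shows "kexp z (ilists d I) (leibniz d F) (permute_list \<sigma> L) L = (\<Prod>t<d. kexp z I F (L ! \<sigma> t) (L ! t))"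
proof -
  have "length L = d" using assms by (simp add: ilists_def)
  then show ?thesis
    using kexp_leibniz[OF assms(1,2) permute_list_in_ilists[OF assms(4,3)] assms(3)] assms(4)
    by (simp add: permute_list_nth cong: prod.cong_simp)
qed

text \<open>
  Take the trace of each power of the curvature over the full tensor power, with a permutation inserted.
  On the tensor power the exponential of \<open>leibniz\<close> splits into a product over the factors, which is
  the summand of \<open>cycle_sum\<close>.
\<close>

lemma ch_bundle_power_kernel:
  fixes x :: "real ^ ('n::{finite,linorder})" and E D :: "('i, 'm, 'n) vbundle" and a :: 'i and d :: nat
  defines "F \<equiv> leibniz d (chern_form E a x)"
  assumes B: "distinct B" "rank D = length B"
    and chern: "\<And>i j. i < length B \<Longrightarrow> j < length B \<Longrightarrow> chern_form D a x i j = proj F (B ! i) (B ! j)"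
    and kpow: "\<And>J K k. J \<in> set B \<Longrightarrow> K \<in> set B \<Longrightarrow>
      kpow (set B) (proj F) k J K = proj (kpow (ilists d {..<rank E}) F k) J K"
    and trace: "\<And>H. equivariant d H \<Longrightarrow> of_nat (fact d) * ktr (set B) (proj H) =
      (\<Sum>L\<in>ilists d {..<rank E}. \<Sum>\<sigma> | \<sigma> permutes {..<d}. perm_weight e \<sigma> * H (permute_list \<sigma> L) L)"
  shows "of_nat (fact d) * ch_bundle D a x = cycle_sum e d {..<rank E} (kexp 1 {..<rank E} (chern_form E a x))"
proof -
  let ?I = "{..<rank E}" and ?Y = "chern_form E a x"
  have "ch_bundle D a x = ktr (set B) (kexp 1 (set B) (proj F))"
    by (rule ch_bundle_bij_betw[where f = "(!) B"]) (auto simp: B chern bij_betw_nth)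
  also have "\<dots> = (\<Sum>k\<le>CARD('n). const_form (1 / fact k) * ktr (set B) (proj (kpow (ilists d ?I) F k)))"
    unfolding ktr_kexp power_one unfolding ktr_def by (intro sum.cong refl arg_cong2[where f = "(*)"] kpow)
  finally have "of_nat (fact d) * ch_bundle D a x =
      (\<Sum>k\<le>CARD('n). const_form (1 / fact k) * (of_nat (fact d) * ktr (set B) (proj (kpow (ilists d ?I) F k))))"
    by (simp only: sum_distrib_left mult.left_commute)
  also have "\<dots> = (\<Sum>k\<le>CARD('n). \<Sum>L\<in>ilists d ?I. \<Sum>\<sigma> | \<sigma> permutes {..<d}.
      perm_weight e \<sigma> * (const_form (1 ^ k / fact k) * kpow (ilists d ?I) F k (permute_list \<sigma> L) L))"
    by (simp add: trace equivariant_kpow equivariant_leibniz F_def sum_distrib_left mult.left_commute)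
  also have "\<dots> = (\<Sum>L\<in>ilists d ?I. \<Sum>k\<le>CARD('n). \<Sum>\<sigma> | \<sigma> permutes {..<d}.
      perm_weight e \<sigma> * (const_form (1 ^ k / fact k) * kpow (ilists d ?I) F k (permute_list \<sigma> L) L))"
    by (rule sum.swap)
  also have "\<dots> = (\<Sum>L\<in>ilists d ?I. \<Sum>\<sigma> | \<sigma> permutes {..<d}. perm_weight e \<sigma> *
      kexp 1 (ilists d ?I) F (permute_list \<sigma> L) L)"
    unfolding kexp_def sum_distrib_left by (intro sum.cong refl sum.swap)
  also have "\<dots> = (\<Sum>L\<in>ilists d ?I. \<Sum>\<sigma> | \<sigma> permutes {..<d}. perm_weight e \<sigma> *
      (\<Prod>t<d. kexp 1 ?I ?Y (L ! \<sigma> t) (L ! t)))"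
    by (intro sum.cong refl arg_cong2[where f = "(*)"])
       (auto simp: F_def kexp_leibniz_permute of_degree_ge_chern_form)
  also have "\<dots> = cycle_sum e d ?I (kexp 1 ?I ?Y)"
    unfolding cycle_sum_def by (rule sum.swap)
  finally show ?thesis .
qed

lemma ch_bundle_ext_bundle:
  assumes "regular E a x"
  shows "of_nat (fact d) * ch_bundle (ext_bundle d E) a x =
    cycle_sum (- 1) d {..<rank E} (kexp 1 {..<rank E} (chern_form E a x))"
proof (rule ch_bundle_power_kernel[where B = "ext_basis d (rank E)" and proj = "alt_kernel d",
      OF distinct_basis(1) _ chern_form_ext_bundle[OF assms], unfolded set_ext_basis])
  show "rank (ext_bundle d E) = length (ext_basis d (rank E))"
    by (simp add: ext_bundle_def power_bundle_def Let_def)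
qed (auto simp: kpow_alt equivariant_leibniz ktr_alt alt_kernel_def sign_def perm_weight_def intro!: sum.cong)

lemma ch_bundle_sym_bundle:
  assumes "regular E a x"
  shows "of_nat (fact d) * ch_bundle (sym_bundle d E) a x =
    cycle_sum 1 d {..<rank E} (kexp 1 {..<rank E} (chern_form E a x))"
proof (rule ch_bundle_power_kernel[where B = "sym_basis d (rank E)" and proj = sym_kernel,
      OF distinct_basis(2) _ chern_form_sym_bundle[OF assms], unfolded set_sym_basis])
  show "rank (sym_bundle d E) = length (sym_basis d (rank E))"
    by (simp add: sym_bundle_def power_bundle_def Let_def)
qed (auto simp: kpow_sym_kernel equivariant_leibniz ktr_sym_kernel perm_weight_1)


section \<open>Chern characters of virtual bundles\<close>

fun regular_virt :: "'i \<Rightarrow> real ^ 'n \<Rightarrow> ('i, 'm, 'n::finite) virt \<Rightarrow> bool" where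
  "regular_virt a x (Diff E F) \<longleftrightarrow> regular E a x \<and> regular F a x"

lemma ch_bundle_triv:
  "ch_bundle (triv_bundle r :: ('i, 'm, 'n::{finite,linorder}) vbundle) a x = of_nat r"
proof -
  let ?E = "triv_bundle r :: ('i, 'm, 'n) vbundle"
  have r: "rank ?E = r" by (simp add: triv_bundle_def)
  have "kpow {..<r} (chern_form ?E a x) k i i = (if k = 0 then 1 else 0)" if "i < r" for k i
  proof (cases k)
    case (Suc m)
    then show ?thesis using that by (auto simp: kmul_def chern_form_triv_bundle intro!: sum.neutral)
  qed (simp add: kone_def)
  then have "ktr {..<r} (kpow {..<r} (chern_form ?E a x) k) = (if k = 0 then of_nat r else 0)" for k
    by (simp add: ktr_def)
  then have "ch_bundle ?E a x = (\<Sum>k\<le>CARD('n). if k = 0 then of_nat r else 0)"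
    unfolding ch_bundle_eq_ktr ktr_kexp r by (intro sum.cong refl) simp
  then show ?thesis by simp
qed

lemma
  assumes "regular_virt a x V" "regular_virt a x W"
  shows ch_add: "ch (V + W) a x = ch V a x + ch W a x" and regular_virt_add: "regular_virt a x (V + W)"
    and ch_mult: "ch (V * W) a x = ch V a x * ch W a x" and regular_virt_mult: "regular_virt a x (V * W)"
    and ch_uminus: "ch (- V) a x = - ch V a x" and regular_virt_uminus: "regular_virt a x (- V)"
  using assms by (cases V; cases W; simp add: ch_bundle_sum_bundle ch_bundle_tensor_bundle
      regular_sum_bundle regular_tensor_bundle algebra_simps)+

lemma ch_virt_of: "ch (virt_of E) a x = ch_bundle E a x"
  by (simp add: virt_of_def ch_bundle_triv)

lemma regular_virt_of: "regular E a x \<Longrightarrow> regular_virt a x (virt_of E)"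
  by (simp add: virt_of_def regular_triv_bundle)

lemma ch_0: "ch 0 a x = 0" and ch_1: "ch 1 a x = 1"
  by (simp_all add: zero_virt_def one_virt_def ch_virt_of ch_bundle_triv)

lemma regular_virt_0: "regular_virt a x 0" and regular_virt_1: "regular_virt a x 1"
  by (simp_all add: zero_virt_def one_virt_def regular_virt_of regular_triv_bundle)

lemma
  assumes "\<And>V. V \<in> set Vs \<Longrightarrow> regular_virt a x V"
  shows ch_virt_sum: "ch (virt_sum Vs) a x = (\<Sum>V\<leftarrow>Vs. ch V a x)"
    and regular_virt_sum: "regular_virt a x (virt_sum Vs)"
proof -
  have "ch (virt_sum Vs) a x = (\<Sum>V\<leftarrow>Vs. ch V a x) \<and> regular_virt a x (virt_sum Vs)"
    using assms
    by (induction Vs) (auto simp: virt_sum_def ch_0 regular_virt_0 ch_add regular_virt_add)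
  then show "ch (virt_sum Vs) a x = (\<Sum>V\<leftarrow>Vs. ch V a x)" "regular_virt a x (virt_sum Vs)" by auto
qed

text \<open>
  The Chern character of \<open>series_inverse\<close>.
\<close>

fun inverse_seq :: "(nat \<Rightarrow> 'a::comm_ring_1) \<Rightarrow> nat \<Rightarrow> 'a" where
  "inverse_seq f 0 = 1"
| "inverse_seq f (Suc n) = - (\<Sum>j\<leftarrow>[0..<Suc n]. f (Suc j) * inverse_seq f (n - j))"

lemma ch_series_inverse:
  assumes "\<And>j. regular_virt a x (V j)"
  shows "ch (series_inverse V n) a x = inverse_seq (\<lambda>j. ch (V j) a x) n \<and> regular_virt a x (series_inverse V n)"
proof (induction n rule: less_induct)
  case (less n)
  show ?case
  proof (cases n)
    case 0
    then show ?thesis by (simp add: ch_1 regular_virt_1)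
  next
    case (Suc m)
    let ?Vs = "map (\<lambda>j. V (Suc j) * series_inverse V (m - j)) [0..<Suc m]"
    have IH: "ch (series_inverse V (m - j)) a x = inverse_seq (\<lambda>j. ch (V j) a x) (m - j)"
      "regular_virt a x (series_inverse V (m - j))" for j
      using less.IH[of "m - j"] Suc by auto
    have reg: "regular_virt a x U" if "U \<in> set ?Vs" for U
      using that IH(2) assms by (auto intro!: regular_virt_mult simp del: upt_Suc)
    have "ch (series_inverse V n) a x = - (\<Sum>U\<leftarrow>?Vs. ch U a x)"
      unfolding Suc series_inverse.simps
      by (subst ch_uminus[OF regular_virt_sum[OF reg] regular_virt_0]) (use reg in \<open>auto simp only: ch_virt_sum\<close>)
    also have "(\<Sum>U\<leftarrow>?Vs. ch U a x) = (\<Sum>j\<leftarrow>[0..<Suc m]. ch (V (Suc j)) a x * inverse_seq (\<lambda>j. ch (V j) a x) (m - j))"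
      unfolding map_map comp_def by (simp only: ch_mult[OF assms IH(2)] IH(1))
    finally have "ch (series_inverse V n) a x = inverse_seq (\<lambda>j. ch (V j) a x) n"
      by (simp only: Suc inverse_seq.simps)
    moreover have "regular_virt a x (series_inverse V n)"
      unfolding Suc series_inverse.simps
      by (rule regular_virt_uminus[OF regular_virt_sum[OF reg] regular_virt_0])
    ultimately show ?thesis by blast
  qed
qed

lemma
  assumes "\<And>j. regular_virt a x (V j)" "\<And>j. regular_virt a x (W j)"
  shows ch_series_quotient: "ch (series_quotient V W n) a x =
      (\<Sum>j\<leftarrow>[0..<Suc n]. ch (V j) a x * inverse_seq (\<lambda>j. ch (W j) a x) (n - j))"
    and regular_virt_series_quotient: "regular_virt a x (series_quotient V W n)"
proof -
  let ?Vs = "map (\<lambda>j. V j * series_inverse W (n - j)) [0..<Suc n]"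
  note inv = ch_series_inverse[of a x W, OF assms(2)]
  have reg: "regular_virt a x U" if "U \<in> set ?Vs" for U
    using that inv assms by (auto intro!: regular_virt_mult simp del: upt_Suc)
  show "regular_virt a x (series_quotient V W n)"
    unfolding series_quotient_def by (rule regular_virt_sum[OF reg])
  show "ch (series_quotient V W n) a x =
      (\<Sum>j\<leftarrow>[0..<Suc n]. ch (V j) a x * inverse_seq (\<lambda>j. ch (W j) a x) (n - j))"
  proof -
    have "ch (virt_sum ?Vs) a x = (\<Sum>U\<leftarrow>?Vs. ch U a x)"
      by (rule ch_virt_sum) (rule reg)
    then show ?thesis
      unfolding series_quotient_def map_map comp_def
      by (simp only: ch_mult[OF assms(1) inv[THEN conjunct2]] inv[THEN conjunct1])
  qed
qed


section \<open>Traces in the spinor representation\<close>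

lemma ktr_kmul_commute: "ktr I (kmul I F H) = ktr I (kmul I H F)"
  unfolding ktr_def kmul_def by (subst sum.swap) (simp add: mult.commute)

lemma kmul_sum_left: "kmul I (\<lambda>i j. \<Sum>q\<in>Q. F q i j) H i j = (\<Sum>q\<in>Q. kmul I (F q) H i j)"
  unfolding kmul_def sum_distrib_right by (rule sum.swap)

lemma kmul_sum_right: "kmul I H (\<lambda>i j. \<Sum>q\<in>Q. F q i j) i j = (\<Sum>q\<in>Q. kmul I H (F q) i j)"
  unfolding kmul_def sum_distrib_left by (rule sum.swap)

lemma kmul_scale_left: "kmul I (\<lambda>i j. c * F i j) H i j = c * kmul I F H i j"
  by (simp add: kmul_def sum_distrib_left mult.assoc)

lemma kmul_scale_right: "kmul I H (\<lambda>i j. c * F i j) i j = c * kmul I H F i j"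
  by (simp add: kmul_def sum_distrib_left mult.left_commute)

lemma kmul_add_left: "kmul I (\<lambda>i j. F i j + G i j) H i j = kmul I F H i j + kmul I G H i j"
  by (simp add: kmul_def distrib_right sum.distrib)

lemma kmul_add_right: "kmul I H (\<lambda>i j. F i j + G i j) i j = kmul I H F i j + kmul I H G i j"
  by (simp add: kmul_def distrib_left sum.distrib)

text \<open>
  A Clifford module over an arbitrary commutative ring in which \<open>4\<close> is invertible.  It is used over the complex numbers, for the
  connection, and over the ring of even forms, for the curvature.
\<close>

locale clifford_kernels =
  fixes T :: "'t set" and P :: "'p set" and \<gamma> :: "'t \<Rightarrow> 'p \<Rightarrow> 'p \<Rightarrow> 'a::comm_ring_1" and h :: 'a
  assumes finite_T [simp]: "finite T" and finite_P [simp]: "finite P"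
    and quarter: "4 * h = 1"
    and clifford: "i \<in> T \<Longrightarrow> j \<in> T \<Longrightarrow> p \<in> P \<Longrightarrow> q \<in> P \<Longrightarrow>
      kmul P (\<gamma> i) (\<gamma> j) p q + kmul P (\<gamma> j) (\<gamma> i) p q = - 2 * kone i j * kone p q"
begin

text \<open>
  The element \<open>- 1/4 \<Sum>\<^sub>i\<^sub>j A\<^sub>i\<^sub>j \<gamma>\<^sub>i \<gamma>\<^sub>j\<close> of the spin Lie algebra that corresponds to \<open>A\<close>.
\<close>

definition spin :: "('t \<Rightarrow> 't \<Rightarrow> 'a) \<Rightarrow> 'p \<Rightarrow> 'p \<Rightarrow> 'a" where
  "spin A p q = - h * (\<Sum>i\<in>T. \<Sum>j\<in>T. A i j * kmul P (\<gamma> i) (\<gamma> j) p q)"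

definition skew :: "('t \<Rightarrow> 't \<Rightarrow> 'a) \<Rightarrow> bool" where
  "skew A \<longleftrightarrow> (\<forall>i\<in>T. \<forall>j\<in>T. A i j = - A j i)"

lemma skewD: "skew A \<Longrightarrow> i \<in> T \<Longrightarrow> j \<in> T \<Longrightarrow> A i j = - A j i"
  unfolding skew_def by blast

lemma eq_half: "2 * x = y \<Longrightarrow> x = 2 * h * y"
proof -
  assume "2 * x = y"
  moreover have "2 * h * (2 * x) = (4 * h) * x" by (simp add: algebra_simps)
  ultimately have "2 * h * y = (4 * h) * x" by simp
  then show ?thesis by (simp add: quarter)
qed

lemma double_eq_0: "2 * x = 0 \<Longrightarrow> (x::'a) = 0"
  using eq_half[of x 0] by simp

lemma eq_uminus_0: "x = - x \<Longrightarrow> (x::'a) = 0"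
proof -
  assume "x = - x"
  have "2 * x = x + x" by simp
  also have "\<dots> = x + - x" by (rule arg_cong[OF \<open>x = - x\<close>])
  finally have "2 * x = 0" by simp
  then show ?thesis by (rule double_eq_0)
qed

lemma gamma_gamma:
  assumes "i \<in> T" "j \<in> T" "p \<in> P" "q \<in> P"
  shows "kmul P (\<gamma> i) (\<gamma> j) p q = - kmul P (\<gamma> j) (\<gamma> i) p q + (- 2 * kone i j) * kone p q"
  using clifford[OF assms] by (simp add: algebra_simps eq_neg_iff_add_eq_0)

lemma gamma_triple:
  assumes "i \<in> T" "j \<in> T" "k \<in> T" "p \<in> P" "q \<in> P"
  shows "kmul P (kmul P (\<gamma> i) (\<gamma> j)) (\<gamma> k) p q =
    kmul P (\<gamma> k) (kmul P (\<gamma> i) (\<gamma> j)) p q - 2 * kone j k * \<gamma> i p q + 2 * kone i k * \<gamma> j p q"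
proof -
  have "kmul P (kmul P (\<gamma> i) (\<gamma> j)) (\<gamma> k) p q = kmul P (\<gamma> i) (kmul P (\<gamma> j) (\<gamma> k)) p q"
    by (simp add: kmul_assoc)
  also have "\<dots> = kmul P (\<gamma> i) (\<lambda>p q. - 1 * kmul P (\<gamma> k) (\<gamma> j) p q + (- 2 * kone j k) * kone p q) p q"
    by (rule kmul_cong[OF refl], subst gamma_gamma) (use assms in simp_all)
  also have "\<dots> = - kmul P (kmul P (\<gamma> i) (\<gamma> k)) (\<gamma> j) p q - 2 * kone j k * \<gamma> i p q"
    using assms by (simp only: kmul_add_right kmul_scale_right kmul_assoc kmul_kone_right finite_P) simp
  also have "kmul P (kmul P (\<gamma> i) (\<gamma> k)) (\<gamma> j) p q =
      kmul P (\<lambda>p q. - 1 * kmul P (\<gamma> k) (\<gamma> i) p q + (- 2 * kone i k) * kone p q) (\<gamma> j) p q"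
    by (rule kmul_cong[OF _ refl], subst gamma_gamma) (use assms in simp_all)
  also have "\<dots> = - kmul P (\<gamma> k) (kmul P (\<gamma> i) (\<gamma> j)) p q - 2 * kone i k * \<gamma> j p q"
    using assms by (simp only: kmul_add_left kmul_scale_left kmul_assoc kmul_kone_left finite_P) simp
  finally show ?thesis by (simp add: algebra_simps)
qed

text \<open>
  The commutator with \<open>spin A\<close> acts on the span of the generators by \<open>A\<close>; everything else about the
  spinor representation follows from this.
\<close>

lemma spin_gamma:
  assumes A: "skew A" and k: "k \<in> T" and pq: "p \<in> P" "q \<in> P"
  shows "kmul P (spin A) (\<gamma> k) p q = kmul P (\<gamma> k) (spin A) p q + (\<Sum>i\<in>T. A i k * \<gamma> i p q)"
proof -
  have 1: "kmul P (spin A) (\<gamma> k) p q = - h * (\<Sum>i\<in>T. \<Sum>j\<in>T. A i j * kmul P (kmul P (\<gamma> i) (\<gamma> j)) (\<gamma> k) p q)"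
    unfolding spin_def[abs_def] kmul_scale_left kmul_sum_left ..
  have 2: "kmul P (\<gamma> k) (spin A) p q = - h * (\<Sum>i\<in>T. \<Sum>j\<in>T. A i j * kmul P (\<gamma> k) (kmul P (\<gamma> i) (\<gamma> j)) p q)"
    unfolding spin_def[abs_def] kmul_scale_right kmul_sum_right ..
  have "(\<Sum>i\<in>T. \<Sum>j\<in>T. A i j * kmul P (kmul P (\<gamma> i) (\<gamma> j)) (\<gamma> k) p q) =
      (\<Sum>i\<in>T. \<Sum>j\<in>T. A i j * kmul P (\<gamma> k) (kmul P (\<gamma> i) (\<gamma> j)) p q
        - 2 * (\<gamma> i p q * (A i j * kone j k)) + 2 * (kone i k * (A i j * \<gamma> j p q)))"
    using k pq by (intro sum.cong refl) (simp add: gamma_triple algebra_simps)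
  also have "\<dots> = (\<Sum>i\<in>T. \<Sum>j\<in>T. A i j * kmul P (\<gamma> k) (kmul P (\<gamma> i) (\<gamma> j)) p q)
      - 2 * (\<Sum>i\<in>T. \<gamma> i p q * (\<Sum>j\<in>T. A i j * kone j k)) + 2 * (\<Sum>i\<in>T. kone i k * (\<Sum>j\<in>T. A i j * \<gamma> j p q))"
    by (simp add: sum.distrib sum_subtractf sum_distrib_left)
  also have "(\<Sum>i\<in>T. \<gamma> i p q * (\<Sum>j\<in>T. A i j * kone j k)) = (\<Sum>i\<in>T. A i k * \<gamma> i p q)"
    using k by (simp add: mult.commute)
  also have "(\<Sum>i\<in>T. kone i k * (\<Sum>j\<in>T. A i j * \<gamma> j p q)) = (\<Sum>j\<in>T. A k j * \<gamma> j p q)"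
    using k by (simp add: mult.commute[of "kone _ _"])
  also have "(\<Sum>j\<in>T. A k j * \<gamma> j p q) = - (\<Sum>i\<in>T. A i k * \<gamma> i p q)"
    unfolding sum_negf[symmetric] using skewD[OF A k] by (intro sum.cong refl) simp
  finally have eq: "(\<Sum>i\<in>T. \<Sum>j\<in>T. A i j * kmul P (kmul P (\<gamma> i) (\<gamma> j)) (\<gamma> k) p q) =
      (\<Sum>i\<in>T. \<Sum>j\<in>T. A i j * kmul P (\<gamma> k) (kmul P (\<gamma> i) (\<gamma> j)) p q) - 4 * (\<Sum>i\<in>T. A i k * \<gamma> i p q)"
    by simp
  have "kmul P (spin A) (\<gamma> k) p q = kmul P (\<gamma> k) (spin A) p q + (4 * h) * (\<Sum>i\<in>T. A i k * \<gamma> i p q)"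
    unfolding 1 2 eq by (simp add: algebra_simps)
  then show ?thesis by (simp add: quarter)
qed

lemma kcomm_spin:
  assumes A: "skew A" and pq: "p \<in> P" "q \<in> P"
  shows "kcomm P (spin A) (spin B) p q = spin (kcomm T A B) p q"
proof -
  let ?G = "\<lambda>i j. kmul P (\<gamma> i) (\<gamma> j) p q"
  have comm: "kmul P (spin A) (kmul P (\<gamma> i) (\<gamma> j)) p q =
      kmul P (kmul P (\<gamma> i) (\<gamma> j)) (spin A) p q + (\<Sum>l\<in>T. A l j * ?G i l) + (\<Sum>l\<in>T. A l i * ?G l j)"
    if ij: "i \<in> T" "j \<in> T" for i j
  proof -
    have "kmul P (spin A) (kmul P (\<gamma> i) (\<gamma> j)) p q = kmul P (kmul P (spin A) (\<gamma> i)) (\<gamma> j) p q"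
      by (simp add: kmul_assoc)
    also have "\<dots> = kmul P (\<lambda>p q. kmul P (\<gamma> i) (spin A) p q + (\<Sum>l\<in>T. A l i * \<gamma> l p q)) (\<gamma> j) p q"
      by (rule kmul_cong) (use spin_gamma[OF A] ij pq in auto)
    also have "\<dots> = kmul P (\<gamma> i) (kmul P (spin A) (\<gamma> j)) p q + (\<Sum>l\<in>T. A l i * ?G l j)"
      by (simp only: kmul_add_left kmul_sum_left kmul_scale_left kmul_assoc)
    also have "kmul P (\<gamma> i) (kmul P (spin A) (\<gamma> j)) p q =
        kmul P (\<gamma> i) (\<lambda>p q. kmul P (\<gamma> j) (spin A) p q + (\<Sum>l\<in>T. A l j * \<gamma> l p q)) p q"
      by (rule kmul_cong) (use spin_gamma[OF A] ij pq in auto)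
    also have "\<dots> = kmul P (kmul P (\<gamma> i) (\<gamma> j)) (spin A) p q + (\<Sum>l\<in>T. A l j * ?G i l)"
      by (simp only: kmul_add_right kmul_sum_right kmul_scale_right kmul_assoc)
    finally show ?thesis .
  qed
  have 1: "kmul P (spin A) (spin B) p q =
      - h * (\<Sum>i\<in>T. \<Sum>j\<in>T. B i j * kmul P (spin A) (kmul P (\<gamma> i) (\<gamma> j)) p q)"
    unfolding spin_def[of B, abs_def] kmul_scale_right kmul_sum_right ..
  have 2: "kmul P (spin B) (spin A) p q =
      - h * (\<Sum>i\<in>T. \<Sum>j\<in>T. B i j * kmul P (kmul P (\<gamma> i) (\<gamma> j)) (spin A) p q)"
    unfolding spin_def[of B, abs_def] kmul_scale_left kmul_sum_left ..
  have "kcomm P (spin A) (spin B) p q =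
      - h * ((\<Sum>i\<in>T. \<Sum>j\<in>T. \<Sum>l\<in>T. B i j * (A l j * ?G i l)) + (\<Sum>i\<in>T. \<Sum>j\<in>T. \<Sum>l\<in>T. B i j * (A l i * ?G l j)))"
    unfolding kcomm_def 1 2 by (simp add: comm distrib_left sum.distrib sum_distrib_left)
  also have "(\<Sum>i\<in>T. \<Sum>j\<in>T. \<Sum>l\<in>T. B i j * (A l j * ?G i l)) = (\<Sum>i\<in>T. \<Sum>l\<in>T. - (kmul T B A i l * ?G i l))"
  proof (rule sum.cong[OF refl])
    fix i assume "i \<in> T"
    have "(\<Sum>j\<in>T. \<Sum>l\<in>T. B i j * (A l j * ?G i l)) = (\<Sum>l\<in>T. \<Sum>j\<in>T. B i j * (A l j * ?G i l))"
      by (rule sum.swap)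
    also have "\<dots> = (\<Sum>l\<in>T. \<Sum>j\<in>T. - (B i j * A j l * ?G i l))"
      by (intro sum.cong refl) (subst skewD[OF A], auto)
    finally show "(\<Sum>j\<in>T. \<Sum>l\<in>T. B i j * (A l j * ?G i l)) = (\<Sum>l\<in>T. - (kmul T B A i l * ?G i l))"
      by (simp add: kmul_def sum_distrib_right sum_negf)
  qed
  also have "(\<Sum>i\<in>T. \<Sum>j\<in>T. \<Sum>l\<in>T. B i j * (A l i * ?G l j)) = (\<Sum>l\<in>T. \<Sum>j\<in>T. kmul T A B l j * ?G l j)"
  proof -
    have "(\<Sum>i\<in>T. \<Sum>j\<in>T. \<Sum>l\<in>T. B i j * (A l i * ?G l j)) = (\<Sum>i\<in>T. \<Sum>l\<in>T. \<Sum>j\<in>T. B i j * (A l i * ?G l j))"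
      by (intro sum.cong refl sum.swap)
    also have "\<dots> = (\<Sum>l\<in>T. \<Sum>i\<in>T. \<Sum>j\<in>T. B i j * (A l i * ?G l j))"
      by (rule sum.swap)
    also have "\<dots> = (\<Sum>l\<in>T. \<Sum>j\<in>T. \<Sum>i\<in>T. B i j * (A l i * ?G l j))"
      by (intro sum.cong refl sum.swap)
    finally show ?thesis by (simp add: kmul_def sum_distrib_right mult_ac)
  qed
  finally show ?thesis
    by (simp add: spin_def[of "kcomm T A B"] kcomm_def[of T] left_diff_distrib sum_subtractf sum_negf)
qed

text \<open>
  The binomial formula for moving a generator through a power: on the generators, multiplication by
  \<open>spin A\<close> from the left is the sum of the commuting operations of multiplication from the right and
  of \<open>A\<close>.
\<close>

lemma spin_pow_gamma:
  assumes A: "skew A" and k: "k \<in> T" and pq: "p \<in> P" "q \<in> P"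
  shows "kmul P (kpow P (spin A) m) (\<gamma> k) p q =
    (\<Sum>r\<le>m. of_nat (m choose r) * (\<Sum>i\<in>T. kpow T A r i k * kmul P (\<gamma> i) (kpow P (spin A) (m - r)) p q))"
  using pq
proof (induction m arbitrary: p q)
  case 0
  then show ?case using k by (simp add: kmul_kone_left kmul_kone_right mult.commute[of "kone _ _"])
next
  case (Suc m)
  let ?S = "spin A"
  define a where "a r n = (\<Sum>i\<in>T. kpow T A r i k * kmul P (\<gamma> i) (kpow P ?S n) p q)" for r n
  have left: "kmul P ?S (kpow P ?S n) p' q' = kpow P ?S (Suc n) p' q'" if "p' \<in> P" "q' \<in> P" for n p' q'
  proof -
    have "kmul P ?S (kpow P ?S n) p' q' = kmul P (kpow P ?S (Suc 0)) (kpow P ?S n) p' q'"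
      by (rule kmul_cong) (use that in \<open>simp_all add: kmul_kone_left\<close>)
    then show ?thesis using kpow_add[of P q' ?S "Suc 0" n p'] that by simp
  qed
  have leftA: "(\<Sum>i\<in>T. A l i * kpow T A r i k) = kpow T A (Suc r) l k" if "l \<in> T" for l r
  proof -
    have "(\<Sum>i\<in>T. A l i * kpow T A r i k) = kmul T (kpow T A (Suc 0)) (kpow T A r) l k"
      unfolding kmul_def[of T _ "kpow T A r"] by (intro sum.cong refl) (use that in \<open>simp add: kmul_kone_left\<close>)
    then show ?thesis using kpow_add[of T k A "Suc 0" r l] k by simp
  qed
  have step: "kmul P ?S (kmul P (\<gamma> i) (kpow P ?S n)) p q =
      kmul P (\<gamma> i) (kpow P ?S (Suc n)) p q + (\<Sum>l\<in>T. A l i * kmul P (\<gamma> l) (kpow P ?S n) p q)"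
    if "i \<in> T" for i n
  proof -
    have "kmul P ?S (kmul P (\<gamma> i) (kpow P ?S n)) p q = kmul P (kmul P ?S (\<gamma> i)) (kpow P ?S n) p q"
      by (simp add: kmul_assoc)
    also have "\<dots> = kmul P (\<lambda>p q. kmul P (\<gamma> i) ?S p q + (\<Sum>l\<in>T. A l i * \<gamma> l p q)) (kpow P ?S n) p q"
      by (rule kmul_cong) (use spin_gamma[OF A that] Suc.prems in auto)
    also have "\<dots> = kmul P (\<gamma> i) (kmul P ?S (kpow P ?S n)) p q + (\<Sum>l\<in>T. A l i * kmul P (\<gamma> l) (kpow P ?S n) p q)"
      by (simp only: kmul_add_left kmul_sum_left kmul_scale_left kmul_assoc)
    also have "kmul P (\<gamma> i) (kmul P ?S (kpow P ?S n)) p q = kmul P (\<gamma> i) (kpow P ?S (Suc n)) p q"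
      by (rule kmul_cong) (use left Suc.prems in auto)
    finally show ?thesis .
  qed
  have "kmul P (kpow P ?S (Suc m)) (\<gamma> k) p q = kmul P (kmul P ?S (kpow P ?S m)) (\<gamma> k) p q"
    by (rule kmul_cong) (use left Suc.prems in auto)
  also have "\<dots> = kmul P ?S (kmul P (kpow P ?S m) (\<gamma> k)) p q"
    by (simp add: kmul_assoc)
  also have "\<dots> = kmul P ?S (\<lambda>p q. \<Sum>r\<le>m. of_nat (m choose r) *
      (\<Sum>i\<in>T. kpow T A r i k * kmul P (\<gamma> i) (kpow P ?S (m - r)) p q)) p q"
    by (rule kmul_cong) (use Suc in auto)
  also have "\<dots> = (\<Sum>r\<le>m. of_nat (m choose r) *
      (\<Sum>i\<in>T. kpow T A r i k * kmul P ?S (kmul P (\<gamma> i) (kpow P ?S (m - r))) p q))"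
    by (simp only: kmul_sum_right kmul_scale_right)
  also have "\<dots> = (\<Sum>r\<le>m. of_nat (m choose r) * (a (Suc r) (m - r) + a r (Suc (m - r))))"
  proof (intro sum.cong refl arg_cong2[where f = "(*)"])
    fix r
    have "(\<Sum>i\<in>T. kpow T A r i k * (\<Sum>l\<in>T. A l i * kmul P (\<gamma> l) (kpow P ?S (m - r)) p q)) =
        (\<Sum>l\<in>T. (\<Sum>i\<in>T. A l i * kpow T A r i k) * kmul P (\<gamma> l) (kpow P ?S (m - r)) p q)"
      unfolding sum_distrib_left sum_distrib_right by (subst sum.swap) (simp add: mult_ac)
    also have "\<dots> = a (Suc r) (m - r)"
      unfolding a_def by (intro sum.cong refl) (simp only: leftA)
    finally show "(\<Sum>i\<in>T. kpow T A r i k * kmul P ?S (kmul P (\<gamma> i) (kpow P ?S (m - r))) p q) =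
        a (Suc r) (m - r) + a r (Suc (m - r))"
      by (simp add: step distrib_left sum.distrib a_def)
  qed
  also have "\<dots> = (\<Sum>r\<le>Suc m. of_nat (Suc m choose r) * a r (Suc m - r))"
    by (rule sum_choose_pascal)
  finally show ?case by (simp only: a_def)
qed

definition spin_trace :: "('t \<Rightarrow> 't \<Rightarrow> 'a) \<Rightarrow> nat \<Rightarrow> 'a" where
  "spin_trace A m = ktr P (kpow P (spin A) m)"

definition gamma_trace :: "('t \<Rightarrow> 't \<Rightarrow> 'a) \<Rightarrow> nat \<Rightarrow> 't \<Rightarrow> 't \<Rightarrow> 'a" where
  "gamma_trace A m i j = ktr P (kmul P (kmul P (\<gamma> i) (\<gamma> j)) (kpow P (spin A) m))"

text \<open>
  Move \<open>\<gamma>\<^sub>i\<close> to the end by cyclicity of the trace, and then back through the power to the left.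
\<close>

lemma gamma_trace_cyclic:
  assumes A: "skew A" and ij: "i \<in> T" "j \<in> T"
  shows "gamma_trace A m i j = (\<Sum>r\<le>m. of_nat (m choose r) * kmul T (gamma_trace A (m - r)) (kpow T A r) j i)"
proof -
  have "gamma_trace A m i j = ktr P (kmul P (kmul P (\<gamma> j) (kpow P (spin A) m)) (\<gamma> i))"
    unfolding gamma_trace_def kmul_assoc by (subst ktr_kmul_commute) (simp add: kmul_assoc)
  also have "\<dots> = (\<Sum>p\<in>P. kmul P (\<gamma> j) (kmul P (kpow P (spin A) m) (\<gamma> i)) p p)"
    by (simp add: ktr_def kmul_assoc)
  also have "\<dots> = (\<Sum>p\<in>P. kmul P (\<gamma> j) (\<lambda>p q. \<Sum>r\<le>m. of_nat (m choose r) *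
      (\<Sum>l\<in>T. kpow T A r l i * kmul P (\<gamma> l) (kpow P (spin A) (m - r)) p q)) p p)"
    by (intro sum.cong refl kmul_cong) (use spin_pow_gamma[OF A] ij in auto)
  also have "\<dots> = (\<Sum>p\<in>P. \<Sum>r\<le>m. of_nat (m choose r) *
      (\<Sum>l\<in>T. kpow T A r l i * kmul P (kmul P (\<gamma> j) (\<gamma> l)) (kpow P (spin A) (m - r)) p p))"
    by (simp only: kmul_sum_right kmul_scale_right kmul_assoc)
  also have "\<dots> = (\<Sum>r\<le>m. of_nat (m choose r) *
      (\<Sum>l\<in>T. kpow T A r l i * ktr P (kmul P (kmul P (\<gamma> j) (\<gamma> l)) (kpow P (spin A) (m - r)))))"
    unfolding ktr_def sum_distrib_left by (subst sum.swap, intro sum.cong refl sum.swap)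
  also have "\<dots> = (\<Sum>r\<le>m. of_nat (m choose r) * kmul T (gamma_trace A (m - r)) (kpow T A r) j i)"
    unfolding gamma_trace_def[symmetric] by (simp only: kmul_def mult.commute)
  finally show ?thesis .
qed

lemma gamma_trace_clifford:
  assumes "i \<in> T" "j \<in> T"
  shows "gamma_trace A m i j + gamma_trace A m j i = - 2 * kone i j * spin_trace A m"
proof -
  have "gamma_trace A m i j + gamma_trace A m j i = (\<Sum>p\<in>P. kmul P (\<lambda>p q. kmul P (\<gamma> i) (\<gamma> j) p q + kmul P (\<gamma> j) (\<gamma> i) p q) (kpow P (spin A) m) p p)"
    by (simp add: gamma_trace_def ktr_def kmul_add_left sum.distrib)
  also have "\<dots> = (\<Sum>p\<in>P. kmul P (\<lambda>p q. (- 2 * kone i j) * kone p q) (kpow P (spin A) m) p p)"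
    by (intro sum.cong refl kmul_cong) (use clifford assms in auto)
  also have "\<dots> = - 2 * kone i j * spin_trace A m"
    unfolding kmul_scale_left by (simp add: kmul_kone_left spin_trace_def ktr_def sum_distrib_left)
  finally show ?thesis .
qed

lemma spin_trace_Suc: "spin_trace A (Suc m) = - h * (\<Sum>i\<in>T. \<Sum>j\<in>T. A i j * gamma_trace A m i j)"
proof -
  have expand: "kmul P (spin A) K p q = - h * (\<Sum>i\<in>T. \<Sum>j\<in>T. A i j * kmul P (kmul P (\<gamma> i) (\<gamma> j)) K p q)" for K p q
    unfolding spin_def[abs_def] kmul_scale_left kmul_sum_left ..
  have "spin_trace A (Suc m) = ktr P (kmul P (spin A) (kpow P (spin A) m))"
    by (simp add: spin_trace_def ktr_kmul_commute)
  also have "\<dots> = (\<Sum>p\<in>P. - h * (\<Sum>i\<in>T. \<Sum>j\<in>T. A i j * kmul P (kmul P (\<gamma> i) (\<gamma> j)) (kpow P (spin A) m) p p))"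
    unfolding ktr_def by (intro sum.cong refl expand)
  also have "\<dots> = - h * (\<Sum>p\<in>P. \<Sum>i\<in>T. \<Sum>j\<in>T. A i j * kmul P (kmul P (\<gamma> i) (\<gamma> j)) (kpow P (spin A) m) p p)"
    by (simp only: sum_distrib_left)
  also have "(\<Sum>p\<in>P. \<Sum>i\<in>T. \<Sum>j\<in>T. A i j * kmul P (kmul P (\<gamma> i) (\<gamma> j)) (kpow P (spin A) m) p p) =
      (\<Sum>i\<in>T. \<Sum>j\<in>T. A i j * gamma_trace A m i j)"
    unfolding gamma_trace_def ktr_def sum_distrib_left by (rule trans[OF sum.swap sum.cong[OF refl sum.swap]])
  finally show ?thesis .
qed

lemma kpow_skew_T:
  assumes "skew A" "i \<in> T" "j \<in> T"
  shows "kpow T A k i j = (- 1) ^ k * kpow T A k j i"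
  by (rule kpow_skew[OF skewD[OF assms(1)] finite_T assms(2,3)])

lemma sum_mult_kpow:
  assumes A: "skew A"
  shows "(\<Sum>i\<in>T. \<Sum>j\<in>T. A i j * kpow T A m i j) = (- 1) ^ m * ktr T (kpow T A (Suc m))"
proof -
  have "(\<Sum>i\<in>T. \<Sum>j\<in>T. A i j * kpow T A m i j) = (\<Sum>i\<in>T. \<Sum>j\<in>T. (- 1) ^ m * (kpow T A m j i * A i j))"
    by (intro sum.cong refl) (subst kpow_skew_T[OF A], auto simp: mult_ac)
  also have "\<dots> = (- 1) ^ m * ktr T (kmul T A (kpow T A m))"
    by (simp add: ktr_def kmul_def sum_distrib_left mult_ac)
  finally show ?thesis by (simp add: ktr_kmul_commute)
qed

text \<open>
  The term for \<open>r = 0\<close> of the previous formula is the transposed trace, which the Clifford relation expresses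
  by the original one.  So the trace with exponent \<open>m\<close> is determined by those with smaller exponents.
\<close>

lemma gamma_trace_recursion:
  assumes A: "skew A" and ij: "i \<in> T" "j \<in> T"
  shows "2 * gamma_trace A m i j = - 2 * kone i j * spin_trace A m
    + (\<Sum>r<m. of_nat (m choose Suc r) * kmul T (gamma_trace A (m - Suc r)) (kpow T A (Suc r)) j i)"
proof -
  have "gamma_trace A m i j = gamma_trace A m j i + (\<Sum>r<m. of_nat (m choose Suc r) * kmul T (gamma_trace A (m - Suc r)) (kpow T A (Suc r)) j i)"
    unfolding gamma_trace_cyclic[OF A ij] lessThan_Suc_atMost[symmetric] sum.lessThan_Suc_shift
    using ij by (simp add: kmul_kone_right)
  moreover have "gamma_trace A m j i = - 2 * kone i j * spin_trace A m - gamma_trace A m i j"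
    using gamma_trace_clifford[OF ij, of A m] by (simp add: algebra_simps eq_diff_eq)
  ultimately show ?thesis by (simp add: algebra_simps)
qed

text \<open>
  With \<open>X\<^sub>m\<close> the matrix of the traces of \<open>\<gamma>\<^sub>i \<gamma>\<^sub>j (spin A)\<^sup>m\<close>, the recursion gives \<open>X\<^sub>0 = - 16\<close>, \<open>X\<^sub>1 = 8 A\<close>,
  \<open>X\<^sub>2 = - 2 u\<close> and \<open>X\<^sub>3 = 3 u A - 4 A\<^sup>3\<close>, and \<open>spin_trace A (m + 1)\<close> is \<open>1/4 tr (A X\<^sub>m)\<close>.
\<close>

lemma spin_trace_values:
  assumes A: "skew A" and dim: "card P = 16"
  defines "u \<equiv> ktr T (kpow T A 2)" and "v \<equiv> ktr T (kpow T A 4)"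
  shows "spin_trace A 0 = 16" "spin_trace A 1 = 0" "spin_trace A 2 = 2 * u" "spin_trace A 3 = 0" "4 * spin_trace A 4 = 3 * (u * u) - 4 * v"
proof -
  have kmul_kpow: "kmul T (\<lambda>i j. c * kpow T A n i j) (kpow T A m) i j = c * kpow T A (n + m) i j"
    if "j \<in> T" for c n m i j
    using kpow_add[of T j A n m i] that by (simp add: kmul_scale_left)
  show t0: "spin_trace A 0 = 16"
    by (simp add: spin_trace_def ktr_def kone_def dim)
  have half: "x = y" if "2 * x = 2 * y" for x y :: 'a
    using double_eq_0[of "x - y"] that by (simp add: right_diff_distrib)
  have odd: "kpow T A k j i = - kpow T A k i j" if "odd k" "i \<in> T" "j \<in> T" for k i j
    using kpow_skew_T[OF A that(3,2), of k] that(1) by simp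
  have tr_odd: "ktr T (kpow T A k) = 0" if "odd k" for k
  proof -
    have "kpow T A k i i = 0" if "i \<in> T" for i
      by (rule eq_uminus_0[OF odd[OF \<open>odd k\<close> that that]])
    then show ?thesis by (simp add: ktr_def)
  qed
  have spin_trace_Suc': "spin_trace A (Suc m) = - h * (c * (- 1) ^ n * ktr T (kpow T A (Suc n)) + d * (- 1) ^ n' * ktr T (kpow T A (Suc n')))"
    if "\<And>i j. i \<in> T \<Longrightarrow> j \<in> T \<Longrightarrow> gamma_trace A m i j = c * kpow T A n i j + d * kpow T A n' i j" for m c n d n'
  proof -
    have "(\<Sum>i\<in>T. \<Sum>j\<in>T. A i j * gamma_trace A m i j) =
        c * (\<Sum>i\<in>T. \<Sum>j\<in>T. A i j * kpow T A n i j) + d * (\<Sum>i\<in>T. \<Sum>j\<in>T. A i j * kpow T A n' i j)"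
      unfolding sum_distrib_left sum.distrib[symmetric]
      by (intro sum.cong refl) (simp add: that algebra_simps)
    then show ?thesis by (simp add: spin_trace_Suc sum_mult_kpow[OF A] mult.assoc)
  qed
  have X0: "gamma_trace A 0 i j = - 16 * kpow T A 0 i j" if "i \<in> T" "j \<in> T" for i j
    by (rule half) (use gamma_trace_recursion[OF A that, of 0] in \<open>simp add: t0\<close>)
  have t1: "spin_trace A (Suc 0) = 0"
    using spin_trace_Suc'[of 0 "- 16" 0 0 0] X0 tr_odd[of "Suc 0"] by simp
  then show "spin_trace A 1 = 0" by simp
  have X0': "kmul T (gamma_trace A 0) (kpow T A n) j i = - 16 * kpow T A n j i" if "i \<in> T" "j \<in> T" for i j n
  proof -
    have "kmul T (gamma_trace A 0) (kpow T A n) j i = kmul T (\<lambda>i j. - 16 * kpow T A 0 i j) (kpow T A n) j i"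
      by (rule kmul_cong) (use X0 that in auto)
    then show ?thesis using kmul_kpow[OF that(1), of "- 16" 0 n j] by simp
  qed
  have X1: "gamma_trace A 1 i j = 8 * kpow T A 1 i j" if "i \<in> T" "j \<in> T" for i j
    by (rule half) (use gamma_trace_recursion[OF A that, of 1] X0'[OF that, of 1] odd[of 1, OF _ that] t1 in simp)
  have t2: "spin_trace A 2 = 2 * u"
  proof -
    have "spin_trace A 2 = (4 * h) * (2 * u)"
      using spin_trace_Suc'[of 1 8 1 0 0] X1 by (simp add: u_def numeral_2_eq_2 algebra_simps)
    then show ?thesis by (simp add: quarter)
  qed
  then show "spin_trace A 2 = 2 * u" .
  have X1': "kmul T (gamma_trace A 1) (kpow T A n) j i = 8 * kpow T A (Suc n) j i" if "i \<in> T" "j \<in> T" for i j n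
  proof -
    have "kmul T (gamma_trace A 1) (kpow T A n) j i = kmul T (\<lambda>i j. 8 * kpow T A 1 i j) (kpow T A n) j i"
      by (rule kmul_cong) (use X1 that in auto)
    then show ?thesis using kmul_kpow[OF that(1), of 8 1 n j] by simp
  qed
  have X2: "gamma_trace A 2 i j = - 2 * u * kpow T A 0 i j" if "i \<in> T" "j \<in> T" for i j
  proof (rule half)
    have "2 * gamma_trace A 2 i j = - 2 * kone i j * spin_trace A 2 + 2 * kmul T (gamma_trace A 1) (kpow T A 1) j i
        + kmul T (gamma_trace A 0) (kpow T A 2) j i"
      using gamma_trace_recursion[OF A that, of 2] by (simp add: numeral_2_eq_2)
    also have "\<dots> = - 4 * u * kone i j"
      unfolding X1'[OF that] X0'[OF that] t2 by (simp add: numeral_2_eq_2)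
    finally show "2 * gamma_trace A 2 i j = 2 * (- 2 * u * kpow T A 0 i j)" by simp
  qed
  have t3: "spin_trace A 3 = 0"
    using spin_trace_Suc'[of 2 "- 2 * u" 0 0 0] X2 tr_odd[of "Suc 0"] by (simp add: numeral_3_eq_3)
  then show "spin_trace A 3 = 0" .
  have X2': "kmul T (gamma_trace A 2) (kpow T A n) j i = - 2 * u * kpow T A n j i" if "i \<in> T" "j \<in> T" for i j n
  proof -
    have "kmul T (gamma_trace A 2) (kpow T A n) j i = kmul T (\<lambda>i j. - 2 * u * kpow T A 0 i j) (kpow T A n) j i"
      by (rule kmul_cong) (use X2 that in auto)
    then show ?thesis using kmul_kpow[OF that(1), of "- 2 * u" 0 n j] by simp
  qed
  have X3: "gamma_trace A 3 i j = 3 * u * kpow T A 1 i j + - 4 * kpow T A 3 i j" if "i \<in> T" "j \<in> T" for i j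
  proof (rule half)
    have "2 * gamma_trace A 3 i j = 3 * kmul T (gamma_trace A 2) (kpow T A 1) j i + 3 * kmul T (gamma_trace A 1) (kpow T A 2) j i
        + kmul T (gamma_trace A 0) (kpow T A 3) j i"
      using gamma_trace_recursion[OF A that, of 3] t3 by (simp add: numeral_3_eq_3 numeral_2_eq_2)
    also have "\<dots> = 6 * u * kpow T A 1 i j - 8 * kpow T A 3 i j"
      unfolding X2'[OF that] X1'[OF that] X0'[OF that]
      unfolding One_nat_def[symmetric] Suc_1 numeral_2_eq_2[symmetric] odd[of 1, OF odd_one that]
      using odd[of 3, OF _ that] by (simp add: numeral_3_eq_3)
    finally show "2 * gamma_trace A 3 i j = 2 * (3 * u * kpow T A 1 i j + - 4 * kpow T A 3 i j)"
      by (simp add: algebra_simps)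
  qed
  have "spin_trace A 4 = - h * (3 * u * (- 1) ^ 1 * ktr T (kpow T A 2) + - 4 * (- 1) ^ 3 * ktr T (kpow T A 4))"
    using spin_trace_Suc'[of 3 "3 * u" 1 "- 4" 3] X3 by (simp add: eval_nat_numeral)
  then have t4: "spin_trace A 4 = h * (3 * (u * u) - 4 * v)"
    unfolding u_def[symmetric] v_def[symmetric] by (simp add: algebra_simps)
  have "4 * spin_trace A 4 = (4 * h) * (3 * (u * u) - 4 * v)"
    unfolding t4 by (simp add: mult.assoc)
  then show "4 * spin_trace A 4 = 3 * (u * u) - 4 * v" by (simp add: quarter)
qed

end


section \<open>The curvature of the tangent and the spinor bundle\<close>

lemma const_form_kmul: "const_form (kmul I F H i j) = kmul I (\<lambda>i j. const_form (F i j)) (\<lambda>i j. const_form (H i j)) i j"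
  by (simp add: kmul_def const_form_sum const_form_mult)

lemma clifford_kernels_complex:
  assumes "clifford8 c"
  shows "clifford_kernels {..<8} {..<16} (\<lambda>i p q. c i $$ (p, q)) (1 / 4)"
proof
  fix i j p q :: nat
  assume *: "i \<in> {..<8}" "j \<in> {..<8}" "p \<in> {..<16}" "q \<in> {..<16}"
  have c: "c i \<in> carrier_mat 16 16" "c j \<in> carrier_mat 16 16"
    and rel: "c i * c j + c j * c i = (if i = j then - 2 else 0) \<cdot>\<^sub>m 1\<^sub>m 16"
    using assms * by (auto simp: clifford8_def)
  have "(c i * c j) $$ (p, q) + (c j * c i) $$ (p, q) = (c i * c j + c j * c i) $$ (p, q)"
    using c * by (intro index_add_mat(1)[symmetric]) auto
  also have "\<dots> = - 2 * kone i j * kone p q"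
    unfolding rel using * by (simp add: kone_def)
  finally show "kmul {..<16} (\<lambda>p q. c i $$ (p, q)) (\<lambda>p q. c j $$ (p, q)) p q +
      kmul {..<16} (\<lambda>p q. c j $$ (p, q)) (\<lambda>p q. c i $$ (p, q)) p q = - 2 * kone i j * kone p q"
    using mat_mult_kmul[OF c, of p q] mat_mult_kmul[OF c(2,1), of p q] * by simp
qed auto

lemma clifford_kernels_evform:
  assumes "clifford8 c"
  shows "clifford_kernels {..<8} {..<16} (\<lambda>i p q. const_form (c i $$ (p, q)) :: 'n::{finite,linorder} evform)
    (const_form (1 / 4))"
proof
  interpret C: clifford_kernels "{..<8}" "{..<16}" "\<lambda>i p q. c i $$ (p, q)" "1 / 4"
    by (rule clifford_kernels_complex[OF assms])
  show "4 * const_form (1 / 4) = (1 :: 'n evform)"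
    using const_form_mult[of 4 "1 / 4"] by (simp add: const_form_numeral)
  fix i j p q :: nat
  assume *: "i \<in> {..<8}" "j \<in> {..<8}" "p \<in> {..<16}" "q \<in> {..<16}"
  show "kmul {..<16} (\<lambda>p q. const_form (c i $$ (p, q)) :: 'n evform) (\<lambda>p q. const_form (c j $$ (p, q))) p q +
      kmul {..<16} (\<lambda>p q. const_form (c j $$ (p, q))) (\<lambda>p q. const_form (c i $$ (p, q))) p q
      = - 2 * kone i j * kone p q"
    using arg_cong[OF C.clifford[OF *], of "const_form :: complex \<Rightarrow> 'n evform"]
    by (simp add: const_form_kmul const_form_add const_form_mult const_form_uminus const_form_kone const_form_numeral)
qed auto

lemma pderiv_at_uminus_near:
  fixes f h :: "real ^ 'n \<Rightarrow> complex"
  assumes "h differentiable (at x)" "open S" "x \<in> S" "\<And>y. y \<in> S \<Longrightarrow> f y = - h y"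
  shows "pderiv_at k f x = - pderiv_at k h x"
proof -
  have "(\<lambda>y. - 1 * h y) differentiable (at x)" using assms(1) by (rule differentiable_cmult)
  then have "frechet_derivative (\<lambda>y. - 1 * h y) (at x) = frechet_derivative f (at x)"
    by (rule frechet_derivative_transform_within_open[OF _ assms(2,3)]) (simp add: assms(4))
  then show ?thesis
    using pderiv_at_cmult[OF assms(1), of k "- 1"] by (simp add: pderiv_at_def)
qed

text \<open>
  The skew symmetry has to hold near the point, since the curvature contains derivatives of the connection.
\<close>

lemma chern_form_skew:
  assumes E: "regular E a x" and S: "open S" "x \<in> S"
    and skew: "\<And>y k i j. y \<in> S \<Longrightarrow> i < rank E \<Longrightarrow> j < rank E \<Longrightarrow> conn_kernel E a k y i j = - conn_kernel E a k y j i"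
    and ij: "i < rank E" "j < rank E"
  shows "chern_form E a x i j = - chern_form E a x j i"
proof -
  have deriv: "pderiv_at k (\<lambda>y. conn_kernel E a l y i j) x = - pderiv_at k (\<lambda>y. conn_kernel E a l y j i) x" for k l
    by (rule pderiv_at_uminus_near[OF regular_differentiable[OF E ij(2,1)] S skew[OF _ ij]])
  have "kmul {..<rank E} (conn_kernel E a k x) (conn_kernel E a l x) i j =
      kmul {..<rank E} (conn_kernel E a l x) (conn_kernel E a k x) j i" for k l
    unfolding kmul_def
  proof (intro sum.cong refl)
    fix m assume "m \<in> {..<rank E}"
    then show "conn_kernel E a k x i m * conn_kernel E a l x m j = conn_kernel E a l x j m * conn_kernel E a k x m i"
      using skew[OF S(2) ij(1), of m k] skew[OF S(2) _ ij(2), of m l] by (simp add: mult.commute)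
  qed
  then have "curvature_coeff E a x k l i j = - curvature_coeff E a x k l j i" for k l
    unfolding curvature_coeff_regular[OF E ij] curvature_coeff_regular[OF E ij(2,1)] deriv kcomm_def by simp
  then show ?thesis by (simp add: chern_form_def form2_uminus)
qed

text \<open>
  The map \<open>spin\<close> is linear with constant coefficients and, on skew matrices, a homomorphism of Lie
  algebras, so it commutes with the formation of the curvature.
\<close>

lemma chern_form_spin:
  fixes E D :: "('i, 'm, 'n::{finite,linorder}) vbundle"
  assumes c: "clifford8 c" and E: "regular E a x" "rank E = 8"
    and D: "rank D = 16" "\<And>k y. conn D a k y \<in> carrier_mat 16 16"
    and conn: "\<And>k y p q. p < 16 \<Longrightarrow> q < 16 \<Longrightarrow> conn_kernel D a k y p q =
      clifford_kernels.spin {..<8} {..<16} (\<lambda>i p q. c i $$ (p, q)) (1 / 4) (conn_kernel E a k y) p q"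
    and skew: "\<And>k i j. i < 8 \<Longrightarrow> j < 8 \<Longrightarrow> conn_kernel E a k x i j = - conn_kernel E a k x j i"
  shows "regular D a x"
    and "p < 16 \<Longrightarrow> q < 16 \<Longrightarrow> chern_form D a x p q =
      clifford_kernels.spin {..<8} {..<16} (\<lambda>i p q. const_form (c i $$ (p, q))) (const_form (1 / 4)) (chern_form E a x) p q"
proof -
  interpret C: clifford_kernels "{..<8}" "{..<16}" "\<lambda>i p q. c i $$ (p, q)" "1 / 4"
    by (rule clifford_kernels_complex[OF c])
  interpret F: clifford_kernels "{..<8}" "{..<16}" "\<lambda>i p q. const_form (c i $$ (p, q)) :: 'n evform" "const_form (1 / 4)"
    by (rule clifford_kernels_evform[OF c])
  let ?G = "\<lambda>i j p q. kmul {..<16} (\<lambda>p q. c i $$ (p, q)) (\<lambda>p q. c j $$ (p, q)) p q"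
  have diff: "(\<lambda>y. conn_kernel E a k y i j) differentiable (at x)" if "i < 8" "j < 8" for k i j
    using that by (intro regular_differentiable E(1)) (simp_all add: E(2))
  have conn': "conn_kernel D a k y p q = - (1 / 4) * (\<Sum>i<8. \<Sum>j<8. ?G i j p q * conn_kernel E a k y i j)"
    if "p < 16" "q < 16" for k y p q
    using that by (simp add: conn C.spin_def mult.commute)
  have diff': "(\<lambda>y. \<Sum>j<8. ?G i j p q * conn_kernel E a k y i j) differentiable (at x)" if "i \<in> {..<8}" for k i p q
    using that by (intro differentiable_sum_family differentiable_cmult diff) auto
  show D': "regular D a x"
  proof -
    have "(\<lambda>y. conn_kernel D a k y p q) differentiable (at x)" if "p < 16" "q < 16" for k p q
      unfolding conn'[OF that] by (intro differentiable_cmult differentiable_sum_family diff')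
    then show ?thesis using D by (simp add: regular_def conn_kernel_def)
  qed
  assume pq: "p < 16" "q < 16"
  have deriv: "pderiv_at k (\<lambda>y. conn_kernel D a l y p q) x =
      - (1 / 4) * (\<Sum>i<8. \<Sum>j<8. ?G i j p q * pderiv_at k (\<lambda>y. conn_kernel E a l y i j) x)" for k l
  proof -
    have "pderiv_at k (\<lambda>y. conn_kernel D a l y p q) x =
        - (1 / 4) * pderiv_at k (\<lambda>y. \<Sum>i<8. \<Sum>j<8. ?G i j p q * conn_kernel E a l y i j) x"
      unfolding conn'[OF pq] by (intro pderiv_at_cmult differentiable_sum_family diff')
    also have "pderiv_at k (\<lambda>y. \<Sum>i<8. \<Sum>j<8. ?G i j p q * conn_kernel E a l y i j) x =
        (\<Sum>i<8. pderiv_at k (\<lambda>y. \<Sum>j<8. ?G i j p q * conn_kernel E a l y i j) x)"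
      by (intro pderiv_at_sum diff')
    also have "\<dots> = (\<Sum>i<8. \<Sum>j<8. pderiv_at k (\<lambda>y. ?G i j p q * conn_kernel E a l y i j) x)"
      by (intro sum.cong refl pderiv_at_sum differentiable_cmult diff) auto
    also have "\<dots> = (\<Sum>i<8. \<Sum>j<8. ?G i j p q * pderiv_at k (\<lambda>y. conn_kernel E a l y i j) x)"
      by (intro sum.cong refl pderiv_at_cmult diff) auto
    finally show ?thesis .
  qed
  have comm: "kcomm {..<16} (conn_kernel D a k x) (conn_kernel D a l x) p q =
      - (1 / 4) * (\<Sum>i<8. \<Sum>j<8. ?G i j p q * kcomm {..<8} (conn_kernel E a k x) (conn_kernel E a l x) i j)" for k l
  proof -
    have "kcomm {..<16} (conn_kernel D a k x) (conn_kernel D a l x) p q =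
        kcomm {..<16} (C.spin (conn_kernel E a k x)) (C.spin (conn_kernel E a l x)) p q"
      using pq by (intro kcomm_cong) (auto simp: conn)
    also have "\<dots> = C.spin (kcomm {..<8} (conn_kernel E a k x) (conn_kernel E a l x)) p q"
    proof (rule C.kcomm_spin)
      show "C.skew (conn_kernel E a k x)" unfolding C.skew_def using skew by blast
    qed (use pq in auto)
    finally show ?thesis by (simp add: C.spin_def mult.commute)
  qed
  have "curvature_coeff D a x k l p q = - (1 / 4) * (\<Sum>i<8. \<Sum>j<8. ?G i j p q * curvature_coeff E a x k l i j)" for k l
  proof -
    have "curvature_coeff D a x k l p q = - (1 / 4) * (\<Sum>i<8. \<Sum>j<8. ?G i j p q *
       (pderiv_at k (\<lambda>y. conn_kernel E a l y i j) x - pderiv_at l (\<lambda>y. conn_kernel E a k y i j) x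
        + kcomm {..<8} (conn_kernel E a k x) (conn_kernel E a l x) i j))"
      using pq unfolding curvature_coeff_regular[OF D', unfolded D(1), OF pq] deriv comm
      by (simp add: distrib_left right_diff_distrib sum.distrib sum_subtractf)
    then show ?thesis by (simp add: curvature_coeff_regular[OF E(1), unfolded E(2)])
  qed
  then have "form2 (\<lambda>k l. curvature_coeff D a x k l p q) = - const_form (1 / 4) *
      (\<Sum>i<8. \<Sum>j<8. const_form (?G i j p q) * form2 (\<lambda>k l. curvature_coeff E a x k l i j))"
    by (simp only: form2_cmult form2_sum const_form_uminus)
  then show "chern_form D a x p q = F.spin (chern_form E a x) p q"
    unfolding chern_form_def F.spin_def const_form_kmul
    by (simp add: sum_distrib_left sum_negf mult_ac)
qed

lemma bounded_bilinear_matrix_vector_mult: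
  "bounded_bilinear (\<lambda>(A :: real ^ 'n ^ 'm) v. A *v v)"
  unfolding bilinear_conv_bounded_bilinear[symmetric] bilinear_def
  by (auto intro!: linearI simp: matrix_vector_mult_add_rdistrib matrix_vector_right_distrib
      scaleR_matrix_vector_assoc matrix_vector_mult_scaleR)

lemma has_derivative_metric:
  fixes u v :: "real ^ 'k \<Rightarrow> real ^ 'n" and g :: "real ^ 'k \<Rightarrow> real ^ 'n ^ 'n"
  assumes "(u has_derivative u') (at x)" "(g has_derivative g') (at x)" "(v has_derivative v') (at x)"
  shows "((\<lambda>y. u y \<bullet> (g y *v v y)) has_derivative
    (\<lambda>t. u x \<bullet> (g x *v v' t + g' t *v v x) + u' t \<bullet> (g x *v v x))) (at x)"
  using bounded_bilinear.FDERIV[OF bounded_bilinear_inner assms(1)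
      bounded_bilinear.FDERIV[OF bounded_bilinear_matrix_vector_mult assms(2,3)]] .

lemma differentiable_metric:
  fixes u v :: "real ^ 'k \<Rightarrow> real ^ 'n" and g :: "real ^ 'k \<Rightarrow> real ^ 'n ^ 'n"
  assumes "u differentiable (at x)" "g differentiable (at x)" "v differentiable (at x)"
  shows "(\<lambda>y. u y \<bullet> (g y *v v y)) differentiable (at x)"
  using assms has_derivative_metric unfolding differentiable_def by blast

lemma differentiable_matrix_vector_mult:
  fixes v :: "real ^ 'k \<Rightarrow> real ^ 'n" and g :: "real ^ 'k \<Rightarrow> real ^ 'n ^ 'n"
  assumes "g differentiable (at x)" "v differentiable (at x)"
  shows "(\<lambda>y. g y *v v y) differentiable (at x)"
  using assms bounded_bilinear.FDERIV[OF bounded_bilinear_matrix_vector_mult] unfolding differentiable_def by blast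

lemma smooth_on_differentiable:
  assumes "smooth_on f S" "open S" "x \<in> S"
  shows "f differentiable (at x)" "(\<lambda>y. frechet_derivative f (at y) v) differentiable (at x)"
proof -
  have "Ck_on (Suc 0) f S" "Ck_on (Suc (Suc 0)) f S" using assms(1) unfolding smooth_on_def by blast+
  then have "f differentiable_on S" "(\<lambda>y. frechet_derivative f (at y) v) differentiable_on S" by auto
  then show "f differentiable (at x)" "(\<lambda>y. frechet_derivative f (at y) v) differentiable (at x)"
    using assms(2,3) by (simp_all add: differentiable_on_eq_differentiable_at)
qed

lemma inner_sym_matrix:
  "Finite_Cartesian_Product.transpose M = M \<Longrightarrow> u \<bullet> (M *v v) = v \<bullet> (M *v u)" for M :: "real ^ 'n ^ 'n"
  by (metis dot_lmul_matrix inner_commute transpose_matrix_vector)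

context spin_manifold8
begin

lemma differentiable_tangent_conn:
  assumes a: "a \<in> I" and x: "x \<in> \<phi> a ` U a" and ij: "i < 8" "j < 8"
  shows "(\<lambda>y. tangent_conn g \<Gamma> e a k y (i, j)) differentiable (at x)"
  unfolding tangent_conn_def prod.case pderiv_at_def
  using smooth_on_differentiable[OF smooth_frame[OF a] open_range[OF a] x]
    smooth_on_differentiable(1)[OF smooth_connection[OF a] open_range[OF a] x]
    smooth_on_differentiable(1)[OF smooth_metric[OF a] open_range[OF a] x] ij
  by (intro differentiable_metric differentiable_add differentiable_matrix_vector_mult) auto

text \<open>
  Differentiate the constant functions \<open>g(e\<^sub>i, e\<^sub>j)\<close>; the derivative of the metric is expressed by the
  Christoffel matrices because the connection is metric.
\<close>

lemma tangent_conn_skew: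
  assumes a: "a \<in> I" and x: "x \<in> \<phi> a ` U a" and ij: "i < 8" "j < 8"
  shows "tangent_conn g \<Gamma> e a k x (i, j) = - tangent_conn g \<Gamma> e a k x (j, i)"
proof -
  let ?S = "\<phi> a ` U a" and ?g = "g a x" and ?k = "axis k 1 :: real ^ 8"
  let ?D = "\<lambda>f. frechet_derivative f (at x)"
  have S: "open ?S" by (rule open_range[OF a])
  have e: "(e a i has_derivative ?D (e a i)) (at x)" "(e a j has_derivative ?D (e a j)) (at x)"
    and g: "(g a has_derivative ?D (g a)) (at x)"
    using smooth_on_differentiable(1)[OF smooth_frame[OF a] S x] smooth_on_differentiable(1)[OF smooth_metric[OF a] S x] ij
    by (auto simp: frechet_derivative_works)
  have sym: "u \<bullet> (?g *v v) = v \<bullet> (?g *v u)" for u v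
    by (rule inner_sym_matrix[OF sym_metric[OF a x]])
  have "((\<lambda>y. u \<bullet> (g a y *v v)) has_derivative (\<lambda>t. u \<bullet> (?D (g a) t *v v))) (at x)" for u v
    using has_derivative_metric[OF has_derivative_const[of u] g has_derivative_const[of v]] by simp
  from pderiv_at_eqI[OF this] have dg: "u \<bullet> (?D (g a) ?k *v v) = (\<Gamma> a k x *v u) \<bullet> (?g *v v) + u \<bullet> (?g *v (\<Gamma> a k x *v v))" for u v
    using metric_connection[OF a x, of k u v] by simp
  have "((\<lambda>y. e a i y \<bullet> (g a y *v e a j y)) has_derivative (\<lambda>t. 0)) (at x)"
    by (rule has_derivative_transform_within_open[OF has_derivative_const S x])
       (simp add: orthonormal_frame[OF a _ ij])
  moreover note has_derivative_metric[OF e(1) g e(2)]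
  ultimately have "(\<lambda>t. e a i x \<bullet> (?g *v ?D (e a j) t + ?D (g a) t *v e a j x) + ?D (e a i) t \<bullet> (?g *v e a j x)) = (\<lambda>t. 0)"
    by (rule has_derivative_unique[symmetric])
  from fun_cong[OF this, of ?k]
  have "e a i x \<bullet> (?g *v ?D (e a j) ?k) + e a i x \<bullet> (?D (g a) ?k *v e a j x) + ?D (e a i) ?k \<bullet> (?g *v e a j x) = 0"
    by (simp add: inner_add_right)
  then show ?thesis
    unfolding dg tangent_conn_def prod.case pderiv_at_def inner_add_left
    using sym[of "e a i x" "?D (e a j) ?k"] sym[of "e a i x" "\<Gamma> a k x *v e a j x"] by simp
qed

end


section \<open>Forms modulo degree greater than 8\<close>

text \<open>
  For \<open>p\<close> of degree at least \<open>4\<close> and \<open>q\<close> of degree at least \<open>8\<close> these forms are closed under multiplication.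
  Thus all computations below take place in \<open>\<complex>[p, q]/(p\<^sup>3, p q, q\<^sup>2)\<close>.
\<close>

definition jet :: "8 evform \<Rightarrow> 8 evform \<Rightarrow> complex \<Rightarrow> complex \<Rightarrow> complex \<Rightarrow> complex \<Rightarrow> 8 evform" where
  "jet p q a b c d = const_form a + const_form b * p + const_form c * q + const_form d * (p * p)"

lemma jet_mult:
  assumes p: "of_degree_ge 4 p" and q: "of_degree_ge 8 q"
  shows "jet p q a b c d * jet p q a' b' c' d' =
    jet p q (a * a') (a * b' + b * a') (a * c' + c * a') (a * d' + b * b' + d * a')"
proof -
  define r where "r = p * p"
  have r: "of_degree_ge 8 r"
    using of_degree_ge_mult[OF p p] by (simp add: r_def)
  have 0: "p * q = 0" "p * r = 0"
    by (rule of_degree_ge_imp_0, rule of_degree_ge_mult[OF p q] of_degree_ge_mult[OF p r], simp)+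
  have 1: "q * q = 0" "q * r = 0" "r * r = 0"
    by (rule of_degree_ge_imp_0, rule of_degree_ge_mult[OF q q] of_degree_ge_mult[OF q r]
        of_degree_ge_mult[OF r r], simp)+
  have "jet p q a b c d * jet p q a' b' c' d' =
      jet p q (a * a') (a * b' + b * a') (a * c' + c * a') (a * d' + b * b' + d * a') +
      ((const_form b * const_form c' + const_form c * const_form b') * (p * q)
      + (const_form b * const_form d' + const_form d * const_form b') * (p * r)
      + const_form c * const_form c' * (q * q)
      + (const_form c * const_form d' + const_form d * const_form c') * (q * r)
      + const_form d * const_form d' * (r * r))"
    unfolding jet_def const_form_add const_form_mult r_def[symmetric]
    by (simp only: distrib_left distrib_right add_ac mult_ac) (simp add: r_def mult_ac)
  then show ?thesis unfolding 0 1 by simp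
qed

lemma jet_add: "jet p q a b c d + jet p q a' b' c' d' = jet p q (a + a') (b + b') (c + c') (d + d')"
  by (simp add: jet_def const_form_add algebra_simps)

lemma jet_diff: "jet p q a b c d - jet p q a' b' c' d' = jet p q (a - a') (b - b') (c - c') (d - d')"
  by (simp add: jet_def const_form_diff algebra_simps)

lemma jet_uminus: "- jet p q a b c d = jet p q (- a) (- b) (- c) (- d)"
  by (simp add: jet_def const_form_uminus algebra_simps)

lemma deg_part_jet: "deg_part 8 (jet p q a 0 c d) = const_form c * deg_part 8 q + const_form d * deg_part 8 (p * p)"
  unfolding jet_def by (simp add: deg_part_add deg_part_const_mult deg_part_const)

lemma jet_const_mult: "const_form z * jet p q a b c d = jet p q (z * a) (z * b) (z * c) (z * d)"
  by (simp add: jet_def const_form_mult algebra_simps)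

lemma jet_of_nat_mult: "of_nat n * jet p q a b c d = jet p q (of_nat n * a) (of_nat n * b) (of_nat n * c) (of_nat n * d)"
  using jet_const_mult[of "of_nat n"] by (simp add: const_form_of_nat)

lemma jet_numeral_mult: "numeral n * jet p q a b c d = jet p q (numeral n * a) (numeral n * b) (numeral n * c) (numeral n * d)"
  using jet_of_nat_mult[of "numeral n"] by simp

lemma jet_0: "jet p q 0 0 0 0 = 0" and jet_1: "jet p q 1 0 0 0 = 1"
  by (simp_all add: jet_def)

lemma jet_divide_nat:
  assumes "of_nat n * \<alpha> = jet p q a b c d" "n > 0"
  shows "\<alpha> = jet p q (a / of_nat n) (b / of_nat n) (c / of_nat n) (d / of_nat n)"
proof -
  have "const_form (1 / of_nat n) * (of_nat n * \<alpha>) = const_form (1 / of_nat n * of_nat n) * \<alpha>"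
    by (simp add: const_form_mult const_form_of_nat mult.assoc del: times_divide_eq_left)
  then have "\<alpha> = const_form (1 / of_nat n) * jet p q a b c d"
    using assms by simp
  then show ?thesis by (simp add: jet_const_mult)
qed

text \<open>
  Odd powers of a skew matrix are traceless, and the powers from the fifth on have degree at least \<open>10\<close>.
\<close>

lemma ktr_kseries_skew:
  fixes Y :: "nat \<Rightarrow> nat \<Rightarrow> 8 evform"
  assumes Y: "\<And>i j. i \<in> {..<8} \<Longrightarrow> j \<in> {..<8} \<Longrightarrow> of_degree_ge 2 (Y i j)"
    and skew: "\<And>i j. i \<in> {..<8} \<Longrightarrow> j \<in> {..<8} \<Longrightarrow> Y i j = - Y j i"
  shows "ktr {..<8} (kseries f {..<8} Y) =
    jet (ktr {..<8} (kpow {..<8} Y 2)) (ktr {..<8} (kpow {..<8} Y 4)) (8 * fps_nth f 0) (fps_nth f 2) (fps_nth f 4) 0"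
proof -
  have odd: "ktr {..<8} (kpow {..<8} Y k) = 0" if "odd k" for k
    by (rule ktr_kpow_odd_skew[OF skew _ that]) auto
  have big: "ktr {..<8} (kpow {..<8} Y k) = 0" if "k \<ge> 5" for k
    unfolding ktr_def
  proof (intro sum.neutral ballI)
    fix i :: nat assume "i \<in> {..<8}"
    then show "kpow {..<8} Y k i i = 0"
      using that by (intro of_degree_ge_imp_0[OF of_degree_ge_kpow[of "{..<8}" 2]] Y) auto
  qed
  have zero: "ktr {..<8} (kpow {..<8} Y 0) = 8"
    by (simp add: ktr_def kone_def)
  have "{..CARD(8)} = {0, 1, 2, 3, 4, 5, 6, 7, 8::nat}" by auto
  then have "ktr {..<8} (kseries f {..<8} Y) = const_form (fps_nth f 0) * 8 +
      (const_form (fps_nth f 2) * ktr {..<8} (kpow {..<8} Y 2) + const_form (fps_nth f 4) * ktr {..<8} (kpow {..<8} Y 4))"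
    unfolding ktr_kseries by (simp add: big odd zero del: kpow.simps)
  then show ?thesis
    by (simp add: jet_def const_form_mult const_form_numeral mult.commute add.assoc)
qed

lemma of_degree_ge_ktr_kpow:
  assumes "\<And>i j. i \<in> I \<Longrightarrow> j \<in> I \<Longrightarrow> of_degree_ge p (F i j)"
  shows "of_degree_ge (k * p) (ktr I (kpow I F k))"
  unfolding ktr_def by (intro of_degree_ge_sum of_degree_ge_kpow assms)


section \<open>The numerical expansions\<close>

text \<open>
  Compare coefficients in \<open>(z / sinh z) sinh z = z\<close>.
\<close>

lemma fps_z_over_sinh_coeffs:
  "fps_nth fps_z_over_sinh 0 = 1" "fps_nth fps_z_over_sinh 1 = 0" "fps_nth fps_z_over_sinh 2 = - 1 / 6"
  "fps_nth fps_z_over_sinh 3 = 0" "fps_nth fps_z_over_sinh 4 = 7 / 360"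
proof -
  define S :: "complex fps" where "S = fps_const (1 / 2) * (fps_exp 1 - fps_exp (- 1))"
  have S: "fps_nth S n = (1 - (- 1) ^ n) / (2 * fact n)" for n
    by (simp add: S_def diff_divide_distrib mult.commute)
  have "S \<noteq> 0" using S[of 1] by auto
  have "subdegree S = 1" by (rule subdegreeI) (auto simp: S)
  then have "S dvd fps_X" using \<open>S \<noteq> 0\<close> by (simp add: fps_dvd_iff)
  then have eq: "fps_z_over_sinh * S = fps_X"
    unfolding fps_z_over_sinh_def S_def[symmetric] by simp
  have nth: "(\<Sum>i=0..n. fps_nth fps_z_over_sinh i * fps_nth S (n - i)) = fps_nth fps_X n" for n
    using arg_cong[OF eq, of "\<lambda>f. fps_nth f n"] by (simp only: fps_mult_nth)
  show 0: "fps_nth fps_z_over_sinh 0 = 1"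
    using nth[of 1] by (simp add: S)
  show 1: "fps_nth fps_z_over_sinh 1 = 0"
    using nth[of 2] 0 by (simp add: S eval_nat_numeral)
  show 2: "fps_nth fps_z_over_sinh 2 = - 1 / 6"
    using nth[of 3] 0 1 by (simp add: S eval_nat_numeral add_eq_0_iff)
  show 3: "fps_nth fps_z_over_sinh 3 = 0"
    using nth[of 4] 0 1 2 by (simp add: S eval_nat_numeral)
  show "fps_nth fps_z_over_sinh 4 = 7 / 360"
    using nth[of 5] 0 1 2 3 by (simp add: S eval_nat_numeral add_eq_0_iff)
qed

lemma even_series_power:
  fixes f :: "complex fps"
  assumes "fps_nth f 0 = 1" "fps_nth f 1 = 0" "fps_nth f 2 = a" "fps_nth f 3 = 0" "fps_nth f 4 = b"
  shows "fps_nth (f ^ m) 0 = 1" "fps_nth (f ^ m) 1 = 0" "fps_nth (f ^ m) 2 = of_nat m * a"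
    "fps_nth (f ^ m) 3 = 0" "fps_nth (f ^ m) 4 = of_nat m * b + of_nat m * (of_nat m - 1) / 2 * a\<^sup>2"
proof -
  have "fps_nth (f ^ m) 0 = 1 \<and> fps_nth (f ^ m) 1 = 0 \<and> fps_nth (f ^ m) 2 = of_nat m * a \<and>
    fps_nth (f ^ m) 3 = 0 \<and> fps_nth (f ^ m) 4 = of_nat m * b + of_nat m * (of_nat m - 1) / 2 * a\<^sup>2"
  proof (induction m)
    case (Suc m)
    have set: "{0..1} = {0, 1::nat}" "{0..2} = {0, 1, 2::nat}" "{0..3} = {0, 1, 2, 3::nat}" "{0..4} = {0, 1, 2, 3, 4::nat}"
      by auto
    show ?case
      using Suc assms
      by (simp add: fps_mult_nth set field_simps power2_eq_square)
  qed simp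
  then show "fps_nth (f ^ m) 0 = 1" "fps_nth (f ^ m) 1 = 0" "fps_nth (f ^ m) 2 = of_nat m * a"
    "fps_nth (f ^ m) 3 = 0" "fps_nth (f ^ m) 4 = of_nat m * b + of_nat m * (of_nat m - 1) / 2 * a\<^sup>2" by auto
qed

context
  fixes p q :: "8 evform"
  assumes p: "of_degree_ge 4 p" and q: "of_degree_ge 8 q"
begin

lemmas jet_simps = jet_mult[OF p q] jet_add jet_diff jet_uminus jet_numeral_mult

text \<open>
  The hypothesis is the expansion of \<open>tr exp (m Y)\<close>.  The parameters \<open>u\<close> and \<open>v\<close> are \<open>1/2\<close> and \<open>1/24\<close> for the
  tangent bundle and \<open>0\<close> for the trivial bundle, so both are covered by one computation.
\<close>

lemma power_sums_cycle_sum: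
  fixes u v :: complex
  assumes I: "finite I" and psi: "\<And>m. ktr I (kpow I G m) = jet p q 8 (u * of_nat m ^ 2) (v * of_nat m ^ 4) 0"
  shows "cycle_sum (- 1) 1 I G = jet p q 8 u v 0"
    and "cycle_sum (- 1) 2 I G = jet p q 56 (12 * u) 0 (u\<^sup>2)"
    and "cycle_sum (- 1) 3 I G = jet p q 336 (90 * u) (- 54 * v) (12 * u\<^sup>2)"
    and "cycle_sum (- 1) 4 I G = jet p q 1680 (480 * u) (- 384 * v) (72 * u\<^sup>2)"
    and "cycle_sum 1 1 I G = jet p q 8 u v 0"
    and "cycle_sum 1 2 I G = jet p q 72 (20 * u) (32 * v) (u\<^sup>2)"
proof -
  note newt = newton_identity[where I = I and G = G, OF _ I, unfolded psi]
  note sums = atMost_nat_numeral atMost_0 cycle_sum_0 fact_numeral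
  show c1: "cycle_sum (- 1) 1 I G = jet p q 8 u v 0"
    using newt[of "- 1" 0] by (simp add: cycle_sum_0)
  show c2: "cycle_sum (- 1) 2 I G = jet p q 56 (12 * u) 0 (u\<^sup>2)"
    using newt[of "- 1" 1] c1
    by (simp add: sums jet_simps numeral_2_eq_2[symmetric] power2_eq_square)
  show c3: "cycle_sum (- 1) 3 I G = jet p q 336 (90 * u) (- 54 * v) (12 * u\<^sup>2)"
    using newt[of "- 1" 2] c1 c2
    by (simp add: sums jet_simps power2_eq_square)
  show "cycle_sum (- 1) 4 I G = jet p q 1680 (480 * u) (- 384 * v) (72 * u\<^sup>2)"
    using newt[of "- 1" 3] c1 c2 c3
    by (simp add: sums jet_simps power2_eq_square)
  show d1: "cycle_sum 1 1 I G = jet p q 8 u v 0"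
    using newt[of 1 0] by (simp add: cycle_sum_0)
  show "cycle_sum 1 2 I G = jet p q 72 (20 * u) (32 * v) (u\<^sup>2)"
    using newt[of 1 1] d1
    by (simp add: sums jet_simps numeral_2_eq_2[symmetric] power2_eq_square)
qed

text \<open>
  The hypothesis is the expansion of \<open>tr (1 + N)\<^sup>m\<close> for \<open>N = a Y\<^sup>2 + b Y\<^sup>4\<close>.  The jet in the conclusion is
  \<open>1 + tr N + ((tr N)\<^sup>2 - tr N\<^sup>2)/2\<close>, which is \<open>det (1 + N)\<close> up to degree \<open>8\<close>.
\<close>

lemma power_sums_det:
  fixes a b :: complex
  assumes I: "finite I"
    and psi: "\<And>m. ktr I (kpow I G m) = jet p q 8 (of_nat m * a) (of_nat m * b + of_nat m * (of_nat m - 1) / 2 * a\<^sup>2) 0"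
  shows "cycle_sum (- 1) 8 I G = of_nat (fact 8) * jet p q 1 a (b - a\<^sup>2 / 2) (a\<^sup>2 / 2)"
proof -
  note newt = newton_identity[where I = I and G = G and e = "- 1", OF _ I, unfolded psi]
  note sums = atMost_nat_numeral atMost_0 cycle_sum_0 fact_numeral jet_simps power2_eq_square
  have c1: "cycle_sum (- 1) 1 I G = jet p q 8 a b 0"
    using newt[of 0] by (simp add: cycle_sum_0)
  have c2: "cycle_sum (- 1) 2 I G = jet p q 56 (14 * a) (14 * b - a\<^sup>2) (a\<^sup>2)"
    using newt[of 1] c1
    by (simp add: sums numeral_2_eq_2[symmetric])
  have c3: "cycle_sum (- 1) 3 I G = jet p q 336 (126 * a) (126 * b - 18 * a\<^sup>2) (18 * a\<^sup>2)"
    using newt[of 2] c1 c2 by (simp add: sums)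
  have c4: "cycle_sum (- 1) 4 I G = jet p q 1680 (840 * a) (840 * b - 180 * a\<^sup>2) (180 * a\<^sup>2)"
    using newt[of 3] c1 c2 c3 by (simp add: sums)
  have c5: "cycle_sum (- 1) 5 I G = jet p q 6720 (4200 * a) (4200 * b - 1200 * a\<^sup>2) (1200 * a\<^sup>2)"
    using newt[of 4] c1 c2 c3 c4 by (simp add: sums)
  have c6: "cycle_sum (- 1) 6 I G = jet p q 20160 (15120 * a) (15120 * b - 5400 * a\<^sup>2) (5400 * a\<^sup>2)"
    using newt[of 5] c1 c2 c3 c4 c5 by (simp add: sums)
  have c7: "cycle_sum (- 1) 7 I G = jet p q 40320 (35280 * a) (35280 * b - 15120 * a\<^sup>2) (15120 * a\<^sup>2)"
    using newt[of 6] c1 c2 c3 c4 c5 c6 by (simp add: sums)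
  have "cycle_sum (- 1) 8 I G = jet p q 40320 (40320 * a) (40320 * b - 20160 * a\<^sup>2) (20160 * a\<^sup>2)"
    using newt[of 7] c1 c2 c3 c4 c5 c6 c7 by (simp add: sums)
  then show ?thesis by (simp add: fact_numeral jet_numeral_mult right_diff_distrib)
qed

end


section \<open>The characteristic forms of a spin manifold\<close>

lemma ktr_kpow_kseries:
  fixes F :: "'i \<Rightarrow> 'i \<Rightarrow> 'n::{finite,linorder} evform"
  assumes "\<And>i j. i \<in> I \<Longrightarrow> j \<in> I \<Longrightarrow> of_degree_ge 2 (F i j)" "finite I"
  shows "ktr I (kpow I (kseries f I F) m) = ktr I (kseries (f ^ m) I F)"
  unfolding ktr_def by (intro sum.cong refl kpow_kseries assms)

lemma A_hat_eq_jet: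
  fixes E :: "('i, 'm, 8) vbundle"
  assumes rank: "rank E = 8"
    and skew: "\<And>i j. i < 8 \<Longrightarrow> j < 8 \<Longrightarrow> chern_form E a x i j = - chern_form E a x j i"
  defines "p \<equiv> ktr {..<8} (kpow {..<8} (chern_form E a x) 2)" and "q \<equiv> ktr {..<8} (kpow {..<8} (chern_form E a x) 4)"
  shows "A_hat E a x = jet p q 1 (- 1 / 48) (1 / 5760) (1 / 4608)"
proof -
  let ?Y = "chern_form E a x"
  let ?M = "fps_mat fps_z_over_sinh (const_form (\<i> / (4 * pi)) \<cdot>\<^sub>m curvature E a x)"
  define f where "f = Abs_fps (\<lambda>k. fps_nth fps_z_over_sinh k * (1 / 2) ^ k)"
  have p: "of_degree_ge 4 p" and q: "of_degree_ge 8 q"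
    using of_degree_ge_ktr_kpow[of "{..<8}" 2 ?Y 2] of_degree_ge_ktr_kpow[of "{..<8}" 2 ?Y 4]
    by (simp_all add: p_def q_def of_degree_ge_chern_form del: kpow.simps)
  have f: "fps_nth f 0 = 1" "fps_nth f 1 = 0" "fps_nth f 2 = - 1 / 24" "fps_nth f 3 = 0" "fps_nth f 4 = 7 / 5760"
    using fps_z_over_sinh_coeffs by (simp_all add: f_def power_divide mult.commute)
  have M: "?M \<in> carrier_mat 8 8"
    by (simp add: fps_mat_def curvature_def rank)
  \<comment> \<open>the argument of the series is \<open>Y/2\<close>\<close>
  have half: "\<i> / complex_of_real (4 * pi) = 1 / 2 * (\<i> / complex_of_real (2 * pi))" by simp
  have M_index: "?M $$ (i, j) = kseries f {..<8} ?Y i j" if "i < 8" "j < 8" for i j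
    unfolding half using that by (subst fps_mat_curvature_index) (simp_all add: rank kseries_def f_def)
  have "ktr {..<8} (kpow {..<8} (\<lambda>i j. ?M $$ (i, j)) m) =
      jet p q 8 (of_nat m * (- 1 / 24)) (of_nat m * (7 / 5760) + of_nat m * (of_nat m - 1) / 2 * (- 1 / 24)\<^sup>2) 0" for m
  proof -
    have "ktr {..<8} (kpow {..<8} (\<lambda>i j. ?M $$ (i, j)) m) = ktr {..<8} (kpow {..<8} (kseries f {..<8} ?Y) m)"
      unfolding ktr_def by (intro sum.cong refl kpow_cong) (rule M_index, simp_all)
    also have "\<dots> = ktr {..<8} (kseries (f ^ m) {..<8} ?Y)"
      by (intro ktr_kpow_kseries of_degree_ge_chern_form) simp
    also have "\<dots> = jet p q (8 * fps_nth (f ^ m) 0) (fps_nth (f ^ m) 2) (fps_nth (f ^ m) 4) 0"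
      unfolding p_def q_def by (rule ktr_kseries_skew) (auto simp: of_degree_ge_chern_form intro: skew)
    finally show ?thesis
      unfolding even_series_power[OF f] by simp
  qed
  note det = power_sums_det[OF p q _ this]
  have "of_nat (fact 8) * Determinant.det ?M = of_nat (fact 8) * jet p q 1 (- 1 / 24) (7 / 5760 - (- 1 / 24)\<^sup>2 / 2) ((- 1 / 24)\<^sup>2 / 2)"
    unfolding det_eq_cycle_sum[OF M] by (rule det) simp
  also have "\<dots> = jet p q (of_nat (fact 8) * 1) (of_nat (fact 8) * (- 1 / 24)) (of_nat (fact 8) * (7 / 5760 - (- 1 / 24)\<^sup>2 / 2))
      (of_nat (fact 8) * ((- 1 / 24)\<^sup>2 / 2))"
    by (rule jet_of_nat_mult)
  finally have det_eq: "Determinant.det ?M = jet p q 1 (- 1 / 24) (7 / 5760 - (- 1 / 24)\<^sup>2 / 2) ((- 1 / 24)\<^sup>2 / 2)"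
    by (drule_tac jet_divide_nat) simp_all
  define v where "v = jet p q 0 (- 1 / 24) (1 / 2880) (1 / 1152)"
  from det_eq have v: "Determinant.det ?M - 1 = v"
    unfolding v_def jet_1[of p q, symmetric] by (simp add: power2_eq_square jet_diff)
  have v2: "v ^ 2 = jet p q 0 0 0 (1 / 576)"
    by (simp add: v_def power2_eq_square jet_mult[OF p q])
  have v3: "v ^ k = 0" if "k \<ge> 3" for k
  proof -
    have "v ^ k = v ^ 2 * v * v ^ (k - 3)"
      using that by (simp add: power_add[symmetric] power_Suc2[symmetric] del: power_Suc)
    moreover have "v ^ 2 * v = 0"
      unfolding v2 by (simp add: v_def jet_mult[OF p q] jet_0)
    ultimately show ?thesis by simp
  qed
  \<comment> \<open>the binomial series of the square root is needed up to the second order, as \<open>v\<^sup>3 = 0\<close>\<close>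
  have gchoose_2: "(1 / 2 :: complex) gchoose 2 = - 1 / 8"
    by (simp add: gbinomial_prod_rev numeral_2_eq_2)
  have "{..CARD(8)} = {0, 1, 2, 3, 4, 5, 6, 7, 8::nat}" by auto
  then have "A_hat E a x = 1 + (const_form (1 / 2) * v + const_form (- 1 / 8) * v ^ 2)"
    unfolding A_hat_def fps_form_def v
    by (simp add: v3 gchoose_2)
  also have "\<dots> = jet p q 1 (- 1 / 48) (1 / 5760) (1 / 4608)"
    unfolding v2 unfolding v_def jet_1[of p q, symmetric] jet_const_mult jet_add by simp
  finally show ?thesis .
qed

lemma ktr_kpow_kexp_skew:
  fixes Y :: "nat \<Rightarrow> nat \<Rightarrow> 8 evform"
  assumes Y: "\<And>i j. i \<in> {..<8} \<Longrightarrow> j \<in> {..<8} \<Longrightarrow> of_degree_ge 2 (Y i j)"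
    and skew: "\<And>i j. i \<in> {..<8} \<Longrightarrow> j \<in> {..<8} \<Longrightarrow> Y i j = - Y j i"
  shows "ktr {..<8} (kpow {..<8} (kexp 1 {..<8} Y) m) =
    jet (ktr {..<8} (kpow {..<8} Y 2)) (ktr {..<8} (kpow {..<8} Y 4)) 8 (1 / 2 * of_nat m ^ 2) (1 / 24 * of_nat m ^ 4) 0"
  unfolding kexp_eq_kseries
  by (subst ktr_kpow_kseries, rule Y, assumption+, simp, subst ktr_kseries_skew[OF Y skew], assumption+)
     (simp add: fps_exp_power_mult fact_numeral)

lemma ch_ext_sym_eq_jet:
  fixes E :: "('i, 'm, 8) vbundle"
  assumes E: "regular E a x" and rank: "rank E = 8" and p: "of_degree_ge 4 p" and q: "of_degree_ge 8 q"
    and psi: "\<And>m. ktr {..<8} (kpow {..<8} (kexp 1 {..<8} (chern_form E a x)) m)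
      = jet p q 8 (u * of_nat m ^ 2) (v * of_nat m ^ 4) 0"
  shows "ch_bundle E a x = jet p q 8 u v 0"
    and "ch_bundle (ext_bundle 0 E) a x = jet p q 1 0 0 0"
    and "ch_bundle (ext_bundle 1 E) a x = jet p q 8 u v 0"
    and "ch_bundle (ext_bundle 2 E) a x = jet p q 28 (6 * u) 0 (u\<^sup>2 / 2)"
    and "ch_bundle (ext_bundle 3 E) a x = jet p q 56 (15 * u) (- 9 * v) (2 * u\<^sup>2)"
    and "ch_bundle (ext_bundle 4 E) a x = jet p q 70 (20 * u) (- 16 * v) (3 * u\<^sup>2)"
    and "ch_bundle (sym_bundle 0 E) a x = jet p q 1 0 0 0"
    and "ch_bundle (sym_bundle 1 E) a x = jet p q 8 u v 0"
    and "ch_bundle (sym_bundle 2 E) a x = jet p q 36 (10 * u) (16 * v) (u\<^sup>2 / 2)"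
proof -
  note ext = ch_bundle_ext_bundle[OF E, unfolded rank]
  note sym = ch_bundle_sym_bundle[OF E, unfolded rank]
  note c = power_sums_cycle_sum[OF p q finite_lessThan psi]
  show "ch_bundle (ext_bundle 0 E) a x = jet p q 1 0 0 0" "ch_bundle (sym_bundle 0 E) a x = jet p q 1 0 0 0"
    using ext[of 0] sym[of 0] by (simp_all add: cycle_sum_0 jet_1)
  show e1: "ch_bundle (ext_bundle 1 E) a x = jet p q 8 u v 0" and "ch_bundle (sym_bundle 1 E) a x = jet p q 8 u v 0"
    using ext[of 1] sym[of 1] c by simp_all
  show "ch_bundle E a x = jet p q 8 u v 0"
    using psi[of 1] unfolding ch_bundle_eq_ktr rank by (simp add: ktr_def kmul_kone_left)
  show "ch_bundle (ext_bundle 2 E) a x = jet p q 28 (6 * u) 0 (u\<^sup>2 / 2)"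
    using jet_divide_nat[OF trans[OF ext c(2)]] by (simp add: fact_numeral)
  show "ch_bundle (ext_bundle 3 E) a x = jet p q 56 (15 * u) (- 9 * v) (2 * u\<^sup>2)"
    using jet_divide_nat[OF trans[OF ext c(3)]] by (simp add: fact_numeral)
  show "ch_bundle (ext_bundle 4 E) a x = jet p q 70 (20 * u) (- 16 * v) (3 * u\<^sup>2)"
    using jet_divide_nat[OF trans[OF ext c(4)]] by (simp add: fact_numeral)
  show "ch_bundle (sym_bundle 2 E) a x = jet p q 36 (10 * u) (16 * v) (u\<^sup>2 / 2)"
    using jet_divide_nat[OF trans[OF sym c(6)]] by (simp add: fact_numeral)
qed

text \<open>
  The spinor curvature is \<open>spin Y\<close>, whose powers have the traces \<open>16\<close>, \<open>0\<close>, \<open>2p\<close>, \<open>0\<close> and \<open>3p\<^sup>2/4 - q\<close>.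
\<close>

lemma ch_spinor_eq_jet:
  fixes E D :: "('i, 'm, 8) vbundle"
  assumes c: "clifford8 c"
    and skew: "\<And>i j. i < 8 \<Longrightarrow> j < 8 \<Longrightarrow> chern_form E a x i j = - chern_form E a x j i"
    and D: "rank D = 16"
    and spin: "\<And>p q. p < 16 \<Longrightarrow> q < 16 \<Longrightarrow> chern_form D a x p q =
      clifford_kernels.spin {..<8} {..<16} (\<lambda>i p q. const_form (c i $$ (p, q))) (const_form (1 / 4)) (chern_form E a x) p q"
  defines "p \<equiv> ktr {..<8} (kpow {..<8} (chern_form E a x) 2)" and "q \<equiv> ktr {..<8} (kpow {..<8} (chern_form E a x) 4)"
  shows "ch_bundle D a x = jet p q 16 1 (- 1 / 24) (1 / 32)"
proof -
  interpret F: clifford_kernels "{..<8}" "{..<16}" "\<lambda>i p q. const_form (c i $$ (p, q)) :: 8 evform" "const_form (1 / 4)"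
    by (rule clifford_kernels_evform[OF c])
  let ?Y = "chern_form E a x"
  let ?t = "\<lambda>k. ktr {..<16} (kpow {..<16} (chern_form D a x) k)"
  have "F.skew ?Y" unfolding F.skew_def using skew by blast
  note t = F.spin_trace_values[OF this, folded p_def q_def]
  have t_eq: "?t k = F.spin_trace ?Y k" for k
    unfolding F.spin_trace_def ktr_def by (intro sum.cong refl kpow_cong) (auto simp: spin)
  have big: "?t k = 0" if "k \<ge> 5" for k
    unfolding ktr_def
  proof (intro sum.neutral ballI)
    fix i :: nat assume "i \<in> {..<16}"
    then show "kpow {..<16} (chern_form D a x) k i i = 0"
      using that by (intro of_degree_ge_imp_0[OF of_degree_ge_kpow[of "{..<16}" 2]] of_degree_ge_chern_form) auto
  qed
  have "of_nat 4 * F.spin_trace ?Y 4 = jet p q 0 0 (- 4) 3"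
    using t(5) by (simp add: jet_def const_form_uminus const_form_numeral)
  then have t4: "F.spin_trace ?Y 4 = jet p q 0 0 (- 1) (3 / 4)"
    by (drule_tac jet_divide_nat) simp_all
  have t2: "F.spin_trace ?Y 2 = jet p q 0 2 0 0" and t0: "F.spin_trace ?Y 0 = jet p q 16 0 0 0"
    using t by (simp_all add: jet_def const_form_numeral)
  have "{..CARD(8)} = {0, 1, 2, 3, 4, 5, 6, 7, 8::nat}" by auto
  then have "ch_bundle D a x = ?t 0 + (?t 1 + (const_form (1 / 2) * ?t 2 + (const_form (1 / 6) * ?t 3 + const_form (1 / 24) * ?t 4)))"
    unfolding ch_bundle_eq_ktr ktr_kexp D by (simp add: big fact_numeral del: kpow.simps)
  also have "\<dots> = jet p q 16 1 (- 1 / 24) (1 / 32)"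
    unfolding t_eq t2 t4 t0 using t by (simp add: jet_const_mult jet_add)
  finally show ?thesis .
qed

context spin_manifold8
begin

abbreviation "TC_bundle \<equiv> complex_tangent_bundle U \<phi> g \<Gamma> e"

lemma conn_kernel_tangent:
  "i < 8 \<Longrightarrow> j < 8 \<Longrightarrow> conn_kernel TC_bundle a k y i j = of_real (tangent_conn g \<Gamma> e a k y (i, j))"
  by (simp add: conn_kernel_def complex_tangent_bundle_def)

lemma regular_tangent:
  assumes "a \<in> I" "x \<in> \<phi> a ` U a"
  shows "regular TC_bundle a x"
proof -
  have "(\<lambda>y. complex_of_real (tangent_conn g \<Gamma> e a k y (i, j))) differentiable (at x)" if "i < 8" "j < 8" for k i j
    using differentiable_tangent_conn[OF assms that] bounded_linear.has_derivative[OF bounded_linear_of_real]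
    unfolding differentiable_def by blast
  then show ?thesis by (simp add: regular_def complex_tangent_bundle_def)
qed

lemma chern_form_tangent_skew:
  assumes a: "a \<in> I" and x: "x \<in> \<phi> a ` U a" and ij: "i < 8" "j < 8"
  shows "chern_form TC_bundle a x i j = - chern_form TC_bundle a x j i"
proof (rule chern_form_skew[OF regular_tangent[OF a x] open_range[OF a] x])
  have r: "rank TC_bundle = 8" by (simp add: complex_tangent_bundle_def)
  show "i < rank TC_bundle" "j < rank TC_bundle" using ij by (simp_all add: r)
  fix y k i j assume "y \<in> \<phi> a ` U a" "i < rank TC_bundle" "j < rank TC_bundle"
  then show "conn_kernel TC_bundle a k y i j = - conn_kernel TC_bundle a k y j i"
    using tangent_conn_skew[OF a, of y i j k] by (simp add: r conn_kernel_tangent)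
qed

lemma spinor_bundle_spin:
  assumes a: "a \<in> I" and x: "x \<in> \<phi> a ` U a"
  defines "\<Delta> \<equiv> spinor_bundle g \<Gamma> e c \<sigma>"
  shows "regular \<Delta> a x"
    and "p < 16 \<Longrightarrow> q < 16 \<Longrightarrow> chern_form \<Delta> a x p q =
      clifford_kernels.spin {..<8} {..<16} (\<lambda>i p q. const_form (c i $$ (p, q))) (const_form (1 / 4)) (chern_form TC_bundle a x) p q"
proof -
  interpret C: clifford_kernels "{..<8}" "{..<16}" "\<lambda>i p q. c i $$ (p, q)" "1 / 4"
    by (rule clifford_kernels_complex[OF clifford])
  have r: "rank TC_bundle = 8" by (simp add: complex_tangent_bundle_def)
  have \<Delta>: "rank \<Delta> = 16" "conn \<Delta> a k y \<in> carrier_mat 16 16" for k y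
    by (simp_all add: \<Delta>_def spinor_bundle_def spin_lift_def)
  have cc: "c i \<in> carrier_mat 16 16" if "i < 8" for i
    using clifford that by (simp add: clifford8_def)
  have conn: "conn_kernel \<Delta> a k y p q = C.spin (conn_kernel TC_bundle a k y) p q" if "p < 16" "q < 16" for k y p q
  proof -
    have "conn_kernel \<Delta> a k y p q =
        - (1 / 4) * (\<Sum>i<8. \<Sum>j<8. of_real (tangent_conn g \<Gamma> e a k y (i, j)) * (c i * c j) $$ (p, q))"
      using that by (simp add: conn_kernel_def \<Delta>_def spinor_bundle_def spin_lift_def)
    also have "\<dots> = C.spin (conn_kernel TC_bundle a k y) p q"
      unfolding C.spin_def
      by (intro arg_cong2[where f = "(*)"] sum.cong refl) (use that in \<open>auto simp: conn_kernel_tangent mat_mult_kmul[OF cc cc] simp del: index_mult_mat\<close>)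
    finally show ?thesis .
  qed
  have skew: "conn_kernel TC_bundle a k x i j = - conn_kernel TC_bundle a k x j i" if "i < 8" "j < 8" for k i j
    using tangent_conn_skew[OF a x that, of k] that by (simp add: conn_kernel_tangent)
  note * = chern_form_spin[OF clifford regular_tangent[OF a x] r \<Delta> conn skew]
  show "regular \<Delta> a x" by (rule *(1))
  show "chern_form \<Delta> a x p q = clifford_kernels.spin {..<8} {..<16} (\<lambda>i p q. const_form (c i $$ (p, q)))
      (const_form (1 / 4)) (chern_form TC_bundle a x) p q" if "p < 16" "q < 16"
    by (rule *(2)[OF _ _ _ _ that]) auto
qed

end


section \<open>The two identities\<close>

text \<open>
  The trivial bundle contributes the series \<open>(1 + t)\<^sup>-\<^sup>8\<close> to the exterior powers and \<open>(1 - t)\<^sup>8\<close> to the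
  symmetric powers of \<open>W\<close>.
\<close>

lemma ch_ext_virt_sym_virt_eq_jet:
  fixes E :: "('i, 'm, 8) vbundle"
  assumes E: "regular E a x" and rank: "rank E = 8" and p: "of_degree_ge 4 p" and q: "of_degree_ge 8 q"
    and psi: "\<And>m. ktr {..<8} (kpow {..<8} (kexp 1 {..<8} (chern_form E a x)) m)
      = jet p q 8 (1 / 2 * of_nat m ^ 2) (1 / 24 * of_nat m ^ 4) 0"
  defines "W \<equiv> Diff E (triv_bundle 8)"
  shows "regular_virt a x W" "\<And>i. regular_virt a x (ext_virt i W)" "\<And>i. regular_virt a x (sym_virt i W)"
    and "ch W a x = jet p q 0 (1 / 2) (1 / 24) 0"
    and "ch (ext_virt 2 W) a x = jet p q 0 (- 1) (- 1 / 3) (1 / 8)"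
    and "ch (ext_virt 4 W) a x = jet p q 0 (- 2) (- 8 / 3) (5 / 4)"
    and "ch (sym_virt 2 W) a x = jet p q 0 1 (1 / 3) (1 / 8)"
proof -
  let ?T = "triv_bundle 8 :: ('i, 'm, 8) vbundle"
  have T: "regular ?T a x" "rank ?T = 8" by (rule regular_triv_bundle) (simp add: triv_bundle_def)
  have zero: "kpow {..<8} (chern_form ?T a x) (Suc k) i i = 0" if "i < 8" for k i
    using that by (auto simp: kmul_def chern_form_triv_bundle intro!: sum.neutral)
  have psi0: "ktr {..<8} (kpow {..<8} (kexp 1 {..<8} (chern_form ?T a x)) m) = jet p q 8 (0 * of_nat m ^ 2) (0 * of_nat m ^ 4) 0" for m
  proof -
    have "ktr {..<8} (kpow {..<8} (chern_form ?T a x) k) = 0" if "k \<noteq> 0" for k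
      using zero[of _ "k - 1"] that by (simp add: ktr_def del: kpow.simps)
    then have "ktr {..<8} (kpow {..<8} (chern_form ?T a x) 2) = 0" "ktr {..<8} (kpow {..<8} (chern_form ?T a x) 4) = 0"
      by (simp_all del: kpow.simps)
    then show ?thesis
      by (subst ktr_kpow_kexp_skew) (simp_all add: of_degree_ge_chern_form chern_form_triv_bundle jet_def)
  qed
  note e = ch_ext_sym_eq_jet[OF E rank p q psi]
  note t = ch_ext_sym_eq_jet[OF T p q psi0]
  have reg: "regular_virt a x (virt_of (ext_bundle j E))" "regular_virt a x (virt_of (ext_bundle j ?T))"
    "regular_virt a x (virt_of (sym_bundle j E))" "regular_virt a x (virt_of (sym_bundle j ?T))" for j
    using E T by (auto intro!: regular_virt_of regular_ext_bundle regular_sym_bundle)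
  show "regular_virt a x W" by (simp add: W_def E T)
  show "regular_virt a x (ext_virt i W)" "regular_virt a x (sym_virt i W)" for i
    unfolding W_def ext_virt.simps sym_virt.simps by (intro regular_virt_series_quotient reg)+
  show "ch W a x = jet p q 0 (1 / 2) (1 / 24) 0"
    by (simp add: W_def e(1) t(1) jet_diff)
  have ext: "ch (ext_virt n W) a x = (\<Sum>j\<leftarrow>[0..<Suc n]. ch_bundle (ext_bundle j E) a x *
      inverse_seq (\<lambda>j. ch_bundle (ext_bundle j ?T) a x) (n - j))" for n
    unfolding W_def ext_virt.simps ch_series_quotient[OF reg(1,2)] ch_virt_of ..
  have sym: "ch (sym_virt n W) a x = (\<Sum>j\<leftarrow>[0..<Suc n]. ch_bundle (sym_bundle j E) a x *
      inverse_seq (\<lambda>j. ch_bundle (sym_bundle j ?T) a x) (n - j))" for n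
    unfolding W_def sym_virt.simps ch_series_quotient[OF reg(3,4)] ch_virt_of ..
  have upt: "[0..<2] = [0, 1]" "[0..<3] = [0, 1, 2]" "[0..<4] = [0, 1, 2, 3]" "[0..<5] = [0, 1, 2, 3, 4]"
    by (simp_all add: upt_rec)
  note jets = jet_mult[OF p q] jet_add jet_diff jet_uminus
  \<comment> \<open>the coefficients \<open>1, - 8, 36, - 120, 330\<close> of \<open>(1 + t)\<^sup>-\<^sup>8\<close>\<close>
  define i where "i = inverse_seq (\<lambda>j. ch_bundle (ext_bundle j ?T) a x)"
  have i: "i 0 = jet p q 1 0 0 0" "i (Suc n) = - (\<Sum>j\<leftarrow>[0..<Suc n]. ch_bundle (ext_bundle (Suc j) ?T) a x * i (n - j))" for n
    unfolding i_def by (simp_all only: inverse_seq.simps jet_1)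
  have i1: "i 1 = jet p q (- 8) 0 0 0"
    using i(2)[of 0] t i(1) by (simp add: jets)
  have i2: "i 2 = jet p q 36 0 0 0"
    using i(2)[of 1] t i(1) i1 by (simp add: upt jets numeral_2_eq_2[symmetric])
  have i3: "i 3 = jet p q (- 120) 0 0 0"
    using i(2)[of 2] t i(1) i1 i2 by (simp add: upt jets numeral_2_eq_2[symmetric])
  show "ch (ext_virt 2 W) a x = jet p q 0 (- 1) (- 1 / 3) (1 / 8)"
    using e i1 i2
    unfolding ext i_def[symmetric] by (simp add: upt jets i(1) power2_eq_square numeral_2_eq_2[symmetric])
  have i4: "i 4 = jet p q 330 0 0 0"
    using i(2)[of 3] t i(1) i1 i2 i3 by (simp add: upt jets numeral_2_eq_2[symmetric])
  show "ch (ext_virt 4 W) a x = jet p q 0 (- 2) (- 8 / 3) (5 / 4)"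
    using e i1 i2 i3 i4
    unfolding ext i_def[symmetric] by (simp add: upt jets i(1) power2_eq_square numeral_2_eq_2[symmetric])
  \<comment> \<open>the coefficients \<open>1, - 8, 28\<close> of \<open>(1 - t)\<^sup>8\<close>\<close>
  define s where "s = inverse_seq (\<lambda>j. ch_bundle (sym_bundle j ?T) a x)"
  have s: "s 0 = jet p q 1 0 0 0" "s (Suc n) = - (\<Sum>j\<leftarrow>[0..<Suc n]. ch_bundle (sym_bundle (Suc j) ?T) a x * s (n - j))" for n
    unfolding s_def by (simp_all only: inverse_seq.simps jet_1)
  have s1: "s 1 = jet p q (- 8) 0 0 0"
    using s(2)[of 0] t s(1) by (simp add: jets)
  have s2: "s 2 = jet p q 28 0 0 0"
    using s(2)[of 1] t s(1) s1 by (simp add: upt jets numeral_2_eq_2[symmetric])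
  show "ch (sym_virt 2 W) a x = jet p q 0 1 (1 / 3) (1 / 8)"
    using e s1 s2
    unfolding sym s_def[symmetric] by (simp add: upt jets s(1) power2_eq_square numeral_2_eq_2[symmetric])
qed

theorem theorem1p1:
  fixes I :: "'i set"
    and U :: "'i \<Rightarrow> 'm::{t2_space,second_countable_topology} set"
    and \<phi> :: "'i \<Rightarrow> 'm \<Rightarrow> real ^ 8"
    and g :: "'i \<Rightarrow> real ^ 8 \<Rightarrow> real ^ 8 ^ 8"
    and \<Gamma> :: "'i \<Rightarrow> 8 \<Rightarrow> real ^ 8 \<Rightarrow> real ^ 8 ^ 8"
    and e :: "'i \<Rightarrow> nat \<Rightarrow> real ^ 8 \<Rightarrow> real ^ 8"
    and c :: "nat \<Rightarrow> complex mat"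
    and \<sigma> :: "'i \<Rightarrow> 'i \<Rightarrow> 'm \<Rightarrow> complex mat"
    and TCX \<Delta> :: "('i, 'm, 8) vbundle"
    and W :: "('i, 'm, 8) virt"
    and A :: "8 evform"
  assumes "spin_manifold8 I U \<phi> g \<Gamma> e c \<sigma>"
    and "TCX = complex_tangent_bundle U \<phi> g \<Gamma> e"
    and "\<Delta> = spinor_bundle g \<Gamma> e c \<sigma>"
    and "W = Diff TCX (triv_bundle 8)"
    and "a \<in> I" and "x \<in> \<phi> a ` U a"
    and "A = A_hat TCX a x"
  shows "deg_part 8 (A * ch (virt_of \<Delta>) a x * ch (W + W) a x
             + 32 * A * ch (W + ext_virt 2 W) a x)
           = 240 * deg_part 8 (A * ch (virt_of \<Delta>) a x + 32 * A)
       \<and> deg_part 8 (A * ch (virt_of \<Delta>) a x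
               * ch (W + W + ext_virt 2 W + W * W + sym_virt 2 W) a x
             + 32 * A * ch (ext_virt 4 W + ext_virt 2 W * W + W * W + sym_virt 2 W + W) a x)
           = 2160 * deg_part 8 (A * ch (virt_of \<Delta>) a x + 32 * A)"
proof -
  interpret spin_manifold8 I U \<phi> g \<Gamma> e c \<sigma> by fact
  define Y where "Y = chern_form TCX a x"
  define p where "p = ktr {..<8} (kpow {..<8} Y 2)"
  define q where "q = ktr {..<8} (kpow {..<8} Y 4)"
  have p: "of_degree_ge 4 p" and q: "of_degree_ge 8 q"
    using of_degree_ge_ktr_kpow[of "{..<8}" 2 Y 2] of_degree_ge_ktr_kpow[of "{..<8}" 2 Y 4]
    by (simp_all add: p_def q_def Y_def of_degree_ge_chern_form del: kpow.simps)
  have rank: "rank TCX = 8" by (simp add: assms complex_tangent_bundle_def)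
  have reg: "regular TCX a x" unfolding assms(2) by (rule regular_tangent[OF assms(5,6)])
  have skew: "Y i j = - Y j i" if "i < 8" "j < 8" for i j
    unfolding Y_def assms(2) by (rule chern_form_tangent_skew[OF assms(5,6) that])
  have psi: "ktr {..<8} (kpow {..<8} (kexp 1 {..<8} (chern_form TCX a x)) m)
      = jet p q 8 (1 / 2 * of_nat m ^ 2) (1 / 24 * of_nat m ^ 4) 0" for m
    unfolding p_def q_def Y_def[symmetric]
    by (rule ktr_kpow_kexp_skew) (auto simp: Y_def of_degree_ge_chern_form intro: skew[unfolded Y_def])
  note W = ch_ext_virt_sym_virt_eq_jet[OF reg rank p q psi, folded assms(4)]
  have A: "A = jet p q 1 (- 1 / 48) (1 / 5760) (1 / 4608)"
    unfolding assms(7) p_def q_def Y_def by (rule A_hat_eq_jet[OF rank]) (rule skew[unfolded Y_def])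
  have \<Delta>: "ch (virt_of \<Delta>) a x = jet p q 16 1 (- 1 / 24) (1 / 32)"
    unfolding ch_virt_of p_def q_def Y_def
  proof (rule ch_spinor_eq_jet[OF clifford skew[unfolded Y_def]])
    show "rank \<Delta> = 16" by (simp add: assms spinor_bundle_def)
    fix p q :: nat assume "p < 16" "q < 16"
    then show "chern_form \<Delta> a x p q = clifford_kernels.spin {..<8} {..<16} (\<lambda>i p q. const_form (c i $$ (p, q)))
        (const_form (1 / 4)) (chern_form TCX a x) p q"
      unfolding assms(2,3) by (rule spinor_bundle_spin(2)[OF assms(5,6)])
  qed
  note reg_simps = regular_virt_add regular_virt_mult W(1-3)
  note ch_simps = ch_add ch_mult reg_simps W(4-7) A \<Delta> jet_mult[OF p q] jet_add jet_numeral_mult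
  have base: "A * ch (virt_of \<Delta>) a x + 32 * A = jet p q 48 0 (- 1 / 30) (1 / 48)"
    by (simp add: ch_simps)
  have first: "A * ch (virt_of \<Delta>) a x * ch (W + W) a x + 32 * A * ch (W + ext_virt 2 W) a x = jet p q 0 0 (- 8) 5"
    by (simp add: ch_simps)
  have second: "A * ch (virt_of \<Delta>) a x * ch (W + W + ext_virt 2 W + W * W + sym_virt 2 W) a x
      + 32 * A * ch (ext_virt 4 W + ext_virt 2 W * W + W * W + sym_virt 2 W + W) a x = jet p q 0 0 (- 72) 45"
    by (simp add: ch_simps)
  have deg: "numeral n * deg_part 8 (jet p q z 0 c d) = deg_part 8 (jet p q 0 0 (numeral n * c) (numeral n * d))" for n z c d
    by (simp add: deg_part_jet const_form_mult const_form_numeral distrib_left mult.assoc)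
  show ?thesis
    unfolding base first second deg by simp
qed

end
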